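(* Let $A$ be a finite-dimensional complex Hilbert space with orthonormal basis $\{|i\rangle\}_{i=1}^{|A|}$, let $A'$ be a Hilbert space isomorphic to $A$ with corresponding orthonormal basis $\{|i\rangle\}$, let $|\Phi\rangle=\sum_{i=1}^{|A|}|i\rangle\otimes|i\rangle\in A\otimes A'$ and $\Phi=|\Phi\rangle\langle\Phi|$. For any non-commutative graph $S\subseteq\mathcal{L}(A)$, $$\widetilde{\vartheta}(S)=\min\bigl\{\,\|\operatorname{Tr}_A Y\| \;:\; Y\in S\otimes\mathcal{L}(A'),\ Y\ge\Phi\,\bigr\}.$$ This minimization is the dual semidefinite programme of the following semidefinite programme with value $\widetilde\vartheta(S)$: maximize $\langle\Phi|(\mathbf{1}\otimes\rho+T')|\Phi\rangle$ subject to $T'\in S^\perp\otimes\mathcal{L}(A')$, $\operatorname{Tr}\rho=1$, $\mathbf{1}\otimes\rho+T'\ge0$, $\rho\ge0$ (with $\rho\in\mathcal{L}(A')$).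
   Context: $\mathcal{L}(A)$ is the space of linear operators on $A$, $|A|=\dim A$, and $\operatorname{Tr}_A:\mathcal{L}(A\otimes A')\to\mathcal{L}(A')$ is the partial trace. A non-commutative graph is a linear subspace $S\subseteq\mathcal{L}(A)$ with $\mathbf{1}\in S$ and $S=S^\dagger$. $S^\perp$ is the orthogonal complement in $\mathcal{L}(A)$ with respect to the Hilbert-Schmidt inner product $\operatorname{Tr}X^\dagger Y$. $\|\cdot\|$ is the operator norm. Define $\vartheta(S):=\max\{\|\mathbf{1}+T\|: T\in S^\perp,\ \mathbf{1}+T\ge 0\}$ and the quantum Lovász function $$\widetilde{\vartheta}(S):=\sup_{n\in\mathbb{N}}\vartheta\bigl(S\otimes\mathcal{L}(\mathbb{C}^n)\bigr)=\sup_n\max\{\|\mathbf{1}+T\|: T\in S^\perp\otimes\mathcal{L}(\mathbb{C}^n),\ \mathbf{1}+T\ge 0\}.$$ *)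

theory Defs
  imports
    "Jordan_Normal_Form.Schur_Decomposition"
    "Jordan_Normal_Form.VS_Connect"
    "HOL-Library.Extended_Real"
begin

section \<open>Operators on finite-dimensional Hilbert spaces\<close>

text \<open>
  A Hilbert space with a fixed orthonormal basis of size $m$ is identified with $\mathbb{C}^m$, and
  its operators with \<^term>\<open>carrier_mat m m :: complex mat set\<close>. The orthonormal basis
  $|i\rangle \otimes |k\rangle$ of a tensor product of an $m$- and an $n$-dimensional space is
  enumerated by $i n + k$ (both counted from 0).
\<close>

definition vnorm :: "complex vec \<Rightarrow> real" where
  "vnorm v = sqrt (Re (v \<bullet>c v))"

definition op_norm :: "complex mat \<Rightarrow> real" where
  "op_norm M = Sup {vnorm (M *\<^sub>v v) | v. v \<in> carrier_vec (dim_col M) \<and> vnorm v \<le> 1}"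

definition mtrace :: "complex mat \<Rightarrow> complex" where
  "mtrace M = (\<Sum>i<dim_row M. M $$ (i, i))"

definition herm_mat :: "nat \<Rightarrow> complex mat \<Rightarrow> bool" where
  "herm_mat m M \<longleftrightarrow> M \<in> carrier_mat m m \<and> mat_adjoint M = M"

text \<open>The order on complex numbers makes the quadratic form real-valued here, so positive
  semidefinite matrices are Hermitian.\<close>

definition psd :: "nat \<Rightarrow> complex mat \<Rightarrow> bool" where
  "psd m M \<longleftrightarrow> M \<in> carrier_mat m m \<and> (\<forall>v\<in>carrier_vec m. 0 \<le> (M *\<^sub>v v) \<bullet>c v)"

definition kron_vec :: "complex vec \<Rightarrow> complex vec \<Rightarrow> complex vec" where
  "kron_vec u v = vec (dim_vec u * dim_vec v) (\<lambda>k. u $ (k div dim_vec v) * v $ (k mod dim_vec v))"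

definition kron :: "complex mat \<Rightarrow> complex mat \<Rightarrow> complex mat" where
  "kron X Z = mat (dim_row X * dim_row Z) (dim_col X * dim_col Z)
     (\<lambda>(k, l). X $$ (k div dim_row Z, l div dim_col Z) * Z $$ (k mod dim_row Z, l mod dim_col Z))"

text \<open>Trace over the first, $m$-dimensional, factor.\<close>

definition ptrace_fst :: "nat \<Rightarrow> nat \<Rightarrow> complex mat \<Rightarrow> complex mat" where
  "ptrace_fst m n Y = mat n n (\<lambda>(k, l). \<Sum>i<m. Y $$ (i * n + k, i * n + l))"


section \<open>Spaces of operators\<close>

abbreviation mat_space :: "nat \<Rightarrow> (complex, complex mat) module" where
  "mat_space m \<equiv> module_mat TYPE(complex) m m"

definition tensor_space :: "nat \<Rightarrow> complex mat set \<Rightarrow> nat \<Rightarrow> complex mat set \<Rightarrow> complex mat set" where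
  "tensor_space m S n R =
     LinearCombinations.module.span class_ring (mat_space (m * n)) {kron X Z | X Z. X \<in> S \<and> Z \<in> R}"

text \<open>Orthogonal complement for the Hilbert--Schmidt inner product.\<close>

definition hs_perp :: "nat \<Rightarrow> complex mat set \<Rightarrow> complex mat set" where
  "hs_perp m S = {X \<in> carrier_mat m m. \<forall>Y\<in>S. mtrace (mat_adjoint X * Y) = 0}"

definition noncomm_graph :: "nat \<Rightarrow> complex mat set \<Rightarrow> bool" where
  "noncomm_graph m S \<longleftrightarrow>
     VectorSpace.subspace class_ring S (mat_space m) \<and> 1\<^sub>m m \<in> S \<and> mat_adjoint ` S = S"


section \<open>The quantum Lovasz function\<close>

definition lovasz_theta :: "nat \<Rightarrow> complex mat set \<Rightarrow> real" where
  "lovasz_theta m S =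
     (GREATEST x. x \<in> {op_norm (1\<^sub>m m + T) | T. T \<in> hs_perp m S \<and> psd m (1\<^sub>m m + T)})"

definition quantum_lovasz :: "nat \<Rightarrow> complex mat set \<Rightarrow> ereal" where
  "quantum_lovasz m S =
     (SUP n\<in>{1..}. ereal (lovasz_theta (m * n) (tensor_space m S n (carrier_mat n n))))"

definition ent_vec :: "nat \<Rightarrow> complex vec" where
  "ent_vec d = vec (d * d) (\<lambda>k. \<Sum>i<d. kron_vec (unit_vec d i) (unit_vec d i) $ k)"

definition ent_mat :: "nat \<Rightarrow> complex mat" where
  "ent_mat d = mat (d * d) (d * d) (\<lambda>(k, l). ent_vec d $ k * cnj (ent_vec d $ l))"

definition lovasz_min_feasible :: "nat \<Rightarrow> complex mat set \<Rightarrow> complex mat set" where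
  "lovasz_min_feasible d S =
     {Y \<in> tensor_space d S d (carrier_mat d d). psd (d * d) (Y - ent_mat d)}"


section \<open>Semidefinite programmes and their duals\<close>

text \<open>
  The programme: maximise a linear objective over a real vector space of variables, subject to
  affine Hermitian-matrix-valued constraints $G_j(x) \ge 0$ and affine scalar constraints
  $h_k(x) = 0$. Each $G_j$ comes with the size of its values.
\<close>

record 'x sdp =
  sdp_vars :: "'x set"
  sdp_obj :: "'x \<Rightarrow> real"
  sdp_psd :: "(nat \<times> ('x \<Rightarrow> complex mat)) list"
  sdp_eq :: "('x \<Rightarrow> real) list"

definition sdp_feasible :: "'x sdp \<Rightarrow> 'x set" where
  "sdp_feasible P = {x \<in> sdp_vars P.
     (\<forall>(m, G) \<in> set (sdp_psd P). psd m (G x)) \<and> (\<forall>h \<in> set (sdp_eq P). h x = 0)}"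

definition sdp_value :: "'x sdp \<Rightarrow> ereal" where
  "sdp_value P = (SUP x\<in>sdp_feasible P. ereal (sdp_obj P x))"

text \<open>
  The dual programme minimises \<open>sdp_dual_obj\<close> (the supremum of the Lagrangian over all variables)
  over a positive semidefinite multiplier for each matrix constraint and a real multiplier for each
  scalar constraint. The value \<open>\<infinity>\<close> expresses infeasibility.
\<close>

definition sdp_multipliers :: "'x sdp \<Rightarrow> (complex mat list \<times> real list) set" where
  "sdp_multipliers P = {(Zs, \<mu>s).
     list_all2 (\<lambda>(m, G) Z. psd m Z) (sdp_psd P) Zs \<and> length \<mu>s = length (sdp_eq P)}"

definition sdp_lagrangian :: "'x sdp \<Rightarrow> complex mat list \<Rightarrow> real list \<Rightarrow> 'x \<Rightarrow> real" where
  "sdp_lagrangian P Zs \<mu>s x = sdp_obj P x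
     + (\<Sum>j<length (sdp_psd P). Re (mtrace (Zs ! j * snd (sdp_psd P ! j) x)))
     + (\<Sum>k<length (sdp_eq P). \<mu>s ! k * (sdp_eq P ! k) x)"

definition sdp_dual_obj :: "'x sdp \<Rightarrow> complex mat list \<Rightarrow> real list \<Rightarrow> ereal" where
  "sdp_dual_obj P Zs \<mu>s = (SUP x\<in>sdp_vars P. ereal (sdp_lagrangian P Zs \<mu>s x))"

text \<open>
  The variables are pairs $(\rho, T')$. The positivity constraints force $\rho$ and $T'$ to be
  Hermitian, so restricting the real vector space of variables to Hermitian matrices does not
  change the feasible set (\<open>sdp_feasible_lovasz_sdp\<close> below).
\<close>

definition lovasz_sdp :: "nat \<Rightarrow> complex mat set \<Rightarrow> (complex mat \<times> complex mat) sdp" where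
  "lovasz_sdp d S = \<lparr>
     sdp_vars = {(\<rho>, T). herm_mat d \<rho> \<and> herm_mat (d * d) T \<and>
                   T \<in> tensor_space d (hs_perp d S) d (carrier_mat d d)},
     sdp_obj = (\<lambda>(\<rho>, T). Re (((kron (1\<^sub>m d) \<rho> + T) *\<^sub>v ent_vec d) \<bullet>c ent_vec d)),
     sdp_psd = [(d * d, \<lambda>(\<rho>, T). kron (1\<^sub>m d) \<rho> + T), (d, \<lambda>(\<rho>, T). \<rho>)],
     sdp_eq = [\<lambda>(\<rho>, T). Re (mtrace \<rho>) - 1]\<rparr>"

lemma tensor_space_carrier:
  assumes "S \<subseteq> carrier_mat m m" and "R \<subseteq> carrier_mat n n" and "T \<in> tensor_space m S n R"
  shows "T \<in> carrier_mat (m * n) (m * n)"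
proof -
  interpret vectorspace class_ring "mat_space (m * n)" by (rule matrix_vs)
  have "{kron X Z | X Z. X \<in> S \<and> Z \<in> R} \<subseteq> carrier (mat_space (m * n))"
    using assms(1,2) by (fastforce simp: module_mat_simps kron_def)
  from span_is_subset2[OF this] assms(3) show ?thesis
    unfolding tensor_space_def module_mat_simps by (rule subsetD)
qed

lemma herm_mat_iff:
  "herm_mat m M \<longleftrightarrow> M \<in> carrier_mat m m \<and> (\<forall>i<m. \<forall>j<m. M $$ (i, j) = cnj (M $$ (j, i)))"
proof -
  have "mat_adjoint M = M \<longleftrightarrow> (\<forall>i<m. \<forall>j<m. M $$ (i, j) = cnj (M $$ (j, i)))"
    if "M \<in> carrier_mat m m"
  proof -
    have *: "mat_adjoint M \<in> carrier_mat m m"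
      using that by (auto simp: mat_adjoint_def)
    have "mat_adjoint M $$ (i, j) = cnj (M $$ (j, i))" if "i < m" "j < m" for i j
      using that \<open>M \<in> carrier_mat m m\<close> by (auto simp: mat_adjoint_def mat_of_rows_index)
    with * that show ?thesis
      by (metis carrier_matD eq_matI)
  qed
  then show ?thesis by (auto simp: herm_mat_def)
qed

lemma herm_matD:
  assumes "herm_mat m M" "i < m" "j < m"
  shows "M $$ (i, j) = cnj (M $$ (j, i))"
  using assms unfolding herm_mat_iff by blast

lemma psd_imp_herm:
  assumes "psd m M"
  shows "herm_mat m M"
proof -
  have M: "M \<in> carrier_mat m m" using assms by (simp add: psd_def)
  have im: "Im ((M *\<^sub>v v) \<bullet>c v) = 0" if "v \<in> carrier_vec m" for v
    using assms that by (auto simp: psd_def less_eq_complex_def)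
  have ent: "(M *\<^sub>v unit_vec m j) \<bullet>c unit_vec m i = M $$ (i, j)" if "i < m" "j < m" for i j
  proof -
    have "conjugate (unit_vec m i :: complex vec) = unit_vec m i" by (auto simp: unit_vec_def)
    then show ?thesis using that M by simp
  qed
  have "M $$ (i, j) = cnj (M $$ (j, i))" if ij: "i < m" "j < m" for i j
  proof -
    have exp: "(M *\<^sub>v (unit_vec m i + c \<cdot>\<^sub>v unit_vec m j)) \<bullet>c (unit_vec m i + c \<cdot>\<^sub>v unit_vec m j)
        = M $$ (i, i) + c * M $$ (i, j) + cnj c * (M $$ (j, i) + c * M $$ (j, j))" for c
    proof -
      have u: "unit_vec m k \<in> carrier_vec m" for k by simp
      have Mu: "M *\<^sub>v unit_vec m k \<in> carrier_vec m" for k using M by simp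
      have cu: "conjugate (unit_vec m k :: complex vec) \<in> carrier_vec m" for k by simp
      have e1: "conjugate (unit_vec m i + c \<cdot>\<^sub>v unit_vec m j)
          = conjugate (unit_vec m i) + cnj c \<cdot>\<^sub>v conjugate (unit_vec m j)"
        by (auto simp: conjugate_vec_def)
      have e2: "M *\<^sub>v (unit_vec m i + c \<cdot>\<^sub>v unit_vec m j)
          = M *\<^sub>v unit_vec m i + c \<cdot>\<^sub>v (M *\<^sub>v unit_vec m j)"
        using M by (simp add: mult_add_distrib_mat_vec mult_mat_vec)
      have "(M *\<^sub>v unit_vec m i + c \<cdot>\<^sub>v (M *\<^sub>v unit_vec m j)) \<bullet>
             (conjugate (unit_vec m i) + cnj c \<cdot>\<^sub>v conjugate (unit_vec m j))
        = (M *\<^sub>v unit_vec m i) \<bullet>c unit_vec m i + c * ((M *\<^sub>v unit_vec m j) \<bullet>c unit_vec m i)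
          + cnj c * ((M *\<^sub>v unit_vec m i) \<bullet>c unit_vec m j
              + c * ((M *\<^sub>v unit_vec m j) \<bullet>c unit_vec m j))"
        using Mu cu
        by (simp add: add_scalar_prod_distrib[of _ m] scalar_prod_add_distrib[of _ m]
            smult_scalar_prod_distrib[of _ m] scalar_prod_smult_distrib[of _ m] algebra_simps)
      then show ?thesis unfolding e1 e2 using ent ij by simp
    qed
    have carr: "unit_vec m i + c \<cdot>\<^sub>v unit_vec m j \<in> carrier_vec m" for c :: complex by simp
    have "Im (M $$ (i, i)) = 0" "Im (M $$ (j, j)) = 0"
      using im[of "unit_vec m i"] im[of "unit_vec m j"] ent ij by auto
    moreover have "Im (M $$ (i, j)) + Im (M $$ (j, i)) = 0"
      using im[OF carr[of 1]] calculation unfolding exp by simp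
    moreover have "Re (M $$ (i, j)) = Re (M $$ (j, i))"
      using im[OF carr[of \<i>]] calculation unfolding exp by simp
    ultimately show ?thesis by (simp add: complex_eq_iff)
  qed
  then show ?thesis unfolding herm_mat_iff using M by blast
qed

lemma sdp_feasible_lovasz_sdp:
  "(\<rho>, T) \<in> sdp_feasible (lovasz_sdp d S) \<longleftrightarrow>
     T \<in> tensor_space d (hs_perp d S) d (carrier_mat d d) \<and> mtrace \<rho> = 1 \<and>
     psd (d * d) (kron (1\<^sub>m d) \<rho> + T) \<and> psd d \<rho>"
proof -
  have "herm_mat d \<rho> \<and> herm_mat (d * d) T"
    if T: "T \<in> tensor_space d (hs_perp d S) d (carrier_mat d d)"
      and P: "psd (d * d) (kron (1\<^sub>m d) \<rho> + T)" and \<rho>: "psd d \<rho>"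
  proof -
    have h\<rho>: "herm_mat d \<rho>" using \<rho> by (rule psd_imp_herm)
    have hP: "herm_mat (d * d) (kron (1\<^sub>m d) \<rho> + T)" using P by (rule psd_imp_herm)
    have T': "T \<in> carrier_mat (d * d) (d * d)"
      by (rule tensor_space_carrier[OF _ _ T]) (auto simp: hs_perp_def)
    have "T $$ (k, l) = cnj (T $$ (l, k))" if kl: "k < d * d" "l < d * d" for k l
    proof -
      have d: "0 < d" using kl by (cases d) auto
      have lt: "k div d < d" "l div d < d" "k mod d < d" "l mod d < d"
        using kl d by (auto simp: less_mult_imp_div_less)
      have dim: "dim_row \<rho> = d" "dim_col \<rho> = d" using h\<rho> by (auto simp: herm_mat_def)
      have "kron (1\<^sub>m d) \<rho> $$ (k, l) = cnj (kron (1\<^sub>m d) \<rho> $$ (l, k))"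
      proof -
        have "\<rho> $$ (k mod d, l mod d) = cnj (\<rho> $$ (l mod d, k mod d))"
          by (rule herm_matD[OF h\<rho> lt(3,4)])
        then show ?thesis
          unfolding kron_def using kl lt dim by simp
      qed
      moreover have "(kron (1\<^sub>m d) \<rho> + T) $$ (k, l) = cnj ((kron (1\<^sub>m d) \<rho> + T) $$ (l, k))"
        by (rule herm_matD[OF hP kl])
      ultimately show ?thesis using kl T' dim by simp
    qed
    then show ?thesis using h\<rho> T' unfolding herm_mat_iff by blast
  qed
  moreover have "Re (mtrace \<rho>) - 1 = 0 \<longleftrightarrow> mtrace \<rho> = 1" if "herm_mat d \<rho>"
  proof -
    have "cnj (\<rho> $$ (i, i)) = \<rho> $$ (i, i)" if "i < d" for i
      using herm_matD[OF \<open>herm_mat d \<rho>\<close> that that] by (rule sym)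
    then have "Im (\<rho> $$ (i, i)) = 0" if "i < d" for i
      using that by (metis Reals_cnj_iff complex_is_Real_iff)
    then have "Im (mtrace \<rho>) = 0"
      using that by (auto simp: mtrace_def herm_mat_def)
    then show ?thesis by (auto simp: complex_eq_iff)
  qed
  ultimately show ?thesis
    by (auto simp: sdp_feasible_def lovasz_sdp_def dest: psd_imp_herm)
qed

end

theory Submission
  imports "HOL-Analysis.Topology_Euclidean_Space" "HOL-Analysis.Function_Topology" Defs
begin

text \<open>
  A unit vector of $A \otimes \mathbb{C}^n$ is $(1 \otimes N)|\Phi\rangle$ for some $N$ with
  $\mathrm{Tr}\, N^* N = 1$. Conjugating $1 + T$ by $1 \otimes N$ gives a feasible point
  $1 \otimes N^* N + T'$ of the maximisation programme with the same value; for invertible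
  $\rho = N^* N$ and $n = |A|$ this can be undone, and singular $\rho$ are reached by perturbation.
  So the programme has the value $\widetilde\vartheta(S)$, and the supremum over $n$ is attained
  at $n = |A|$.

  For strong duality at the level $t$, minimise
  $\|P + \Phi - Y\|^2 + \|Q + \mathrm{Tr}_A Y - t 1\|^2$ over Hermitian $Y \in S \otimes L(A')$ and
  positive $P$, $Q$. Since $1 \in S$, the sublevel sets are compact and a minimiser exists. If the
  minimum is $0$, then $Y$ is feasible for the dual with value at most $t$; otherwise the first-order
  conditions say that the residuals are, after scaling, a feasible point of the primal programme
  with value greater than $t$. At $t = \widetilde\vartheta(S)$ the second case is impossible.
\<close>

section \<open>Sesquilinear forms on finite index sets\<close>

text \<open>Operators are treated as complex functions of two indices, with pairs as indices on a
  tensor product: function types carry the product topology, in which boxes are compact, and index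
  arithmetic is kept out of the analysis. The price is that entries off the finite index set are
  arbitrary and have to be cut to 0 before compactness applies, so membership in the operator space
  must depend on the entries inside only.

  A separation argument for strong duality would have to show that some image of a cone is closed.
  Minimising the residuals replaces this by a bound on sublevel sets, and the bound has a concrete
  source: \<open>Y\<close> and \<open>Tr_A Y\<close> have the same trace, so the traces of the two
  residuals add up to \<open>Tr P + Tr Q\<close> plus a constant.

  The identity in \<open>S\<close> acts at the other end. The residuals \<open>E\<close>,
  \<open>F\<close> satisfy \<open>E - 1 \<otimes> F \<in> S^\<bottom> \<otimes> L(A')\<close>, and
  pairing with 1 gives \<open>Tr E = |A| Tr F\<close>. Hence \<open>F = 0\<close> would force
  \<open>E = 0\<close>, and otherwise \<open>F\<close> can be scaled to trace 1.\<close>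

definition sesq :: "'i set \<Rightarrow> ('i \<Rightarrow> 'i \<Rightarrow> complex) \<Rightarrow> ('i \<Rightarrow> complex) \<Rightarrow> ('i \<Rightarrow> complex) \<Rightarrow> complex" where
  "sesq I R x y = (\<Sum>i\<in>I. \<Sum>j\<in>I. cnj (x i) * R i j * y j)"

definition pos_form :: "'i set \<Rightarrow> ('i \<Rightarrow> 'i \<Rightarrow> complex) \<Rightarrow> bool" where
  "pos_form I R \<longleftrightarrow> (\<forall>x. 0 \<le> sesq I R x x)"

definition herm_form :: "'i set \<Rightarrow> ('i \<Rightarrow> 'i \<Rightarrow> complex) \<Rightarrow> bool" where
  "herm_form I R \<longleftrightarrow> (\<forall>i\<in>I. \<forall>j\<in>I. cnj (R j i) = R i j)"

definition hsip :: "'i set \<Rightarrow> ('i \<Rightarrow> 'i \<Rightarrow> complex) \<Rightarrow> ('i \<Rightarrow> 'i \<Rightarrow> complex) \<Rightarrow> complex" where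
  "hsip I X Y = (\<Sum>i\<in>I. \<Sum>j\<in>I. cnj (X i j) * Y i j)"

lemma sesq_add_left: "sesq I R (\<lambda>i. x i + x' i) y = sesq I R x y + sesq I R x' y"
  and sesq_add_right: "sesq I R x (\<lambda>i. y i + y' i) = sesq I R x y + sesq I R x y'"
  and sesq_scale_left: "sesq I R (\<lambda>i. c * x i) y = cnj c * sesq I R x y"
  and sesq_scale_right: "sesq I R x (\<lambda>i. c * y i) = c * sesq I R x y"
  by (simp_all add: sesq_def sum.distrib sum_distrib_left algebra_simps)

lemma sesq_form_add: "sesq I (\<lambda>i j. R i j + R' i j) x y = sesq I R x y + sesq I R' x y"
  and sesq_form_diff: "sesq I (\<lambda>i j. R i j - R' i j) x y = sesq I R x y - sesq I R' x y"
  and sesq_form_scale: "sesq I (\<lambda>i j. c * R i j) x y = c * sesq I R x y"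
  by (simp_all add: sesq_def sum.distrib sum_subtractf sum_distrib_left algebra_simps)

lemma sesq_cong:
  assumes "\<And>i. i \<in> I \<Longrightarrow> x i = x' i" "\<And>i. i \<in> I \<Longrightarrow> y i = y' i"
    "\<And>i j. i \<in> I \<Longrightarrow> j \<in> I \<Longrightarrow> R i j = R' i j"
  shows "sesq I R x y = sesq I R' x' y'"
  unfolding sesq_def by (intro sum.cong refl) (simp add: assms)

lemma pos_form_cong:
  assumes "\<And>i j. i \<in> I \<Longrightarrow> j \<in> I \<Longrightarrow> R i j = R' i j"
  shows "pos_form I R \<longleftrightarrow> pos_form I R'"
  unfolding pos_form_def by (simp add: assms cong: sesq_cong)

lemma sesq_delta:
  assumes "finite I" "a \<in> I" "b \<in> I"
  shows "sesq I R (\<lambda>k. if k = a then 1 else 0) (\<lambda>k. if k = b then 1 else 0) = R a b"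
  using assms by (simp add: sesq_def sum.delta if_distrib[of cnj] if_distrib[of "(*) _"]
      if_distrib[of "\<lambda>z. z * _"] cong: if_cong)

lemma sesq_swap:
  assumes "herm_form I R"
  shows "sesq I R y x = cnj (sesq I R x y)"
proof -
  have "cnj (sesq I R x y) = (\<Sum>i\<in>I. \<Sum>j\<in>I. x i * cnj (R i j) * cnj (y j))"
    by (simp add: sesq_def)
  also have "\<dots> = (\<Sum>j\<in>I. \<Sum>i\<in>I. x i * cnj (R i j) * cnj (y j))"
    by (rule sum.swap)
  also have "\<dots> = sesq I R y x"
    unfolding sesq_def using assms
    by (intro sum.cong refl) (metis (no_types, lifting) herm_form_def mult.assoc mult.commute)
  finally show ?thesis by simp
qed

text \<open>Polarisation on two coordinates: the value at \<open>u + v\<close> controls the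
  imaginary parts of \<open>R i j\<close> and \<open>R j i\<close>, the value at
  \<open>u + \<i> v\<close> their real parts.\<close>

lemma pos_form_herm:
  assumes fin: "finite I" and pos: "pos_form I R"
  shows "herm_form I R"
  unfolding herm_form_def
proof (intro ballI)
  fix i j assume ij: "i \<in> I" "j \<in> I"
  define u v :: "'a \<Rightarrow> complex" where "u = (\<lambda>k. if k = i then 1 else 0)" and "v = (\<lambda>k. if k = j then 1 else 0)"
  have im: "Im (sesq I R x x) = 0" for x
    using pos by (auto simp: pos_form_def less_eq_complex_def)
  have ent: "sesq I R u u = R i i" "sesq I R u v = R i j" "sesq I R v u = R j i" "sesq I R v v = R j j"
    using ij fin by (simp_all add: u_def v_def sesq_delta)
  have e: "sesq I R (\<lambda>k. u k + c * v k) (\<lambda>k. u k + c * v k)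
     = R i i + c * R i j + cnj c * (R j i + c * R j j)" for c
    unfolding sesq_add_left sesq_add_right sesq_scale_left sesq_scale_right ent by (simp add: algebra_simps)
  have "Im (R i i) = 0" "Im (R j j) = 0" using im[of u] im[of v] ent by auto
  moreover have "Im (R i j) + Im (R j i) = 0"
    using im[of "\<lambda>k. u k + 1 * v k"] calculation unfolding e by simp
  moreover have "Re (R i j) = Re (R j i)"
    using im[of "\<lambda>k. u k + \<i> * v k"] calculation unfolding e by simp
  ultimately show "cnj (R j i) = R i j" by (simp add: complex_eq_iff)
qed

lemma pos_form_cauchy_schwarz:
  assumes fin: "finite I" and pos: "pos_form I R"
  shows "(cmod (sesq I R x y))\<^sup>2 \<le> Re (sesq I R x x) * Re (sesq I R y y)"
proof -
  define s where "s = sesq I R y x"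
  define a b where "a = Re (sesq I R x x)" and "b = Re (sesq I R y y)"
  have sw: "sesq I R x y = cnj s" unfolding s_def
    using sesq_swap[OF pos_form_herm[OF fin pos]] by blast
  have nn: "a \<ge> 0" "b \<ge> 0" using pos by (auto simp: a_def b_def pos_form_def less_eq_complex_def)
  have key: "0 \<le> a - 2 * t * (cmod s)\<^sup>2 + t\<^sup>2 * (cmod s)\<^sup>2 * b" for t :: real
  proof -
    define c where "c = - of_real t * s"
    have "0 \<le> Re (sesq I R (\<lambda>k. x k + c * y k) (\<lambda>k. x k + c * y k))"
      using pos by (auto simp: pos_form_def less_eq_complex_def)
    also have "\<dots> = a + Re (c * cnj s) + Re (cnj c * s) + Re (cnj c * c * sesq I R y y)"
      unfolding sesq_add_left sesq_add_right sesq_scale_left sesq_scale_right a_def sw s_def[symmetric]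
      by (simp add: algebra_simps)
    also have "cnj c * c = of_real (t\<^sup>2 * (cmod s)\<^sup>2)"
    proof -
      have "cnj s * s = of_real ((cmod s)\<^sup>2)" by (metis complex_norm_square mult.commute)
      moreover have "cnj c * c = of_real (t\<^sup>2) * (cnj s * s)"
        by (simp add: c_def power2_eq_square)
      ultimately show ?thesis by simp
    qed
    also have "Re (of_real (t\<^sup>2 * (cmod s)\<^sup>2) * sesq I R y y) = t\<^sup>2 * (cmod s)\<^sup>2 * b"
      by (simp add: b_def)
    also have "Re (c * cnj s) = - t * (cmod s)\<^sup>2"
      by (simp add: c_def cmod_power2) (simp add: power2_eq_square algebra_simps)
    also have "Re (cnj c * s) = - t * (cmod s)\<^sup>2"
      by (simp add: c_def cmod_power2) (simp add: power2_eq_square algebra_simps)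
    finally show ?thesis by simp
  qed
  have "(cmod s)\<^sup>2 \<le> a * b"
  proof (cases "b = 0")
    case True
    have "cmod s = 0"
    proof (rule ccontr)
      assume "cmod s \<noteq> 0"
      then have "(cmod s)\<^sup>2 > 0" by simp
      then have "(a + 1) / (cmod s)\<^sup>2 * (cmod s)\<^sup>2 = a + 1" by simp
      then show False using key[of "(a + 1) / (cmod s)\<^sup>2"] True nn by (simp add: mult.assoc split: if_splits)
    qed
    then show ?thesis using nn by simp
  next
    case False
    then have "b > 0" using nn by simp
    then show ?thesis using key[of "1 / b"] by (simp add: field_simps power2_eq_square)
  qed
  then show ?thesis by (simp add: sw a_def b_def)
qed

lemma pos_form_diag:
  assumes "finite I" "pos_form I R" "i \<in> I"
  shows "Im (R i i) = 0" "Re (R i i) \<ge> 0"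
proof -
  have "0 \<le> sesq I R (\<lambda>k. if k = i then 1 else 0) (\<lambda>k. if k = i then 1 else 0)"
    using assms(2) unfolding pos_form_def by blast
  then have "0 \<le> R i i" using sesq_delta[OF assms(1,3,3)] by metis
  then show "Im (R i i) = 0" "Re (R i i) \<ge> 0" by (auto simp: less_eq_complex_def)
qed

lemma pos_form_minor:
  assumes "finite I" "pos_form I R" "i \<in> I" "j \<in> I"
  shows "(cmod (R i j))\<^sup>2 \<le> Re (R i i) * Re (R j j)"
  using pos_form_cauchy_schwarz[OF assms(1,2), of "\<lambda>k. if k = i then 1 else 0" "\<lambda>k. if k = j then 1 else 0"]
  by (simp only: sesq_delta[OF assms(1)] assms(3,4))

text \<open>Minors of order two bound an entry by diagonal entries, which are non-negative. The
  linear constraints control only traces; this turns such control into a bound on all entries, hence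
  into compactness.\<close>

lemma pos_form_entry_le_trace:
  assumes "finite I" "pos_form I R" "i \<in> I" "j \<in> I"
  shows "cmod (R i j) \<le> (\<Sum>k\<in>I. Re (R k k))"
proof -
  let ?t = "\<Sum>k\<in>I. Re (R k k)"
  have d: "0 \<le> Re (R k k) \<and> Re (R k k) \<le> ?t" if "k \<in> I" for k
    using that assms(1) pos_form_diag[OF assms(1,2)] by (auto intro!: member_le_sum)
  have "(cmod (R i j))\<^sup>2 \<le> Re (R i i) * Re (R j j)" by (rule pos_form_minor[OF assms])
  also have "\<dots> \<le> ?t * ?t" using d assms by (intro mult_mono) (auto intro: order_trans)
  finally show ?thesis
    using d[OF assms(3)] by (metis order_trans power2_eq_square power2_le_imp_le)
qed

lemma sesq_insert:
  assumes "finite I" "a \<notin> I"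
  shows "sesq (insert a I) R x y = cnj (x a) * R a a * y a + cnj (x a) * (\<Sum>j\<in>I. R a j * y j)
    + (\<Sum>i\<in>I. cnj (x i) * R i a) * y a + sesq I R x y"
  using assms by (simp add: sesq_def sum.distrib sum_distrib_left sum_distrib_right algebra_simps)

text \<open>Induction over the index set: split off one index and pass to the Schur complement.\<close>

lemma pos_form_cholesky:
  assumes "finite I" "pos_form I R"
  obtains M where "\<And>i j. i \<in> I \<Longrightarrow> j \<in> I \<Longrightarrow> R i j = (\<Sum>k\<in>I. cnj (M k i) * M k j)"
proof -
  have "\<exists>M. \<forall>i\<in>I. \<forall>j\<in>I. R i j = (\<Sum>k\<in>I. cnj (M k i) * M k j)"
    using assms
  proof (induction I arbitrary: R rule: finite_induct)
    case (insert a I)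
    have fin: "finite (insert a I)" using insert.hyps by simp
    have herm: "R i j = cnj (R j i)" if "i \<in> insert a I" "j \<in> insert a I" for i j
      using pos_form_herm[OF fin insert.prems] that unfolding herm_form_def by metis
    define r where "r = Re (R a a)"
    have r: "R a a = of_real r" "r \<ge> 0"
      using pos_form_diag[OF fin insert.prems, of a] by (auto simp: r_def complex_eq_iff)
    have zero: "R a j = 0" if "r = 0" "j \<in> I" for j
      using pos_form_minor[OF fin insert.prems, of a j] that by (simp add: r_def)
    \<comment> \<open>If the pivot \<open>r\<close> is 0, division by it yields 0 and row
      \<open>a\<close> vanishes by \<open>zero\<close>, so one formula for the Schur complement
      serves both cases.\<close>
    define R' where "R' = (\<lambda>i j. R i j - cnj (R a i) * R a j / of_real r)"
    have "pos_form I R'"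
      unfolding pos_form_def
    proof
      fix x
      define L where "L = (\<Sum>j\<in>I. R a j * x j)"
      \<comment> \<open>For positive \<open>r\<close> the value at \<open>a\<close> minimises the
        form among vectors that agree with \<open>x\<close> on \<open>I\<close>, and the minimum is
        the form of the Schur complement at \<open>x\<close>.\<close>
      define x' where "x' = x(a := - L / of_real r)"
      have cL: "cnj L = (\<Sum>i\<in>I. cnj (x i) * R i a)"
        unfolding L_def cnj_sum by (intro sum.cong refl) (simp add: herm[of _ a] mult.commute)
      have L0: "L = 0" if "r = 0" using zero[OF that] by (simp add: L_def)
      have on_I: "x' i = x i" if "i \<in> I" for i using that insert.hyps by (auto simp: x'_def)
      have s1: "(\<Sum>j\<in>I. R a j * x' j) = L" "(\<Sum>i\<in>I. cnj (x' i) * R i a) = cnj L"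
        unfolding cL by (simp_all add: L_def on_I)
      have s2: "sesq I R x' x' = sesq I R x x" by (rule sesq_cong) (auto simp: on_I)
      have "sesq (insert a I) R x' x' = sesq I R x x - cnj L * L / of_real r"
        unfolding sesq_insert[OF insert.hyps(1,2)] s1 s2 r
        using L0 by (cases "r = 0") (auto simp: x'_def field_simps)
      also have "\<dots> = sesq I R' x x"
      proof -
        have "sesq I (\<lambda>i j. cnj (R a i) * R a j / of_real r) x x = cnj L * L / of_real r"
          unfolding L_def cnj_sum sum_product sum_divide_distrib sesq_def
          by (intro sum.cong refl) (simp add: algebra_simps)
        then show ?thesis unfolding R'_def sesq_form_diff by simp
      qed
      finally show "0 \<le> sesq I R' x x" using insert.prems unfolding pos_form_def by metis
    qed
    then obtain M where M: "\<And>i j. i \<in> I \<Longrightarrow> j \<in> I \<Longrightarrow> R' i j = (\<Sum>k\<in>I. cnj (M k i) * M k j)"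
      using insert.IH by blast
    define M' where "M' = (\<lambda>k j. if k = a then R a j / of_real (sqrt r) else if j = a then 0 else M k j)"
    have sq: "complex_of_real (sqrt r) * of_real (sqrt r) = of_real r"
      using r(2) by (simp flip: of_real_mult)
    have split: "(\<Sum>k\<in>insert a I. cnj (M' k i) * M' k j) = cnj (R a i) * R a j / of_real r
        + (\<Sum>k\<in>I. if i = a \<or> j = a then 0 else cnj (M k i) * M k j)"
      for i j
    proof -
      have 1: "(\<Sum>k\<in>I. cnj (M' k i) * M' k j) = (\<Sum>k\<in>I. if i = a \<or> j = a then 0 else cnj (M k i) * M k j)"
        using insert.hyps by (intro sum.cong refl) (auto simp: M'_def)
      have 2: "cnj (M' a i) * M' a j = cnj (R a i) * R a j / of_real r"
        by (simp add: M'_def sq)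
      show ?thesis using insert.hyps 1 2 by simp
    qed
    have "R i j = (\<Sum>k\<in>insert a I. cnj (M' k i) * M' k j)"
      if ij: "i \<in> insert a I" "j \<in> insert a I" for i j
    proof (cases "i = a \<or> j = a")
      case True
      have "cnj (R a i) * R a j / of_real r = R i j"
      proof (cases "r = 0")
        case r0: True
        have "R a k = 0" if "k \<in> insert a I" for k using that zero[OF r0] r r0 by auto
        then have "R i j = 0" using True ij herm[OF ij] by (metis complex_cnj_zero)
        then show ?thesis using r0 by simp
      next
        case False
        have "cnj (R a i) = R i a" using herm[OF ij(1), of a] by simp
        then show ?thesis using True False r by auto
      qed
      then show ?thesis unfolding split using True by simp
    next
      case False
      then have "i \<in> I" "j \<in> I" using ij by auto
      from M[OF this] show ?thesis unfolding split using False by (simp add: R'_def algebra_simps)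
    qed
    then show ?case by blast
  qed simp
  then show ?thesis using that by blast
qed

lemma pos_form_gram: "pos_form I (\<lambda>i j. \<Sum>k\<in>K. cnj (M k i) * M k j)"
  unfolding pos_form_def
proof
  fix x
  have "sesq I (\<lambda>i j. \<Sum>k\<in>K. cnj (M k i) * M k j) x x
     = (\<Sum>i\<in>I. \<Sum>j\<in>I. \<Sum>k\<in>K. cnj (M k i * x i) * (M k j * x j))"
    by (simp add: sesq_def sum_distrib_left sum_distrib_right algebra_simps)
  also have "\<dots> = (\<Sum>i\<in>I. \<Sum>k\<in>K. \<Sum>j\<in>I. cnj (M k i * x i) * (M k j * x j))"
    by (intro sum.cong refl sum.swap)
  also have "\<dots> = (\<Sum>k\<in>K. \<Sum>i\<in>I. \<Sum>j\<in>I. cnj (M k i * x i) * (M k j * x j))"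
    by (rule sum.swap)
  also have "\<dots> = (\<Sum>k\<in>K. cnj (\<Sum>i\<in>I. M k i * x i) * (\<Sum>j\<in>I. M k j * x j))"
    by (simp add: sum_product)
  also have "\<dots> = of_real (\<Sum>k\<in>K. (cmod (\<Sum>i\<in>I. M k i * x i))\<^sup>2)"
    by (simp add: complex_norm_square mult.commute del: of_real_power)
  finally show "0 \<le> sesq I (\<lambda>i j. \<Sum>k\<in>K. cnj (M k i) * M k j) x x"
    by (simp add: sum_nonneg less_eq_complex_def)
qed

section \<open>The Hilbert-Schmidt pairing of forms\<close>

lemma hsip_cong:
  assumes "\<And>i j. i \<in> I \<Longrightarrow> j \<in> I \<Longrightarrow> X i j = X' i j" "\<And>i j. i \<in> I \<Longrightarrow> j \<in> I \<Longrightarrow> Y i j = Y' i j"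
  shows "hsip I X Y = hsip I X' Y'"
  unfolding hsip_def by (intro sum.cong refl) (simp add: assms)

lemma hsip_add_right: "hsip I X (\<lambda>i j. Y i j + Z i j) = hsip I X Y + hsip I X Z"
  and hsip_diff_right: "hsip I X (\<lambda>i j. Y i j - Z i j) = hsip I X Y - hsip I X Z"
  and hsip_scale_right: "hsip I X (\<lambda>i j. c * Y i j) = c * hsip I X Y"
  and hsip_add_left: "hsip I (\<lambda>i j. Y i j + Z i j) X = hsip I Y X + hsip I Z X"
  and hsip_diff_left: "hsip I (\<lambda>i j. Y i j - Z i j) X = hsip I Y X - hsip I Z X"
  and hsip_scale_left: "hsip I (\<lambda>i j. c * Y i j) X = cnj c * hsip I Y X"
  by (simp_all add: hsip_def sum.distrib sum_subtractf sum_distrib_left algebra_simps)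

lemma hsip_swap: "hsip I Y X = cnj (hsip I X Y)"
  by (simp add: hsip_def mult.commute)

lemma hsip_rank_one: "hsip I X (\<lambda>i j. x i * cnj (x j)) = cnj (sesq I X x x)"
  by (simp add: hsip_def sesq_def algebra_simps)

lemma Im_hsip_herm:
  assumes "herm_form I X" "herm_form I Y"
  shows "Im (hsip I X Y) = 0"
proof -
  have "cnj (hsip I X Y) = (\<Sum>i\<in>I. \<Sum>j\<in>I. cnj (X j i) * Y j i)"
    unfolding hsip_def cnj_sum using assms
    by (intro sum.cong refl) (metis complex_cnj_mult herm_form_def)
  also have "\<dots> = hsip I X Y" unfolding hsip_def by (rule sum.swap)
  finally show ?thesis by (metis Reals_cnj_iff complex_is_Real_iff)
qed

text \<open>A Gram factorisation of \<open>X\<close> turns the pairing into a sum of values of the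
  quadratic form of \<open>Y\<close>, taken at the conjugated rows of \<open>M\<close>. Weak duality
  rests on this.\<close>

lemma hsip_pos_form_nonneg:
  assumes fin: "finite I" and X: "pos_form I X" and Y: "pos_form I Y"
  shows "0 \<le> Re (hsip I X Y)"
proof -
  obtain M where M: "\<And>i j. i \<in> I \<Longrightarrow> j \<in> I \<Longrightarrow> X i j = (\<Sum>k\<in>I. cnj (M k i) * M k j)"
    using pos_form_cholesky[OF fin X] by blast
  have "hsip I X Y = (\<Sum>i\<in>I. \<Sum>j\<in>I. \<Sum>k\<in>I. M k i * Y i j * cnj (M k j))"
    unfolding hsip_def by (intro sum.cong refl) (simp add: M sum_distrib_left sum_distrib_right mult_ac)
  also have "\<dots> = (\<Sum>i\<in>I. \<Sum>k\<in>I. \<Sum>j\<in>I. M k i * Y i j * cnj (M k j))"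
    by (intro sum.cong refl sum.swap)
  also have "\<dots> = (\<Sum>k\<in>I. \<Sum>i\<in>I. \<Sum>j\<in>I. M k i * Y i j * cnj (M k j))"
    by (rule sum.swap)
  also have "\<dots> = (\<Sum>k\<in>I. sesq I Y (\<lambda>i. cnj (M k i)) (\<lambda>i. cnj (M k i)))"
    by (simp add: sesq_def)
  finally have "Re (hsip I X Y) = (\<Sum>k\<in>I. Re (sesq I Y (\<lambda>i. cnj (M k i)) (\<lambda>i. cnj (M k i))))"
    by simp
  then show ?thesis using Y
    by (auto intro!: sum_nonneg simp: pos_form_def less_eq_complex_def)
qed

text \<open>Induction over the index set: orthogonalise one extra vector against the subspace of
  vectors vanishing at the new index.\<close>

lemma ex_orthogonal_projection:
  fixes W :: "('i \<Rightarrow> complex) set"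
  assumes "finite I" and "(\<lambda>_. 0) \<in> W"
    and "\<And>u v. u \<in> W \<Longrightarrow> v \<in> W \<Longrightarrow> (\<lambda>i. u i + v i) \<in> W"
    and "\<And>c u. u \<in> W \<Longrightarrow> (\<lambda>i. c * u i) \<in> W"
  shows "\<exists>p\<in>W. \<forall>w\<in>W. (\<Sum>i\<in>I. cnj (w i) * (x i - p i)) = 0"
  using assms
proof (induction I arbitrary: W x rule: finite_induct)
  case empty
  then show ?case by auto
next
  case (insert a I)
  define W0 where "W0 = {w \<in> W. w a = 0}"
  have IH: "\<exists>p\<in>W0. \<forall>w\<in>W0. (\<Sum>i\<in>I. cnj (w i) * (x i - p i)) = 0" for x
    by (rule insert.IH) (use insert.prems in \<open>auto simp: W0_def\<close>)
  have proj: "\<exists>p\<in>W0. \<forall>w\<in>W0. (\<Sum>i\<in>insert a I. cnj (w i) * (x i - p i)) = 0" for x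
    using IH[of x] insert.hyps by (fastforce simp: W0_def)
  show ?case
  proof (cases "W0 = W")
    case True
    then show ?thesis using proj by simp
  next
    case False
    then obtain u1 where u1: "u1 \<in> W" "u1 a \<noteq> 0" by (auto simp: W0_def)
    \<comment> \<open>With the coordinate at \<open>a\<close> scaled to 1, every \<open>w\<close> in
      \<open>W\<close> differs from a vector of \<open>W0\<close> by the multiple \<open>w a\<close>
      of \<open>u'\<close>, so two orthogonality checks suffice.\<close>
    define u where "u = (\<lambda>i. inverse (u1 a) * u1 i)"
    have u: "u \<in> W" "u a = 1" using u1 insert.prems(3) by (auto simp: u_def)
    obtain q where q: "q \<in> W0" "\<forall>w\<in>W0. (\<Sum>i\<in>insert a I. cnj (w i) * (u i - q i)) = 0"
      using proj by blast
    define u' where "u' = (\<lambda>i. u i - q i)"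
    have nW: "(\<lambda>i. v i - c * w i) \<in> W" if "v \<in> W" "w \<in> W" for v w c
      using insert.prems(2)[OF that(1) insert.prems(3)[OF that(2), of "- c"]] by simp
    have u': "u' \<in> W" "u' a = 1"
      using nW[OF u(1), of q 1] q u by (auto simp: u'_def W0_def)
    define ip where "ip = (\<lambda>v w. \<Sum>i\<in>insert a I. cnj (v i) * w i :: complex)"
    have ip_orth: "ip w u' = 0" if "w \<in> W0" for w using q that by (simp add: ip_def u'_def)
    have ip_sym: "ip v w = cnj (ip w v)" for v w by (simp add: ip_def mult.commute)
    have ip_add: "ip (\<lambda>i. v i + c * v' i) w = ip v w + cnj c * ip v' w" for v v' w c
      by (simp add: ip_def sum.distrib sum_distrib_left algebra_simps)
    have ip_diff: "ip v (\<lambda>i. w i - (w' i + c * w'' i)) = ip v w - ip v w' - c * ip v w''" for v w w' w'' c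
      by (simp add: ip_def sum.distrib sum_subtractf sum_distrib_left algebra_simps)
    have "ip u' u' = of_real (\<Sum>i\<in>insert a I. (cmod (u' i))\<^sup>2)"
      by (simp add: ip_def complex_norm_square mult.commute del: of_real_power)
    moreover have "(\<Sum>i\<in>insert a I. (cmod (u' i))\<^sup>2) > 0"
      using insert.hyps u' by (auto intro!: add_pos_nonneg sum_nonneg)
    ultimately have uu: "ip u' u' \<noteq> 0" by (metis of_real_eq_0_iff less_irrefl)
    obtain p0 where p0: "p0 \<in> W0" "\<forall>w\<in>W0. (\<Sum>i\<in>insert a I. cnj (w i) * (x i - p0 i)) = 0"
      using proj by blast
    define c where "c = ip u' x / ip u' u'"
    define p where "p = (\<lambda>i. p0 i + c * u' i)"
    have ip_p0: "ip w x - ip w p0 = 0" if "w \<in> W0" for w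
      using p0(2) that by (simp add: ip_def sum_subtractf right_diff_distrib)
    have pW: "p \<in> W" unfolding p_def using p0 u' insert.prems(2,3) by (auto simp: W0_def)
    have on_u': "ip u' (\<lambda>i. x i - (p0 i + c * u' i)) = 0"
      unfolding ip_diff using ip_orth[OF p0(1)] ip_sym[of u' p0] uu by (simp add: c_def)
    have on_W0: "ip w (\<lambda>i. x i - (p0 i + c * u' i)) = 0" if "w \<in> W0" for w
      unfolding ip_diff using ip_orth[OF that] ip_p0[OF that] by simp
    have "ip w (\<lambda>i. x i - p i) = 0" if w: "w \<in> W" for w
    proof -
      have w0: "(\<lambda>i. w i - w a * u' i) \<in> W0" using nW[OF w u'(1)] u' by (simp add: W0_def)
      have "ip w (\<lambda>i. x i - p i) = ip (\<lambda>i. (w i - w a * u' i) + w a * u' i) (\<lambda>i. x i - p i)"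
        by simp
      also have "\<dots> = 0" unfolding ip_add p_def using on_W0[OF w0] on_u' by simp
      finally show ?thesis .
    qed
    then show ?thesis using pW unfolding ip_def by blast
  qed
qed

section \<open>Compact and closed sets of forms\<close>

lemma compact_PiE_UNIV:
  fixes K :: "'k \<Rightarrow> 'b::topological_space set"
  assumes "\<And>k. compact (K k)"
  shows "compact (Pi\<^sub>E UNIV K)"
  using assms compactin_PiE[of "\<lambda>_. euclidean" UNIV K]
  by (simp add: euclidean_product_topology)

lemma compact_vector_box: "compact {x :: 'i \<Rightarrow> complex. \<forall>i. cmod (x i) \<le> b i}"
proof -
  have "{x. \<forall>i. cmod (x i) \<le> b i} = Pi\<^sub>E UNIV (\<lambda>i. cball 0 (b i))"
    by (auto simp: PiE_iff)
  then show ?thesis by (simp add: compact_PiE_UNIV)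
qed

text \<open>Tychonoff, applied to rows and then to entries. The bound may be 0 off a finite index
  set, so truncated forms fit into such a box.\<close>

lemma compact_coordinate_box:
  "compact {R :: 'i \<Rightarrow> 'j \<Rightarrow> complex. \<forall>i j. cmod (R i j) \<le> b i j}"
proof -
  have "{R. \<forall>i j. cmod (R i j) \<le> b i j} = Pi\<^sub>E UNIV (\<lambda>i. {x. \<forall>j. cmod (x j) \<le> b i j})"
    by (auto simp: PiE_iff)
  then show ?thesis by (simp add: compact_PiE_UNIV compact_vector_box)
qed

lemma continuous_on_entry:
  assumes "continuous_on A f"
  shows "continuous_on A (\<lambda>x. f x i j :: 'b::topological_space)"
  by (rule continuous_on_product_then_coordinatewise, rule continuous_on_product_then_coordinatewise, rule assms)

lemma closed_herm_form:
  assumes "\<And>i j. continuous_on UNIV (\<lambda>x. f x i j)"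
  shows "closed {x. herm_form I (f x)}"
proof -
  have "{x. herm_form I (f x)} = (\<Inter>i\<in>I. \<Inter>j\<in>I. {x. cnj (f x j i) = f x i j})"
    by (auto simp: herm_form_def)
  also have "closed \<dots>"
    by (intro closed_INT ballI closed_Collect_eq continuous_intros assms)
  finally show ?thesis .
qed

lemma closed_pos_form:
  assumes "\<And>i j. continuous_on UNIV (\<lambda>x. f x i j)"
  shows "closed {x. pos_form I (f x)}"
proof -
  have "{x. pos_form I (f x)} = (\<Inter>v. {x. 0 \<le> Re (sesq I (f x) v v)} \<inter> {x. Im (sesq I (f x) v v) = 0})"
    by (auto simp: pos_form_def less_eq_complex_def)
  also have "closed \<dots>"
    unfolding sesq_def
    by (intro closed_INT ballI closed_Int closed_Collect_le closed_Collect_eq continuous_intros assms)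
  finally show ?thesis .
qed

section \<open>Strong duality on function matrices\<close>

definition fun_ent :: "nat \<times> nat \<Rightarrow> nat \<times> nat \<Rightarrow> complex" where
  "fun_ent p q = (if fst p = snd p \<and> fst q = snd q then 1 else 0)"

definition fun_ptrace :: "nat \<Rightarrow> (nat \<times> nat \<Rightarrow> nat \<times> nat \<Rightarrow> complex) \<Rightarrow> nat \<Rightarrow> nat \<Rightarrow> complex" where
  "fun_ptrace d Y k l = (\<Sum>i<d. Y (i, k) (i, l))"

definition one_kron :: "(nat \<Rightarrow> nat \<Rightarrow> complex) \<Rightarrow> nat \<times> nat \<Rightarrow> nat \<times> nat \<Rightarrow> complex" where
  "one_kron F p q = (if fst p = fst q then F (snd p) (snd q) else 0)"

definition fun_one :: "'i \<Rightarrow> 'i \<Rightarrow> complex" where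
  "fun_one i j = (if i = j then 1 else 0)"

lemma sum_times: "(\<Sum>p\<in>A \<times> B. f p) = (\<Sum>i\<in>A. \<Sum>k\<in>B. f (i, k))"
  by (simp add: sum.cartesian_product)

text \<open>The partial trace is the adjoint of \<open>F \<mapsto> 1 \<otimes> F\<close>; this links
  the constraint on \<open>Tr_A Y\<close> to the variable \<open>\<rho>\<close>.\<close>

lemma hsip_one_kron:
  "hsip ({..<d} \<times> {..<n}) (one_kron F) Y = hsip {..<n} F (fun_ptrace d Y)"
proof -
  have "hsip ({..<d} \<times> {..<n}) (one_kron F) Y
      = (\<Sum>i<d. \<Sum>k<n. \<Sum>j<d. if j = i then \<Sum>l<n. cnj (F k l) * Y (i, k) (j, l) else 0)"
    unfolding hsip_def sum_times one_kron_def
    by (intro sum.cong refl) auto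
  also have "\<dots> = (\<Sum>i<d. \<Sum>k<n. \<Sum>l<n. cnj (F k l) * Y (i, k) (i, l))"
    by (rule sum.cong, rule refl, rule sum.cong, rule refl) (simp add: sum.delta)
  also have "\<dots> = (\<Sum>k<n. \<Sum>i<d. \<Sum>l<n. cnj (F k l) * Y (i, k) (i, l))"
    by (rule sum.swap)
  also have "\<dots> = (\<Sum>k<n. \<Sum>l<n. \<Sum>i<d. cnj (F k l) * Y (i, k) (i, l))"
    by (intro sum.cong refl sum.swap)
  finally show ?thesis by (simp add: hsip_def fun_ptrace_def sum_distrib_left)
qed

lemma hsip_fun_ent:
  "hsip ({..<d} \<times> {..<d}) fun_ent E = (\<Sum>i<d. \<Sum>j<d. E (i, i) (j, j))"
proof -
  have "hsip ({..<d} \<times> {..<d}) fun_ent E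
     = (\<Sum>i<d. \<Sum>k<d. if k = i then \<Sum>j<d. \<Sum>l<d. if l = j then E (i, k) (j, l) else 0 else 0)"
    unfolding hsip_def sum_times fun_ent_def
    by (rule sum.cong, rule refl, rule sum.cong, rule refl)
      (auto simp: if_distrib[of cnj] if_distrib[of "\<lambda>z. z * _"] sum.delta sum.delta' cong: if_cong)
  then show ?thesis by (simp add: sum.delta)
qed

lemma hsip_fun_one:
  assumes "finite I"
  shows "hsip I fun_one X = (\<Sum>i\<in>I. X i i)"
proof -
  have "hsip I fun_one X = (\<Sum>i\<in>I. \<Sum>j\<in>I. if j = i then X i j else 0)"
    unfolding hsip_def fun_one_def by (intro sum.cong refl) auto
  then show ?thesis using assms by (simp add: sum.delta)
qed

lemma Re_hsip_self: "Re (hsip I X X) = (\<Sum>i\<in>I. \<Sum>j\<in>I. (cmod (X i j))\<^sup>2)"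
  unfolding hsip_def Re_sum cmod_power2 by (intro sum.cong refl) (simp add: power2_eq_square)

lemma Re_hsip_self_nonneg: "0 \<le> Re (hsip I X X)"
  unfolding Re_hsip_self by (intro sum_nonneg) simp

lemma entry_le_hsip_self:
  assumes "finite I" "i \<in> I" "j \<in> I"
  shows "(cmod (X i j))\<^sup>2 \<le> Re (hsip I X X)"
proof -
  have "(cmod (X i j))\<^sup>2 \<le> (\<Sum>j\<in>I. (cmod (X i j))\<^sup>2)"
    using assms by (intro member_le_sum) auto
  also have "\<dots> \<le> Re (hsip I X X)"
    unfolding Re_hsip_self using assms
    by (intro member_le_sum[where f = "\<lambda>i. \<Sum>j\<in>I. (cmod (X i j))\<^sup>2"]) (auto intro: sum_nonneg)
  finally show ?thesis .
qed

section \<open>First-order conditions and the duality alternative\<close>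

lemma hsip_line:
  "Re (hsip I (\<lambda>p q. X p q + of_real s * Z p q) (\<lambda>p q. X p q + of_real s * Z p q))
    = Re (hsip I X X) + 2 * s * Re (hsip I X Z) + s\<^sup>2 * Re (hsip I Z Z)"
  unfolding hsip_add_left hsip_add_right hsip_scale_left hsip_scale_right hsip_swap[of I Z X]
  by (simp add: power2_eq_square algebra_simps)

text \<open>Points of a cone can be moved in some directions only forwards and only for a bounded
  time, so the hypothesis covers \<open>0 < s \<le> 1\<close> and the conclusion is an
  inequality.\<close>

lemma first_order_condition:
  fixes a b c :: real
  assumes "\<And>s. 0 < s \<Longrightarrow> s \<le> 1 \<Longrightarrow> c \<le> c + 2 * s * a + s\<^sup>2 * b"
  shows "0 \<le> a"
proof (rule ccontr)
  assume "\<not> 0 \<le> a"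
  \<comment> \<open>So small that \<open>s * b \<le> - a\<close>; then \<open>2 * a + s * b\<close>
    is at most \<open>a\<close>, hence negative.\<close>
  define s where "s = min 1 (- a / (\<bar>b\<bar> + 1))"
  have "s \<le> - a / (\<bar>b\<bar> + 1)" by (simp add: s_def)
  moreover have "0 < \<bar>b\<bar> + 1" by simp
  ultimately have s: "0 < s" "s \<le> 1" "s * (\<bar>b\<bar> + 1) \<le> - a"
    using \<open>\<not> 0 \<le> a\<close> by (auto simp: s_def pos_le_divide_eq[symmetric] divide_neg_pos)
  have "0 \<le> s * (2 * a + s * b)" using assms[OF s(1,2)] by (simp add: power2_eq_square algebra_simps)
  then have "0 \<le> 2 * a + s * b" using s(1) by (simp add: zero_le_mult_iff)
  moreover have "s * b \<le> s * (\<bar>b\<bar> + 1)" using s(1) by (intro mult_left_mono) auto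
  ultimately show False using s(3) \<open>\<not> 0 \<le> a\<close> by linarith
qed

lemma pos_form_add: "pos_form I X \<Longrightarrow> pos_form I Y \<Longrightarrow> pos_form I (\<lambda>i j. X i j + Y i j)"
  unfolding pos_form_def sesq_form_add by simp

lemma pos_form_scale: "pos_form I X \<Longrightarrow> 0 \<le> r \<Longrightarrow> pos_form I (\<lambda>i j. of_real r * X i j)"
  unfolding pos_form_def sesq_form_scale by (simp add: less_eq_complex_def)

lemma pos_form_rank_one: "pos_form I (\<lambda>i j. x i * cnj (x j))"
  using pos_form_gram[where I = I and K = "{()}" and M = "\<lambda>_ i. cnj (x i)"] by simp

lemma herm_form_add: "herm_form I X \<Longrightarrow> herm_form I Y \<Longrightarrow> herm_form I (\<lambda>i j. X i j + Y i j)"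
  unfolding herm_form_def by simp

lemma herm_form_scale: "herm_form I X \<Longrightarrow> herm_form I (\<lambda>i j. of_real r * X i j)"
  unfolding herm_form_def by simp

lemma pos_formI:
  assumes "herm_form I X" "\<And>x. 0 \<le> Re (sesq I X x x)"
  shows "pos_form I X"
  unfolding pos_form_def
proof
  fix x
  have "Im (sesq I X x x) = 0"
    using sesq_swap[OF assms(1), of x x] by (metis Reals_cnj_iff complex_is_Real_iff)
  then show "0 \<le> sesq I X x x" using assms(2) by (simp add: less_eq_complex_def)
qed


text \<open>Split \<open>Z\<close> into Hermitian parts \<open>Z1\<close>, \<open>Z2\<close>, which
  stay in \<open>V\<close> because \<open>V\<close> is closed under adjoints. Variations are
  restricted to Hermitian directions, whereas orthogonality is wanted over the complex
  numbers.\<close>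

lemma hsip_eq_0_of_hermitian:
  assumes lin: "\<And>Y Z c. Y \<in> V \<Longrightarrow> Z \<in> V \<Longrightarrow> (\<lambda>p q. Y p q + c * Z p q) \<in> V"
    and adj: "\<And>Y. Y \<in> V \<Longrightarrow> (\<lambda>p q. cnj (Y q p)) \<in> V"
    and R: "herm_form I R"
    and orth: "\<And>Z. Z \<in> V \<Longrightarrow> herm_form I Z \<Longrightarrow> Re (hsip I R Z) = 0"
    and Z: "Z \<in> V"
  shows "hsip I R Z = 0"
proof -
  have H: "hsip I R Z = 0" if Z: "Z \<in> V" "herm_form I Z" for Z
    using orth[OF Z] Im_hsip_herm[OF R Z(2)] by (simp add: complex_eq_iff)
  define Z1 where "Z1 = (\<lambda>p q. Z p q + 1 * cnj (Z q p))"
  define Z2 where "Z2 = (\<lambda>p q. \<i> * Z p q + (- \<i>) * cnj (Z q p))"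
  have "(\<lambda>p q. \<i> * Z p q) \<in> V" using lin[OF Z Z, of "\<i> - 1"] by (simp add: algebra_simps)
  then have V12: "Z1 \<in> V" "Z2 \<in> V"
    unfolding Z1_def Z2_def using lin adj[OF Z] Z by blast+
  have herm12: "herm_form I Z1" "herm_form I Z2"
    by (auto simp: herm_form_def Z1_def Z2_def algebra_simps)
  have "Z = (\<lambda>p q. (1 / 2) * Z1 p q + (- \<i> / 2) * Z2 p q)"
    by (auto simp: Z1_def Z2_def fun_eq_iff field_simps)
  then have "hsip I R Z = hsip I R (\<lambda>p q. (1 / 2) * Z1 p q + (- \<i> / 2) * Z2 p q)" by simp
  also have "\<dots> = 0" unfolding hsip_add_right hsip_scale_right using H V12 herm12 by simp
  finally show ?thesis .
qed

text \<open>At a minimiser, raising \<open>P\<close> or \<open>Q\<close> shows that the residuals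
  \<open>E\<close>, \<open>F\<close> are positive, lowering them shows that the pairings of
  \<open>E\<close> with \<open>P\<close> and of \<open>F\<close> with \<open>Q\<close> are at most
  0, and moving \<open>Y\<close> makes \<open>E - 1 \<otimes> F\<close> orthogonal to
  \<open>V\<close>. Inserted into the minimum itself, these facts bound it by the pairing of
  \<open>\<Phi>\<close> with \<open>E\<close> minus \<open>t Tr F\<close>; so a positive minimum
  produces a primal point with value above \<open>t\<close>.\<close>

lemma duality_alternative:
  fixes V :: "(nat \<times> nat \<Rightarrow> nat \<times> nat \<Rightarrow> complex) set" and t :: real and d :: nat
  defines "D \<equiv> {..<d}" and "I \<equiv> {..<d} \<times> {..<d}"
  assumes d: "0 < d"
    and closed: "closed V"
    and lin: "\<And>Y Z c. Y \<in> V \<Longrightarrow> Z \<in> V \<Longrightarrow> (\<lambda>p q. Y p q + c * Z p q) \<in> V"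
    and adj: "\<And>Y. Y \<in> V \<Longrightarrow> (\<lambda>p q. cnj (Y q p)) \<in> V"
    and one: "fun_one \<in> V"
    and local: "\<And>Y Z. Y \<in> V \<Longrightarrow> (\<And>p q. p \<in> I \<Longrightarrow> q \<in> I \<Longrightarrow> Y p q = Z p q) \<Longrightarrow> Z \<in> V"
  shows "(\<exists>Y\<in>V. pos_form I (\<lambda>p q. Y p q - fun_ent p q) \<and>
            pos_form D (\<lambda>k l. of_real t * fun_one k l - fun_ptrace d Y k l)) \<or>
    (\<exists>\<rho> E. pos_form D \<rho> \<and> (\<Sum>k<d. \<rho> k k) = 1 \<and> pos_form I E \<and>
       (\<forall>Z\<in>V. hsip I (\<lambda>p q. E p q - one_kron \<rho> p q) Z = 0) \<and> t < Re (hsip I fun_ent E))"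
proof -
  have fin: "finite D" "finite I" by (simp_all add: D_def I_def)
  \<comment> \<open>\<open>P\<close> and \<open>Q\<close> are slacks: \<open>Ef = 0\<close> says
    \<open>Y - \<Phi> = P\<close>, and \<open>Ff = 0\<close> says
    \<open>t 1 - Tr_A Y = Q\<close>.\<close>
  define Ef :: "_ \<Rightarrow> _ \<Rightarrow> nat \<times> nat \<Rightarrow> nat \<times> nat \<Rightarrow> complex"
    where "Ef = (\<lambda>Y P p q. P p q + fun_ent p q - Y p q)"
  define Ff :: "_ \<Rightarrow> _ \<Rightarrow> nat \<Rightarrow> nat \<Rightarrow> complex"
    where "Ff = (\<lambda>Y Q k l. Q k l + fun_ptrace d Y k l - of_real t * fun_one k l)"
  define f where "f = (\<lambda>(Y, P, Q). Re (hsip I (Ef Y P) (Ef Y P)) + Re (hsip D (Ff Y Q) (Ff Y Q)))"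
  define K0 where "K0 = {(Y, P, Q). Y \<in> V \<and> herm_form I Y \<and> pos_form I P \<and> pos_form D Q}"
  have zeroV: "(\<lambda>p q. 0) \<in> V" using lin[OF one one, of "-1"] by simp
  have scaleV: "(\<lambda>p q. c * Y p q) \<in> V" if "Y \<in> V" for Y c using lin[OF zeroV that, of c] by simp
  define c0 where "c0 = f (\<lambda>p q. 0, \<lambda>p q. 0, \<lambda>k l. 0)"
  \<comment> \<open>On the sublevel set of \<open>c0\<close> every residual entry is at most
    \<open>sqrt c0\<close>. \<open>B1\<close> collects the diagonals of both residuals and the
    constant \<open>(t - 1) d\<close> left by the traces of \<open>t 1\<close> and
    \<open>\<Phi>\<close>. \<open>B2\<close> then covers \<open>Y = P + \<Phi> - E\<close>, where
    the entries of \<open>\<Phi>\<close> are at most 1.\<close>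
  define B1 where "B1 = real d * real d * sqrt c0 + real d * sqrt c0 + \<bar>(t - 1) * real d\<bar>"
  define B2 where "B2 = B1 + 1 + sqrt c0"
  define bI where "bI = (\<lambda>p q. if p \<in> I \<and> q \<in> I then B2 else 0)"
  define bD where "bD = (\<lambda>p q. if p \<in> D \<and> q \<in> D then B2 else 0)"
  define K where "K = ({R. \<forall>p q. cmod (R p q) \<le> bI p q} \<times> {R. \<forall>p q. cmod (R p q) \<le> bI p q} \<times>
      {R. \<forall>k l. cmod (R k l) \<le> bD k l})
    \<inter> (fst -` V \<inter> {x. herm_form I (fst x)} \<inter> {x. pos_form I (fst (snd x))}
    \<inter> {x. pos_form D (snd (snd x))} \<inter> {x. f x \<le> c0})"
  have bound: "cmod (P p q) \<le> B2 \<and> cmod (Y p q) \<le> B2" "k \<in> D \<Longrightarrow> l \<in> D \<Longrightarrow> cmod (Q k l) \<le> B2"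
    if x: "(Y, P, Q) \<in> K0" and le: "f (Y, P, Q) \<le> c0" and pq: "p \<in> I" "q \<in> I" for Y P Q p q k l
  proof -
    have P: "pos_form I P" and Q: "pos_form D Q" using x by (auto simp: K0_def)
    have "Re (hsip I (Ef Y P) (Ef Y P)) \<le> c0" "Re (hsip D (Ff Y Q) (Ff Y Q)) \<le> c0"
      using le Re_hsip_self_nonneg[of I "Ef Y P"] Re_hsip_self_nonneg[of D "Ff Y Q"]
      by (auto simp: f_def)
    note le' = this
    have E: "cmod (Ef Y P p q) \<le> sqrt c0" if "p \<in> I" "q \<in> I" for p q
      using order_trans[OF entry_le_hsip_self[OF fin(2) that] le'(1)] by (rule real_le_rsqrt)
    have F: "cmod (Ff Y Q k l) \<le> sqrt c0" if "k \<in> D" "l \<in> D" for k l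
      using order_trans[OF entry_le_hsip_self[OF fin(1) that] le'(2)] by (rule real_le_rsqrt)
    define trP where "trP = (\<Sum>p\<in>I. Re (P p p))"
    define trQ where "trQ = (\<Sum>k\<in>D. Re (Q k k))"
    have trE: "(\<Sum>p\<in>I. Re (Ef Y P p p)) = trP + real d - (\<Sum>p\<in>I. Re (Y p p))"
    proof -
      have "(\<Sum>p\<in>I. Re (fun_ent p p)) = (\<Sum>i<d. \<Sum>k<d. if k = i then 1 else 0)"
        unfolding I_def sum_times fun_ent_def by (intro sum.cong refl) auto
      then have "(\<Sum>p\<in>I. Re (fun_ent p p)) = real d" by (simp add: sum.delta)
      then show ?thesis by (simp add: Ef_def trP_def sum.distrib sum_subtractf)
    qed
    have trF: "(\<Sum>k\<in>D. Re (Ff Y Q k k)) = trQ + (\<Sum>p\<in>I. Re (Y p p)) - t * real d"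
    proof -
      have "(\<Sum>k\<in>D. Re (fun_ptrace d Y k k)) = (\<Sum>k<d. \<Sum>i<d. Re (Y (i, k) (i, k)))"
        by (simp add: fun_ptrace_def D_def)
      also have "\<dots> = (\<Sum>p\<in>I. Re (Y p p))" unfolding I_def sum_times by (rule sum.swap)
      finally show ?thesis
        by (simp add: Ff_def trQ_def sum.distrib sum_subtractf fun_one_def D_def)
    qed
    have "(\<Sum>p\<in>I. Re (Ef Y P p p)) \<le> (\<Sum>p\<in>I. sqrt c0)"
      by (intro sum_mono order_trans[OF complex_Re_le_cmod] E)
    also have "\<dots> = real d * real d * sqrt c0" by (simp add: I_def)
    finally have 1: "(\<Sum>p\<in>I. Re (Ef Y P p p)) \<le> real d * real d * sqrt c0" .
    have "(\<Sum>k\<in>D. Re (Ff Y Q k k)) \<le> (\<Sum>k\<in>D. sqrt c0)"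
      by (intro sum_mono order_trans[OF complex_Re_le_cmod] F)
    also have "\<dots> = real d * sqrt c0" by (simp add: D_def)
    finally have 2: "(\<Sum>k\<in>D. Re (Ff Y Q k k)) \<le> real d * sqrt c0" .
    \<comment> \<open>Adding the two traces cancels that of \<open>Y\<close>, so \<open>P\<close>
      and \<open>Q\<close> are bounded before anything is known about the size of
      \<open>Y\<close>.\<close>
    have tr: "trP + trQ \<le> B1" using 1 2 unfolding trE trF B1_def by (simp add: algebra_simps)
    have nn: "0 \<le> trP" "0 \<le> trQ"
      using pos_form_diag(2)[OF fin(2) P] pos_form_diag(2)[OF fin(1) Q]
      by (auto simp: trP_def trQ_def intro: sum_nonneg)
    have "0 \<le> sqrt c0" using E[OF pq] norm_ge_zero order_trans by blast
    then have B12: "B1 \<le> B2" unfolding B2_def by linarith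
    have P1: "cmod (P p q) \<le> B1"
      using pos_form_entry_le_trace[OF fin(2) P pq] tr nn by (simp add: trP_def)
    have "cmod (Y p q) = cmod ((P p q + fun_ent p q) - Ef Y P p q)" by (simp add: Ef_def)
    also have "\<dots> \<le> cmod (P p q) + cmod (fun_ent p q) + cmod (Ef Y P p q)"
      by (intro order_trans[OF norm_triangle_ineq4] add_mono norm_triangle_ineq order_refl)
    also have "\<dots> \<le> B2" unfolding B2_def using P1 E[OF pq] by (intro add_mono) (auto simp: fun_ent_def)
    finally show "cmod (P p q) \<le> B2 \<and> cmod (Y p q) \<le> B2" using P1 B12 by simp
    show "cmod (Q k l) \<le> B2" if "k \<in> D" "l \<in> D"
      using pos_form_entry_le_trace[OF fin(1) Q that] tr nn B12 by (simp add: trQ_def)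
  qed
  \<comment> \<open>The boxes constrain all indices, so points are first set to 0 off
    \<open>I\<close> and \<open>D\<close>. The hypothesis \<open>local\<close> keeps the result in
    \<open>V\<close>, and \<open>f\<close> does not see the change.\<close>
  define tI where "tI = (\<lambda>X p q. if p \<in> I \<and> q \<in> I then X p q else 0 :: complex)"
  define tD where "tD = (\<lambda>X p q. if p \<in> D \<and> q \<in> D then X p q else 0 :: complex)"
  have trunc: "(tI Y, tI P, tD Q) \<in> K0 \<and> f (tI Y, tI P, tD Q) = f (Y, P, Q)"
    if "(Y, P, Q) \<in> K0" for Y P Q
  proof -
    have "tI Y \<in> V" by (rule local[of Y]) (use that in \<open>auto simp: K0_def tI_def\<close>)
    moreover have "herm_form I (tI Y)" using that by (auto simp: K0_def tI_def herm_form_def)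
    moreover have "pos_form I (tI P)" using that pos_form_cong[of I P "tI P"] by (auto simp: K0_def tI_def)
    moreover have "pos_form D (tD Q)" using that pos_form_cong[of D Q "tD Q"] by (auto simp: K0_def tD_def)
    moreover have "hsip I (Ef (tI Y) (tI P)) (Ef (tI Y) (tI P)) = hsip I (Ef Y P) (Ef Y P)"
      by (rule hsip_cong) (auto simp: Ef_def tI_def)
    moreover have "fun_ptrace d (tI Y) k l = fun_ptrace d Y k l" if "k \<in> D" "l \<in> D" for k l
      unfolding fun_ptrace_def using that by (intro sum.cong refl) (auto simp: tI_def I_def D_def)
    then have "hsip D (Ff (tI Y) (tD Q)) (Ff (tI Y) (tD Q)) = hsip D (Ff Y Q) (Ff Y Q)"
      by (intro hsip_cong) (auto simp: Ff_def tD_def)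
    ultimately show ?thesis by (simp add: K0_def f_def)
  qed
  have to_K: "(tI Y, tI P, tD Q) \<in> K" if "(Y, P, Q) \<in> K0" "f (Y, P, Q) \<le> c0" for Y P Q
  proof -
    have 1: "(tI Y, tI P, tD Q) \<in> K0" "f (tI Y, tI P, tD Q) \<le> c0" using trunc[OF that(1)] that(2) by auto
    \<comment> \<open>\<open>bound\<close> asks for indices in \<open>I\<close> even where only
      \<open>Q\<close> is concerned; \<open>0 < d\<close> supplies them.\<close>
    have "(0, 0) \<in> I" using d by (simp add: I_def)
    then have "cmod (tI Y p q) \<le> bI p q" "cmod (tI P p q) \<le> bI p q" "cmod (tD Q k l) \<le> bD k l"
      for p q k l
      using bound[OF that] by (auto simp: bI_def bD_def tI_def tD_def)
    then show ?thesis using 1 by (simp add: K_def K0_def)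
  qed
  have K_K0: "(Y, P, Q) \<in> K0" if "(Y, P, Q) \<in> K" for Y P Q
    using that by (simp add: K_def K0_def)
  have cont: "continuous_on UNIV (\<lambda>x :: ((nat \<times> nat \<Rightarrow> nat \<times> nat \<Rightarrow> complex) \<times> (nat \<times> nat \<Rightarrow> nat \<times> nat \<Rightarrow> complex) \<times> (nat \<Rightarrow> nat \<Rightarrow> complex)). fst x p q)"
    "continuous_on UNIV (\<lambda>x :: ((nat \<times> nat \<Rightarrow> nat \<times> nat \<Rightarrow> complex) \<times> (nat \<times> nat \<Rightarrow> nat \<times> nat \<Rightarrow> complex) \<times> (nat \<Rightarrow> nat \<Rightarrow> complex)). fst (snd x) p q)"
    "continuous_on UNIV (\<lambda>x :: ((nat \<times> nat \<Rightarrow> nat \<times> nat \<Rightarrow> complex) \<times> (nat \<times> nat \<Rightarrow> nat \<times> nat \<Rightarrow> complex) \<times> (nat \<Rightarrow> nat \<Rightarrow> complex)). snd (snd x) k l)"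
    for p q k l
    by (rule continuous_on_entry, intro continuous_intros)+
  have cont_f: "continuous_on UNIV f"
    unfolding f_def hsip_def Ef_def Ff_def fun_ptrace_def case_prod_unfold
    by (intro continuous_intros cont)
  have "compact K"
    unfolding K_def
    by (intro compact_Int_closed compact_Times compact_coordinate_box closed_Int closed_vimage_fst
        closed closed_herm_form closed_pos_form cont closed_Collect_le cont_f continuous_intros)
  moreover have K0_0: "(\<lambda>p q. 0, \<lambda>p q. 0, \<lambda>k l. 0) \<in> K0"
    using zeroV by (simp add: K0_def herm_form_def pos_form_def sesq_def)
  then have "K \<noteq> {}" using to_K[OF K0_0] by (auto simp: c0_def)
  ultimately obtain Y P Q where x: "(Y, P, Q) \<in> K" and "\<forall>y\<in>K. f (Y, P, Q) \<le> f y"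
    using continuous_attains_inf[of K f] continuous_on_subset[OF cont_f] by (metis subset_UNIV prod_cases3)
  then have min: "f (Y, P, Q) \<le> f (Y', P', Q')" if "(Y', P', Q') \<in> K0" for Y' P' Q'
  proof (cases "f (Y', P', Q') \<le> c0")
    case True
    then show ?thesis using to_K[OF that True] trunc[OF that] \<open>\<forall>y\<in>K. f (Y, P, Q) \<le> f y\<close> by metis
  next
    case False
    then show ?thesis using x by (simp add: K_def)
  qed
  have Y: "Y \<in> V" "herm_form I Y" and P: "pos_form I P" and Q: "pos_form D Q"
    using K_K0[OF x] by (auto simp: K0_def)
  define E where "E = Ef Y P"
  define F where "F = Ff Y Q"
  \<comment> \<open>Half the derivative of \<open>f\<close> along \<open>(dY, dP, dQ)\<close>. The
    residuals are affine in the point, so \<open>f\<close> is exactly quadratic along the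
    segment.\<close>
  have foc: "0 \<le> Re (hsip I E (\<lambda>p q. dP p q - dY p q)) + Re (hsip D F (\<lambda>k l. dQ k l + fun_ptrace d dY k l))"
    if "\<And>s :: real. 0 < s \<Longrightarrow> s \<le> 1 \<Longrightarrow> (\<lambda>p q. Y p q + of_real s * dY p q,
        \<lambda>p q. P p q + of_real s * dP p q, \<lambda>k l. Q k l + of_real s * dQ k l) \<in> K0" for dY dP dQ
  proof (rule first_order_condition)
    fix s :: real assume s: "0 < s" "s \<le> 1"
    have e: "Ef (\<lambda>p q. Y p q + of_real s * dY p q) (\<lambda>p q. P p q + of_real s * dP p q)
        = (\<lambda>p q. E p q + of_real s * (dP p q - dY p q))"
      by (simp add: E_def Ef_def fun_eq_iff algebra_simps)
    have f': "Ff (\<lambda>p q. Y p q + of_real s * dY p q) (\<lambda>k l. Q k l + of_real s * dQ k l)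
        = (\<lambda>k l. F k l + of_real s * (dQ k l + fun_ptrace d dY k l))"
      by (simp add: F_def Ff_def fun_eq_iff algebra_simps fun_ptrace_def sum.distrib sum_distrib_left)
    have "f (Y, P, Q) \<le> f (\<lambda>p q. Y p q + of_real s * dY p q,
        \<lambda>p q. P p q + of_real s * dP p q, \<lambda>k l. Q k l + of_real s * dQ k l)"
      by (rule min[OF that[OF s]])
    also have "\<dots> = f (Y, P, Q)
      + 2 * s * (Re (hsip I E (\<lambda>p q. dP p q - dY p q)) + Re (hsip D F (\<lambda>k l. dQ k l + fun_ptrace d dY k l)))
      + s\<^sup>2 * (Re (hsip I (\<lambda>p q. dP p q - dY p q) (\<lambda>p q. dP p q - dY p q))
          + Re (hsip D (\<lambda>k l. dQ k l + fun_ptrace d dY k l) (\<lambda>k l. dQ k l + fun_ptrace d dY k l)))"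
      unfolding f_def prod.case e f' hsip_line E_def[symmetric] F_def[symmetric] by (simp add: algebra_simps)
    finally show "f (Y, P, Q) \<le> f (Y, P, Q)
      + 2 * s * (Re (hsip I E (\<lambda>p q. dP p q - dY p q)) + Re (hsip D F (\<lambda>k l. dQ k l + fun_ptrace d dY k l)))
      + s\<^sup>2 * (Re (hsip I (\<lambda>p q. dP p q - dY p q) (\<lambda>p q. dP p q - dY p q))
          + Re (hsip D (\<lambda>k l. dQ k l + fun_ptrace d dY k l) (\<lambda>k l. dQ k l + fun_ptrace d dY k l)))" .
  qed
  have h0: "hsip J X (\<lambda>p q. 0) = 0" for J :: "'j set" and X by (simp add: hsip_def)
  have p0: "fun_ptrace d (\<lambda>p q. 0) = (\<lambda>k l. 0)" by (simp add: fun_ptrace_def fun_eq_iff)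
  have herm: "herm_form I P" "herm_form D Q" by (rule pos_form_herm[OF fin(2) P], rule pos_form_herm[OF fin(1) Q])
  have hE: "herm_form I E"
    using herm(1) Y(2) unfolding herm_form_def E_def Ef_def fun_ent_def by auto
  have hF: "herm_form D F"
    unfolding herm_form_def F_def Ff_def
  proof (intro ballI)
    fix k l assume kl: "k \<in> D" "l \<in> D"
    have "cnj (fun_ptrace d Y l k) = fun_ptrace d Y k l"
      unfolding fun_ptrace_def cnj_sum using kl Y(2)
      by (intro sum.cong refl) (auto simp: herm_form_def I_def D_def)
    then show "cnj (Q l k + fun_ptrace d Y l k - of_real t * fun_one l k)
        = Q k l + fun_ptrace d Y k l - of_real t * fun_one k l"
      using kl herm(2) unfolding herm_form_def fun_one_def by auto
  qed
  \<comment> \<open>Adding multiples of the rank-one form of \<open>v\<close> to \<open>P\<close>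
    never leaves the cone, and the derivative in this direction is the form of \<open>E\<close> at
    \<open>v\<close>.\<close>
  have posE: "pos_form I E"
  proof (rule pos_formI[OF hE])
    fix v
    have "0 \<le> Re (hsip I E (\<lambda>p q. v p * cnj (v q) - 0)) + Re (hsip D F (\<lambda>k l. 0 + fun_ptrace d (\<lambda>p q. 0) k l))"
    proof (rule foc)
      fix s :: real assume "0 < s"
      then show "(\<lambda>p q. Y p q + of_real s * 0, \<lambda>p q. P p q + of_real s * (v p * cnj (v q)), \<lambda>k l. Q k l + of_real s * 0) \<in> K0"
        using pos_form_add[OF P pos_form_scale[OF pos_form_rank_one[of I v], of s]] Y Q
        by (simp add: K0_def)
    qed
    then show "0 \<le> Re (sesq I E v v)" by (simp add: p0 h0 hsip_rank_one)
  qed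
  have posF: "pos_form D F"
  proof (rule pos_formI[OF hF])
    fix v
    have "0 \<le> Re (hsip I E (\<lambda>p q. 0 - 0)) + Re (hsip D F (\<lambda>k l. v k * cnj (v l) + fun_ptrace d (\<lambda>p q. 0) k l))"
    proof (rule foc)
      fix s :: real assume "0 < s"
      then show "(\<lambda>p q. Y p q + of_real s * 0, \<lambda>p q. P p q + of_real s * 0, \<lambda>k l. Q k l + of_real s * (v k * cnj (v l))) \<in> K0"
        using pos_form_add[OF Q pos_form_scale[OF pos_form_rank_one[of D v], of s]] Y P
        by (simp add: K0_def)
    qed
    then show "0 \<le> Re (sesq D F v v)" by (simp add: p0 h0 hsip_rank_one)
  qed
  \<comment> \<open>Moving along \<open>- X\<close> multiplies \<open>X\<close> by
    \<open>1 - s\<close>; this is the reason for the restriction to \<open>s \<le> 1\<close> in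
    \<open>foc\<close>.\<close>
  have shrink: "pos_form J (\<lambda>p q. X p q + of_real s * - X p q)"
    if "pos_form J X" "s \<le> 1" for J :: "'j set" and X s
    using pos_form_scale[OF that(1), of "1 - s"] that(2) by (simp add: algebra_simps)
  have hneg: "hsip J X (\<lambda>p q. - Z p q) = - hsip J X Z" for J :: "'j set" and X Z
    using hsip_scale_right[of J X "-1" Z] by simp
  have fun_ptrace_neg: "fun_ptrace d (\<lambda>p q. - Z p q) = (\<lambda>k l. - fun_ptrace d Z k l)" for Z
    by (simp add: fun_ptrace_def fun_eq_iff sum_negf)
  have EP: "Re (hsip I E P) \<le> 0"
  proof -
    have "0 \<le> Re (hsip I E (\<lambda>p q. - P p q - 0)) + Re (hsip D F (\<lambda>k l. 0 + fun_ptrace d (\<lambda>p q. 0) k l))"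
      by (rule foc) (use Y Q shrink[OF P] in \<open>simp add: K0_def\<close>)
    then show ?thesis by (simp add: p0 h0 hneg)
  qed
  have FQ: "Re (hsip D F Q) \<le> 0"
  proof -
    have "0 \<le> Re (hsip I E (\<lambda>p q. 0 - 0)) + Re (hsip D F (\<lambda>k l. - Q k l + fun_ptrace d (\<lambda>p q. 0) k l))"
      by (rule foc) (use Y P shrink[OF Q] in \<open>simp add: K0_def\<close>)
    then show ?thesis by (simp add: p0 h0 hneg)
  qed
  \<comment> \<open>\<open>Y\<close> is not confined to a cone, so both \<open>Z\<close> and
    \<open>- Z\<close> are admissible directions and the inequality becomes an equality.\<close>
  have EZ: "Re (hsip I E Z) = Re (hsip D F (fun_ptrace d Z))" if Z: "Z \<in> V" "herm_form I Z" for Z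
  proof -
    have le: "Re (hsip I E Z) \<le> Re (hsip D F (fun_ptrace d Z))" if Z: "Z \<in> V" "herm_form I Z" for Z
    proof -
      have "0 \<le> Re (hsip I E (\<lambda>p q. 0 - Z p q)) + Re (hsip D F (\<lambda>k l. 0 + fun_ptrace d Z k l))"
        by (rule foc) (use Y P Q lin[OF Y(1) Z(1)] herm_form_add[OF Y(2) herm_form_scale[OF Z(2)]] in \<open>simp add: K0_def\<close>)
      then show ?thesis by (simp add: hneg)
    qed
    have "(\<lambda>p q. - Z p q) \<in> V" "herm_form I (\<lambda>p q. - Z p q)"
      using scaleV[OF Z(1), of "-1"] herm_form_scale[OF Z(2), of "-1"] by simp_all
    from le[OF this] have "Re (hsip D F (fun_ptrace d Z)) \<le> Re (hsip I E Z)"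
      using hneg[of D F "fun_ptrace d Z"] by (simp add: hneg fun_ptrace_neg)
    then show ?thesis using le[OF Z] by simp
  qed
  define trF where "trF = (\<Sum>k<d. Re (F k k))"
  have trF: "(\<Sum>k<d. F k k) = of_real trF"
    using pos_form_diag(1)[OF fin(1) posF] by (simp add: trF_def complex_eq_iff D_def)
  \<comment> \<open>Expand one factor of each squared residual: the terms with \<open>Y\<close>
    cancel by \<open>EZ\<close>, and those with \<open>P\<close> and \<open>Q\<close> are at most
    0.\<close>
  have gap: "f (Y, P, Q) \<le> Re (hsip I fun_ent E) - t * trF"
  proof -
    have "hsip I E E = hsip I E P + hsip I E fun_ent - hsip I E Y"
      by (subst (2) E_def) (simp add: Ef_def hsip_add_right hsip_diff_right)
    moreover have "hsip D F F = hsip D F Q + hsip D F (fun_ptrace d Y) - of_real t * hsip D F fun_one"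
      by (subst (2) F_def) (simp add: Ff_def hsip_add_right hsip_diff_right hsip_scale_right)
    moreover have "Re (hsip D F fun_one) = trF"
      using hsip_fun_one[OF fin(1), of F] hsip_swap[of D F fun_one] trF by (simp add: D_def)
    moreover have "Re (hsip I E fun_ent) = Re (hsip I fun_ent E)" using hsip_swap[of I E fun_ent] by simp
    ultimately show ?thesis using EP FQ EZ[OF Y]
      unfolding f_def prod.case E_def[symmetric] F_def[symmetric] by simp
  qed
  show ?thesis
  proof (cases "f (Y, P, Q) = 0")
    case True
    then have 0: "Re (hsip I E E) = 0" "Re (hsip D F F) = 0"
      using Re_hsip_self_nonneg[of I E] Re_hsip_self_nonneg[of D F]
      unfolding f_def prod.case E_def[symmetric] F_def[symmetric] by linarith+
    have "E p q = 0" if "p \<in> I" "q \<in> I" for p q using entry_le_hsip_self[OF fin(2) that, of E] 0 by simp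
    then have "pos_form I (\<lambda>p q. Y p q - fun_ent p q)"
      using P by (subst pos_form_cong[of I _ P]) (auto simp: E_def Ef_def algebra_simps)
    moreover have "F p q = 0" if "p \<in> D" "q \<in> D" for p q using entry_le_hsip_self[OF fin(1) that, of F] 0 by simp
    then have "pos_form D (\<lambda>k l. of_real t * fun_one k l - fun_ptrace d Y k l)"
      using Q by (subst pos_form_cong[of D _ Q]) (auto simp: F_def Ff_def algebra_simps)
    ultimately show ?thesis using Y by blast
  next
    case False
    moreover have "0 \<le> f (Y, P, Q)" by (simp add: f_def Re_hsip_self_nonneg)
    ultimately have pos: "0 < Re (hsip I fun_ent E) - t * trF" using gap by simp
    have perp: "hsip I (\<lambda>p q. E p q - one_kron F p q) Z = 0" if Z: "Z \<in> V" for Z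
    proof -
      have hT: "herm_form I (\<lambda>p q. E p q - one_kron F p q)"
        using hE hF unfolding herm_form_def one_kron_def I_def D_def by fastforce
      have orth: "Re (hsip I (\<lambda>p q. E p q - one_kron F p q) Z) = 0" if Z: "Z \<in> V" "herm_form I Z" for Z
        using EZ[OF Z] unfolding hsip_diff_left by (simp add: hsip_one_kron I_def D_def)
      show ?thesis by (rule hsip_eq_0_of_hermitian[OF lin adj hT orth Z])
    qed
    have F_le: "cmod (F k l) \<le> trF" if "k \<in> D" "l \<in> D" for k l
      using pos_form_entry_le_trace[OF fin(1) posF that] by (simp add: trF_def D_def)
    \<comment> \<open>A positive form of trace 0 vanishes, so \<open>F = 0\<close>. Orthogonality to
      the identity, an element of \<open>V\<close>, then gives \<open>Tr E = 0\<close> and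
      \<open>E = 0\<close>, against \<open>pos\<close>.\<close>
    have "trF \<noteq> 0"
    proof
      assume t0: "trF = 0"
      have F0: "F k l = 0" if "k \<in> D" "l \<in> D" for k l using F_le[OF that] t0 by simp
      have "hsip I (one_kron F) fun_one = 0"
        unfolding hsip_def by (intro sum.neutral ballI) (use F0 in \<open>auto simp: one_kron_def I_def D_def\<close>)
      then have "hsip I E fun_one = 0" using perp[OF one] by (simp add: hsip_diff_left)
      then have "(\<Sum>p\<in>I. E p p) = 0" using hsip_swap[of I fun_one E] hsip_fun_one[OF fin(2), of E]
        by (metis complex_cnj_zero)
      then have "(\<Sum>p\<in>I. Re (E p p)) = 0" by (metis Re_sum zero_complex.simps(1))
      then have "E p q = 0" if "p \<in> I" "q \<in> I" for p q
        using pos_form_entry_le_trace[OF fin(2) posE that] by simp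
      then have "hsip I fun_ent E = 0" unfolding hsip_def by (intro sum.neutral ballI) simp
      then show False using pos t0 by simp
    qed
    moreover have "0 \<le> trF"
      using pos_form_diag(2)[OF fin(1) posF] by (auto simp: trF_def D_def intro: sum_nonneg)
    ultimately have trF_pos: "0 < trF" by simp
    define r where "r = 1 / trF"
    have r: "0 < r" "r * trF = 1" using trF_pos by (auto simp: r_def)
    define \<rho> where "\<rho> = (\<lambda>k l. of_real r * F k l)"
    define E' where "E' = (\<lambda>p q. of_real r * E p q)"
    have "pos_form D \<rho>" "pos_form I E'"
      unfolding \<rho>_def E'_def using r by (auto intro: pos_form_scale posF posE)
    moreover have "(\<Sum>k<d. \<rho> k k) = 1"
      using r trF unfolding \<rho>_def by (simp flip: sum_distrib_left of_real_mult)
    moreover have "hsip I (\<lambda>p q. E' p q - one_kron \<rho> p q) Z = 0" if "Z \<in> V" for Z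
    proof -
      have "(\<lambda>p q. E' p q - one_kron \<rho> p q) = (\<lambda>p q. of_real r * (E p q - one_kron F p q))"
        by (auto simp: E'_def \<rho>_def one_kron_def fun_eq_iff algebra_simps)
      then show ?thesis using perp[OF that] by (simp add: hsip_scale_left)
    qed
    moreover have "t < Re (hsip I fun_ent E')"
    proof -
      have "0 < r * (Re (hsip I fun_ent E) - t * trF)" using pos r by simp
      also have "\<dots> = Re (hsip I fun_ent E') - t * (r * trF)"
        by (simp add: E'_def hsip_scale_right algebra_simps)
      finally show ?thesis using r by simp
    qed
    ultimately show ?thesis by blast
  qed
qed

section \<open>Matrices as forms\<close>

definition mat_fun :: "complex mat \<Rightarrow> nat \<Rightarrow> nat \<Rightarrow> complex" where
  "mat_fun M i j = M $$ (i, j)"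

definition tensor_fun :: "nat \<Rightarrow> complex mat \<Rightarrow> nat \<times> nat \<Rightarrow> nat \<times> nat \<Rightarrow> complex" where
  "tensor_fun n Y p q = Y $$ (fst p * n + snd p, fst q * n + snd q)"

definition tensor_mat :: "nat \<Rightarrow> nat \<Rightarrow> (nat \<times> nat \<Rightarrow> nat \<times> nat \<Rightarrow> complex) \<Rightarrow> complex mat" where
  "tensor_mat m n R = mat (m * n) (m * n) (\<lambda>(a, b). R (a div n, a mod n) (b div n, b mod n))"

definition sqnorm :: "'i set \<Rightarrow> ('i \<Rightarrow> complex) \<Rightarrow> real" where
  "sqnorm I x = (\<Sum>i\<in>I. (cmod (x i))\<^sup>2)"

lemma sqnorm_nonneg: "0 \<le> sqnorm I x"
  by (auto simp: sqnorm_def intro: sum_nonneg)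

lemma sqnorm_scale: "sqnorm I (\<lambda>i. c * x i) = (cmod c)\<^sup>2 * sqnorm I x"
  by (simp add: sqnorm_def norm_mult power_mult_distrib sum_distrib_left)

lemma sqnorm_cong: "(\<And>i. i \<in> I \<Longrightarrow> x i = y i) \<Longrightarrow> sqnorm I x = sqnorm I y"
  by (simp add: sqnorm_def)

lemma entry_le_sqnorm: "finite I \<Longrightarrow> i \<in> I \<Longrightarrow> (cmod (x i))\<^sup>2 \<le> sqnorm I x"
  unfolding sqnorm_def by (intro member_le_sum) auto

lemma sesq_fun_one:
  assumes "finite I"
  shows "sesq I fun_one x y = (\<Sum>i\<in>I. cnj (x i) * y i)"
proof -
  have "sesq I fun_one x y = (\<Sum>i\<in>I. \<Sum>j\<in>I. if j = i then cnj (x i) * y j else 0)"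
    unfolding sesq_def fun_one_def by (intro sum.cong refl) auto
  then show ?thesis using assms by (simp add: sum.delta)
qed

lemma sesq_fun_one_self: "finite I \<Longrightarrow> sesq I fun_one x x = of_real (sqnorm I x)"
  by (simp add: sesq_fun_one sqnorm_def complex_norm_square mult.commute del: of_real_power)

lemma pos_form_fun_one: "finite I \<Longrightarrow> pos_form I fun_one"
  by (simp add: pos_form_def sesq_fun_one_self sqnorm_nonneg less_eq_complex_def)

lemma herm_form_diff: "herm_form I X \<Longrightarrow> herm_form I Y \<Longrightarrow> herm_form I (\<lambda>i j. X i j - Y i j)"
  unfolding herm_form_def by simp

text \<open>Together with \<open>op_norm_le_iff\<close> this turns a norm bound on a positive
  operator into positivity of \<open>t 1 - R\<close>, which a semidefinite programme can
  express.\<close>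

lemma pos_form_one_diff_iff:
  assumes "finite I" "herm_form I R"
  shows "pos_form I (\<lambda>i j. of_real t * fun_one i j - R i j) \<longleftrightarrow>
    (\<forall>x. Re (sesq I R x x) \<le> t * sqnorm I x)"
proof -
  have e: "Re (sesq I (\<lambda>i j. of_real t * fun_one i j - R i j) x x) = t * sqnorm I x - Re (sesq I R x x)" for x
    using assms(1) by (simp add: sesq_form_diff sesq_form_scale sesq_fun_one_self)
  have h: "herm_form I (\<lambda>i j. of_real t * fun_one i j - R i j)"
    using assms(2) by (intro herm_form_diff herm_form_scale) (auto simp: herm_form_def fun_one_def)
  show ?thesis
  proof
    assume "pos_form I (\<lambda>i j. of_real t * fun_one i j - R i j)"
    then have "0 \<le> Re (sesq I (\<lambda>i j. of_real t * fun_one i j - R i j) x x)" for x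
      by (auto simp: pos_form_def less_eq_complex_def)
    then show "\<forall>x. Re (sesq I R x x) \<le> t * sqnorm I x" unfolding e by simp
  next
    assume "\<forall>x. Re (sesq I R x x) \<le> t * sqnorm I x"
    then show "pos_form I (\<lambda>i j. of_real t * fun_one i j - R i j)"
      by (intro pos_formI h) (simp add: e)
  qed
qed

section \<open>The operator norm of positive matrices and the maximum in
  \<open>lovasz_theta\<close>\<close>

lemma sesq_le_of_unit:
  assumes fin: "finite I" and unit: "\<And>x. sqnorm I x = 1 \<Longrightarrow> Re (sesq I R x x) \<le> t"
  shows "Re (sesq I R x x) \<le> t * sqnorm I x"
proof (cases "sqnorm I x = 0")
  case True
  then have "x i = 0" if "i \<in> I" for i using entry_le_sqnorm[OF fin that, of x] by simp
  then have "sesq I R x x = 0" unfolding sesq_def by (intro sum.neutral ballI) simp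
  then show ?thesis using True by simp
next
  case False
  then have pos: "0 < sqnorm I x" using sqnorm_nonneg[of I x] by simp
  define c where "c = complex_of_real (1 / sqrt (sqnorm I x))"
  have c: "(cmod c)\<^sup>2 = 1 / sqnorm I x" using pos by (simp add: c_def norm_divide power_divide)
  have "Re (sesq I R (\<lambda>i. c * x i) (\<lambda>i. c * x i)) \<le> t"
    using c pos by (intro unit) (simp add: sqnorm_scale)
  moreover have "sesq I R (\<lambda>i. c * x i) (\<lambda>i. c * x i) = of_real (1 / sqnorm I x) * sesq I R x x"
    using c by (simp add: sesq_scale_left sesq_scale_right complex_norm_square[symmetric]
        mult.assoc[symmetric] mult.commute[of "cnj c"] del: of_real_power of_real_divide)
  ultimately show ?thesis using pos by (simp add: field_simps)
qed

text \<open>A crude estimate by the arithmetic-geometric mean inequality. It serves to show that the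
  supremum in \<open>op_norm\<close> is taken over a bounded set.\<close>

lemma sesq_le_bound:
  assumes fin: "finite I" and B: "\<And>i j. i \<in> I \<Longrightarrow> j \<in> I \<Longrightarrow> cmod (R i j) \<le> B"
  shows "Re (sesq I R x x) \<le> B * real (card I) * sqnorm I x"
proof -
  have "Re (sesq I R x x) \<le> (\<Sum>i\<in>I. \<Sum>j\<in>I. B * (((cmod (x i))\<^sup>2 + (cmod (x j))\<^sup>2) / 2))"
    unfolding sesq_def Re_sum
  proof (intro sum_mono)
    fix i j assume ij: "i \<in> I" "j \<in> I"
    have "0 \<le> B" using B[OF ij] norm_ge_zero order_trans by blast
    have "Re (cnj (x i) * R i j * x j) \<le> cmod (x i) * cmod (R i j) * cmod (x j)"
      using complex_Re_le_cmod[of "cnj (x i) * R i j * x j"] by (simp add: norm_mult)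
    also have "\<dots> = cmod (R i j) * (cmod (x i) * cmod (x j))" by simp
    also have "\<dots> \<le> B * (((cmod (x i))\<^sup>2 + (cmod (x j))\<^sup>2) / 2)"
      using B[OF ij] \<open>0 \<le> B\<close> sum_squares_bound[of "cmod (x i)" "cmod (x j)"] by (intro mult_mono) auto
    finally show "Re (cnj (x i) * R i j * x j) \<le> B * (((cmod (x i))\<^sup>2 + (cmod (x j))\<^sup>2) / 2)" .
  qed
  also have "\<dots> = B * real (card I) * sqnorm I x"
    by (simp add: sqnorm_def sum.distrib sum_distrib_left[symmetric] sum_divide_distrib[symmetric])
  finally show ?thesis .
qed

lemma vec_cscalar_prod: "v \<in> carrier_vec m \<Longrightarrow> w \<in> carrier_vec m \<Longrightarrow> w \<bullet>c v = (\<Sum>i<m. cnj (v $ i) * w $ i)"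
  by (simp add: scalar_prod_def atLeast0LessThan mult.commute)

lemma mult_mat_vec_index:
  "M \<in> carrier_mat m m \<Longrightarrow> v \<in> carrier_vec m \<Longrightarrow> i < m \<Longrightarrow> (M *\<^sub>v v) $ i = (\<Sum>j<m. M $$ (i, j) * v $ j)"
  by (simp add: scalar_prod_def atLeast0LessThan)

lemma cscalar_prod_sesq:
  assumes "M \<in> carrier_mat m m" "v \<in> carrier_vec m" "w \<in> carrier_vec m"
  shows "(M *\<^sub>v v) \<bullet>c w = sesq {..<m} (mat_fun M) (($) w) (($) v)"
proof -
  have "M *\<^sub>v v \<in> carrier_vec m" using assms by simp
  then show ?thesis
    using assms(1,2,3) vec_cscalar_prod[OF assms(3), of "M *\<^sub>v v"]
    by (simp add: mult_mat_vec_index sesq_def mat_fun_def sum_distrib_left mult.assoc del: index_mult_mat_vec)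
qed

lemma psd_iff_pos_form: "psd m M \<longleftrightarrow> M \<in> carrier_mat m m \<and> pos_form {..<m} (mat_fun M)"
proof -
  have "(\<forall>v\<in>carrier_vec m. 0 \<le> (M *\<^sub>v v) \<bullet>c v) \<longleftrightarrow> pos_form {..<m} (mat_fun M)" if M: "M \<in> carrier_mat m m"
  proof
    assume a: "\<forall>v\<in>carrier_vec m. 0 \<le> (M *\<^sub>v v) \<bullet>c v"
    show "pos_form {..<m} (mat_fun M)"
      unfolding pos_form_def
    proof
      fix x
      have "sesq {..<m} (mat_fun M) x x = sesq {..<m} (mat_fun M) (($) (vec m x)) (($) (vec m x))"
        by (rule sesq_cong) auto
      also have "\<dots> = (M *\<^sub>v vec m x) \<bullet>c vec m x" by (rule cscalar_prod_sesq[symmetric]) (use M in auto)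
      finally show "0 \<le> sesq {..<m} (mat_fun M) x x" using a by simp
    qed
  next
    assume "pos_form {..<m} (mat_fun M)"
    then show "\<forall>v\<in>carrier_vec m. 0 \<le> (M *\<^sub>v v) \<bullet>c v"
      using M by (auto simp: cscalar_prod_sesq pos_form_def)
  qed
  then show ?thesis by (auto simp: psd_def)
qed

lemma vnorm_sqnorm: "v \<in> carrier_vec m \<Longrightarrow> vnorm v = sqrt (sqnorm {..<m} (($) v))"
  unfolding vnorm_def
  by (simp add: vec_cscalar_prod sqnorm_def cmod_power2) (simp add: power2_eq_square)

text \<open>The form of \<open>M\<close> at \<open>M v\<close> and \<open>v\<close> is the squared
  norm of \<open>M v\<close>, so Cauchy-Schwarz for this very form yields the norm bound without
  diagonalisation. Positivity of \<open>M\<close> excludes large negative eigenvalues, to which the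
  right-hand side is blind.\<close>

lemma op_norm_le_iff:
  assumes psd: "psd m M" and m: "0 < m"
  shows "op_norm M \<le> t \<longleftrightarrow> (\<forall>x. Re (sesq {..<m} (mat_fun M) x x) \<le> t * sqnorm {..<m} x)"
proof -
  have M: "M \<in> carrier_mat m m" and pos: "pos_form {..<m} (mat_fun M)"
    using psd by (auto simp: psd_iff_pos_form)
  let ?I = "{..<m}" and ?R = "mat_fun M"
  have fin: "finite ?I" by simp
  define N where "N = {vnorm (M *\<^sub>v v) | v. v \<in> carrier_vec m \<and> vnorm v \<le> 1}"
  have op: "op_norm M = Sup N" using M by (simp add: op_norm_def N_def)
  have le: "vnorm (M *\<^sub>v v) \<le> s"
    if bnd: "\<And>x. Re (sesq ?I ?R x x) \<le> s * sqnorm ?I x" and v: "v \<in> carrier_vec m" "vnorm v \<le> 1" for s v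
  proof -
    define x y where "x = ($) v" and "y = ($) (M *\<^sub>v v)"
    have Mv: "M *\<^sub>v v \<in> carrier_vec m" using M v by simp
    have x1: "sqnorm ?I x \<le> 1" using v by (simp add: vnorm_sqnorm x_def)
    have "sesq ?I ?R y x = (M *\<^sub>v v) \<bullet>c (M *\<^sub>v v)"
      unfolding x_def y_def by (rule cscalar_prod_sesq[OF M v(1) Mv, symmetric])
    also have "\<dots> = of_real (sqnorm ?I y)"
      using vec_cscalar_prod[OF Mv Mv] by (simp add: y_def sesq_fun_one flip: sesq_fun_one_self)
    finally have yx: "sesq ?I ?R y x = of_real (sqnorm ?I y)" .
    have nn: "0 \<le> Re (sesq ?I ?R z z)" for z using pos by (auto simp: pos_form_def less_eq_complex_def)
    \<comment> \<open>Test on the all-ones vector, whose squared norm \<open>m\<close> is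
      positive.\<close>
    have s: "0 \<le> s"
    proof -
      have "0 \<le> s * sqnorm ?I (\<lambda>_. 1)" using order_trans[OF nn bnd] .
      then show ?thesis using m by (simp add: sqnorm_def zero_le_mult_iff)
    qed
    have "(sqnorm ?I y)\<^sup>2 \<le> Re (sesq ?I ?R y y) * Re (sesq ?I ?R x x)"
      using pos_form_cauchy_schwarz[OF fin pos, of y x] by (simp add: yx)
    also have "\<dots> \<le> (s * sqnorm ?I y) * (s * sqnorm ?I x)"
      using bnd s by (intro mult_mono mult_nonneg_nonneg sqnorm_nonneg nn)
    also have "\<dots> \<le> (s * sqnorm ?I y) * (s * 1)"
      using s x1 by (intro mult_left_mono mult_nonneg_nonneg sqnorm_nonneg)
    finally have "sqnorm ?I y * sqnorm ?I y \<le> s\<^sup>2 * sqnorm ?I y"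
      by (simp add: power2_eq_square algebra_simps)
    then have "sqnorm ?I y \<le> s\<^sup>2"
      using sqnorm_nonneg[of ?I y] by (cases "sqnorm ?I y = 0") auto
    then show ?thesis using s by (simp add: vnorm_sqnorm[OF Mv] y_def real_le_lsqrt sqnorm_nonneg)
  qed
  have "0\<^sub>v m \<in> carrier_vec m \<and> vnorm (0\<^sub>v m) \<le> 1" by (simp add: vnorm_sqnorm[of _ m] sqnorm_def)
  then have ne: "N \<noteq> {}" unfolding N_def by blast
  have bdd: "bdd_above N"
  proof -
    define B where "B = (\<Sum>k<m. Re (?R k k))"
    have "Re (sesq ?I ?R x x) \<le> (B * real (card ?I)) * sqnorm ?I x" for x
      by (rule sesq_le_bound[OF fin]) (auto simp: B_def intro!: pos_form_entry_le_trace[OF fin pos])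
    from le[OF this] show ?thesis unfolding N_def bdd_above_def by blast
  qed
  show ?thesis
  proof
    assume t: "op_norm M \<le> t"
    have "Re (sesq ?I ?R x x) \<le> t" if x: "sqnorm ?I x = 1" for x
    proof -
      define v where "v = vec m x"
      have v: "v \<in> carrier_vec m" by (simp add: v_def)
      have Mv: "M *\<^sub>v v \<in> carrier_vec m" using M v by simp
      have vx: "v $ i = x i" if "i < m" for i using that by (simp add: v_def)
      have v1: "vnorm v = 1" using sqnorm_cong[of ?I "($) v" x] vx x by (simp add: vnorm_sqnorm[OF v])
      have "vnorm (M *\<^sub>v v) \<in> N" using v v1 unfolding N_def by auto
      then have Mvt: "vnorm (M *\<^sub>v v) \<le> t" using cSup_upper[OF _ bdd] t op by fastforce
      have "sesq ?I ?R x x = sesq ?I ?R (($) v) (($) v)" by (rule sesq_cong) (auto simp: vx)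
      also have "\<dots> = sesq ?I fun_one (($) v) (($) (M *\<^sub>v v))"
        unfolding cscalar_prod_sesq[OF M v v, symmetric] sesq_fun_one[OF fin] by (rule vec_cscalar_prod[OF v Mv])
      finally have "(cmod (sesq ?I ?R x x))\<^sup>2 \<le> sqnorm ?I (($) v) * sqnorm ?I (($) (M *\<^sub>v v))"
        using pos_form_cauchy_schwarz[OF fin pos_form_fun_one[OF fin], of "($) v" "($) (M *\<^sub>v v)"]
        by (simp add: sesq_fun_one_self)
      also have "\<dots> = (vnorm (M *\<^sub>v v))\<^sup>2"
        using v1 Mv v by (simp add: vnorm_sqnorm[of _ m] sqnorm_nonneg)
      finally have "cmod (sesq ?I ?R x x) \<le> vnorm (M *\<^sub>v v)"
        using Mv by (auto intro: power2_le_imp_le simp: vnorm_sqnorm sqnorm_nonneg)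
      then show ?thesis using Mvt complex_Re_le_cmod[of "sesq ?I ?R x x"] by linarith
    qed
    then show "\<forall>x. Re (sesq ?I ?R x x) \<le> t * sqnorm ?I x" using sesq_le_of_unit[OF fin] by blast
  next
    assume "\<forall>x. Re (sesq ?I ?R x x) \<le> t * sqnorm ?I x"
    then show "op_norm M \<le> t"
      unfolding op using le by (intro cSup_least[OF ne]) (auto simp: N_def)
  qed
qed

lemma mat_adjoint_index:
  assumes "X \<in> carrier_mat m m"
  shows "mat_adjoint X \<in> carrier_mat m m"
    and "i < m \<Longrightarrow> j < m \<Longrightarrow> mat_adjoint X $$ (i, j) = cnj (X $$ (j, i))"
  using assms by (auto simp: mat_adjoint_def mat_of_rows_index)

lemma mtrace_mult:
  assumes "X \<in> carrier_mat m m" "Y \<in> carrier_mat m m"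
  shows "mtrace (X * Y) = (\<Sum>i<m. \<Sum>j<m. X $$ (i, j) * Y $$ (j, i))"
  using assms by (simp add: mtrace_def scalar_prod_def atLeast0LessThan)

lemma mtrace_adjoint_mult:
  assumes "X \<in> carrier_mat m m" "Y \<in> carrier_mat m m"
  shows "mtrace (mat_adjoint X * Y) = hsip {..<m} (mat_fun X) (mat_fun Y)"
proof -
  have "mtrace (mat_adjoint X * Y) = (\<Sum>i<m. \<Sum>j<m. cnj (X $$ (j, i)) * Y $$ (j, i))"
    using assms by (simp add: mtrace_mult[OF mat_adjoint_index(1)] mat_adjoint_index(2))
  also have "\<dots> = hsip {..<m} (mat_fun X) (mat_fun Y)"
    unfolding hsip_def mat_fun_def by (rule sum.swap)
  finally show ?thesis .
qed

lemma hs_perp_iff: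
  assumes "S \<subseteq> carrier_mat m m"
  shows "X \<in> hs_perp m S \<longleftrightarrow> X \<in> carrier_mat m m \<and> (\<forall>Y\<in>S. hsip {..<m} (mat_fun X) (mat_fun Y) = 0)"
  using assms mtrace_adjoint_mult unfolding hs_perp_def by (auto simp: subset_eq)

text \<open>The maximum over all pairs of an admissible operator and a unit vector exists by compactness;
  \<open>1 \<in> S\<close> fixes the trace of the operators and makes them bounded.\<close>

lemma lovasz_theta_attained:
  assumes m: "0 < m" and S: "S \<subseteq> carrier_mat m m" and one: "1\<^sub>m m \<in> S"
  shows "\<exists>T\<in>hs_perp m S. psd m (1\<^sub>m m + T) \<and> lovasz_theta m S = op_norm (1\<^sub>m m + T)"
    and "T \<in> hs_perp m S \<Longrightarrow> psd m (1\<^sub>m m + T) \<Longrightarrow> op_norm (1\<^sub>m m + T) \<le> lovasz_theta m S"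
proof -
  let ?I = "{..<m}"
  have fin: "finite ?I" by simp
  \<comment> \<open>The constant \<open>m\<close> is the trace of \<open>1 + T\<close>, as
    \<open>T\<close> is orthogonal to the identity; no entry of a positive form exceeds its
    trace.\<close>
  define bR where "bR = (\<lambda>i j. if i \<in> ?I \<and> j \<in> ?I then real m else 0)"
  define bx where "bx = (\<lambda>i. if i \<in> ?I then 1 else 0 :: real)"
  define KR where "KR = {R. \<forall>i j. cmod (R i j) \<le> bR i j} \<inter> ({R. pos_form ?I R}
     \<inter> (\<Inter>Y\<in>S. {R. hsip ?I (\<lambda>i j. R i j - fun_one i j) (mat_fun Y) = 0}))"
  define Kx where "Kx = {x. \<forall>i. cmod (x i) \<le> bx i} \<inter> {x. sqnorm ?I x = 1}"
  have cR: "continuous_on UNIV (\<lambda>R :: nat \<Rightarrow> nat \<Rightarrow> complex. R i j)" for i j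
    by (rule continuous_on_entry) (rule continuous_on_id)
  have cR2: "continuous_on UNIV (\<lambda>R :: (nat \<Rightarrow> nat \<Rightarrow> complex) \<times> (nat \<Rightarrow> complex). fst R i j)" for i j
    by (rule continuous_on_entry) (intro continuous_intros)
  have cx: "continuous_on UNIV (\<lambda>x :: nat \<Rightarrow> complex. x i)" for i
    by (rule continuous_on_product_then_coordinatewise) (rule continuous_on_id)
  have cx2: "continuous_on UNIV (\<lambda>R :: (nat \<Rightarrow> nat \<Rightarrow> complex) \<times> (nat \<Rightarrow> complex). snd R i)" for i
    by (rule continuous_on_product_then_coordinatewise) (intro continuous_intros)
  have "compact KR"
    unfolding KR_def hsip_def
    by (intro compact_Int_closed compact_coordinate_box closed_Int closed_pos_form cR closed_INT ballI
        closed_Collect_eq continuous_intros)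
  moreover have "compact Kx"
    unfolding Kx_def sqnorm_def
    by (intro compact_Int_closed compact_vector_box closed_Collect_eq continuous_intros cx)
  ultimately have cpt: "compact (KR \<times> Kx)" by (rule compact_Times)
  have toR: "(\<lambda>i j. if i < m \<and> j < m then (1\<^sub>m m + T) $$ (i, j) else 0) \<in> KR"
    if T: "T \<in> hs_perp m S" "psd m (1\<^sub>m m + T)" for T
  proof -
    define R where "R = (\<lambda>i j. if i < m \<and> j < m then (1\<^sub>m m + T) $$ (i, j) else 0)"
    have Tc: "T \<in> carrier_mat m m" using T(1) by (simp add: hs_perp_def)
    have R: "pos_form ?I R"
      using T(2) pos_form_cong[of ?I "mat_fun (1\<^sub>m m + T)" R] by (simp add: psd_iff_pos_form R_def mat_fun_def)
    have orth: "hsip ?I (\<lambda>i j. R i j - fun_one i j) (mat_fun Y) = 0" if "Y \<in> S" for Y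
    proof -
      have "hsip ?I (\<lambda>i j. R i j - fun_one i j) (mat_fun Y) = hsip ?I (mat_fun T) (mat_fun Y)"
        using Tc by (intro hsip_cong) (auto simp: R_def mat_fun_def fun_one_def)
      then show ?thesis using T(1) that by (simp add: hs_perp_iff[OF S])
    qed
    have o1: "hsip ?I X (mat_fun (1\<^sub>m m)) = hsip ?I X fun_one" for X
      by (rule hsip_cong) (auto simp: mat_fun_def fun_one_def)
    have "hsip ?I R fun_one = hsip ?I fun_one fun_one"
      using orth[OF one] unfolding o1 hsip_diff_left by simp
    then have "hsip ?I fun_one R = hsip ?I fun_one fun_one" using hsip_swap by metis
    then have "(\<Sum>i<m. R i i) = of_nat m" by (simp add: hsip_fun_one) (simp add: fun_one_def)
    then have "Re (\<Sum>i<m. R i i) = real m" by simp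
    then have "(\<Sum>i<m. Re (R i i)) = real m" by simp
    then have "cmod (R i j) \<le> bR i j" for i j
      using pos_form_entry_le_trace[OF fin R] by (auto simp: bR_def R_def)
    then show ?thesis using R orth by (simp add: KR_def flip: R_def)
  qed
  have fromR: "mat m m (\<lambda>(i, j). R i j - fun_one i j) \<in> hs_perp m S \<and> psd m (1\<^sub>m m + mat m m (\<lambda>(i, j). R i j - fun_one i j))"
    if R: "R \<in> KR" for R
  proof -
    define T where "T = mat m m (\<lambda>(i, j). R i j - fun_one i j)"
    have "hsip ?I (mat_fun T) (mat_fun Y) = 0" if "Y \<in> S" for Y
    proof -
      have "hsip ?I (mat_fun T) (mat_fun Y) = hsip ?I (\<lambda>i j. R i j - fun_one i j) (mat_fun Y)"
        by (rule hsip_cong) (auto simp: T_def mat_fun_def)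
      then show ?thesis using R that by (simp add: KR_def)
    qed
    then have "T \<in> hs_perp m S" by (simp add: hs_perp_iff[OF S] T_def)
    moreover have "pos_form ?I (mat_fun (1\<^sub>m m + T)) = pos_form ?I R"
      by (rule pos_form_cong) (auto simp: mat_fun_def T_def fun_one_def)
    then have "psd m (1\<^sub>m m + T)" using R by (simp add: psd_iff_pos_form KR_def T_def)
    ultimately show ?thesis by (simp add: T_def)
  qed
  define x0 :: "nat \<Rightarrow> complex" where "x0 = (\<lambda>i. if i = 0 then 1 else 0 :: complex)"
  have "sqnorm ?I x0 = 1" using m by (simp add: sqnorm_def x0_def if_distrib[of cmod] if_distrib[of "\<lambda>z. z\<^sup>2"] cong: if_cong)
  then have x0: "x0 \<in> Kx" using m by (auto simp: Kx_def x0_def bx_def)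
  have "(0\<^sub>m m m :: complex mat) \<in> hs_perp m S"
    using hsip_swap[of ?I "mat_fun (0\<^sub>m m m)"] by (auto simp: hs_perp_iff[OF S] hsip_def mat_fun_def)
  moreover have "psd m (1\<^sub>m m + 0\<^sub>m m m)"
    using pos_form_fun_one[OF fin] pos_form_cong[of ?I "mat_fun (1\<^sub>m m)" fun_one]
    by (simp add: psd_iff_pos_form mat_fun_def fun_one_def)
  ultimately have ne: "KR \<times> Kx \<noteq> {}" using toR x0 by blast
  have "continuous_on (KR \<times> Kx) (\<lambda>z. Re (sesq ?I (fst z) (snd z) (snd z)))"
    unfolding sesq_def
    by (rule continuous_on_subset[of UNIV]) (intro continuous_intros cR2 cx2 | simp)+
  from continuous_attains_sup[OF cpt ne this]
  obtain z1 where z1: "z1 \<in> KR \<times> Kx"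
    and z1_max: "\<And>z. z \<in> KR \<times> Kx \<Longrightarrow> Re (sesq ?I (fst z) (snd z) (snd z)) \<le> Re (sesq ?I (fst z1) (snd z1) (snd z1))"
    by blast
  define R1 x1 where "R1 = fst z1" and "x1 = snd z1"
  have Rx: "R1 \<in> KR" "x1 \<in> Kx" using z1 by (auto simp: R1_def x1_def)
  have max: "Re (sesq ?I R x x) \<le> Re (sesq ?I R1 x1 x1)" if "R \<in> KR" "x \<in> Kx" for R x
    using z1_max[of "(R, x)"] that by (simp add: R1_def x1_def)
  define c where "c = Re (sesq ?I R1 x1 x1)"
  have le: "op_norm (1\<^sub>m m + T) \<le> c" if T: "T \<in> hs_perp m S" "psd m (1\<^sub>m m + T)" for T
  proof -
    define R where "R = (\<lambda>i j. if i < m \<and> j < m then (1\<^sub>m m + T) $$ (i, j) else 0)"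
    have "Re (sesq ?I (mat_fun (1\<^sub>m m + T)) x x) \<le> c" if x: "sqnorm ?I x = 1" for x
    proof -
      define x' where "x' = (\<lambda>i. if i < m then x i else 0)"
      have "cmod (x i) \<le> 1" if "i < m" for i
        using entry_le_sqnorm[OF fin, of i x] that x by (simp add: power2_le_imp_le[of _ 1])
      then have "x' \<in> Kx" using sqnorm_cong[of ?I x x'] x by (auto simp: Kx_def x'_def bx_def)
      then have "Re (sesq ?I R x' x') \<le> c" using max toR[OF T] by (simp add: c_def R_def)
      moreover have "sesq ?I (mat_fun (1\<^sub>m m + T)) x x = sesq ?I R x' x'"
        by (rule sesq_cong) (auto simp: mat_fun_def R_def x'_def)
      ultimately show ?thesis by simp
    qed
    then show ?thesis unfolding op_norm_le_iff[OF T(2) m] using sesq_le_of_unit[OF fin] by blast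
  qed
  define T1 where "T1 = mat m m (\<lambda>(i, j). R1 i j - fun_one i j)"
  have T1: "T1 \<in> hs_perp m S" "psd m (1\<^sub>m m + T1)" using fromR[OF Rx(1)] by (auto simp: T1_def)
  have "c \<le> op_norm (1\<^sub>m m + T1)"
  proof -
    have "sesq ?I R1 x1 x1 = sesq ?I (mat_fun (1\<^sub>m m + T1)) x1 x1"
      by (rule sesq_cong) (auto simp: mat_fun_def T1_def fun_one_def)
    moreover have "Re (sesq ?I (mat_fun (1\<^sub>m m + T1)) x1 x1) \<le> op_norm (1\<^sub>m m + T1) * sqnorm ?I x1"
      using op_norm_le_iff[OF T1(2) m] by blast
    ultimately show ?thesis using Rx(2) by (simp add: c_def Kx_def)
  qed
  with le[OF T1] have eq: "op_norm (1\<^sub>m m + T1) = c" by simp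
  \<comment> \<open>\<open>GREATEST\<close> denotes the maximum only because it is attained, here at
    \<open>T1\<close>.\<close>
  have th: "lovasz_theta m S = c"
    unfolding lovasz_theta_def by (rule Greatest_equality) (use T1 eq le in auto)
  show "\<exists>T\<in>hs_perp m S. psd m (1\<^sub>m m + T) \<and> lovasz_theta m S = op_norm (1\<^sub>m m + T)"
    using T1 eq th by auto
  show "T \<in> hs_perp m S \<Longrightarrow> psd m (1\<^sub>m m + T) \<Longrightarrow> op_norm (1\<^sub>m m + T) \<le> lovasz_theta m S"
    using le th by simp
qed

section \<open>Operators on tensor products\<close>

lemma bij_betw_tensor_index:
  "bij_betw (\<lambda>p. fst p * n + snd p) ({..<m} \<times> {..<n}) {..<m * n :: nat}"
proof (rule bij_betw_byWitness[where f' = "\<lambda>a. (a div n, a mod n)"])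
  show "\<forall>p\<in>{..<m} \<times> {..<n}. ((fst p * n + snd p) div n, (fst p * n + snd p) mod n) = p" by auto
  show "\<forall>a\<in>{..<m * n}. fst (a div n, a mod n) * n + snd (a div n, a mod n) = a" by simp
  show "(\<lambda>p. fst p * n + snd p) ` ({..<m} \<times> {..<n}) \<subseteq> {..<m * n}"
  proof clarsimp
    fix i k assume "i < m" "k < n"
    then have "i * n + k < Suc i * n" by simp
    also have "\<dots> \<le> m * n" using \<open>i < m\<close> by (intro mult_le_mono1) simp
    finally show "i * n + k < m * n" .
  qed
  show "(\<lambda>a. (a div n, a mod n)) ` {..<m * n} \<subseteq> {..<m} \<times> {..<n}"
    by (auto simp: less_mult_imp_div_less) (metis mod_less_divisor mult_0_right not_gr_zero not_less_zero)
qed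

lemma sum_tensor_index:
  fixes n m :: nat
  shows "(\<Sum>a<m * n. f a) = (\<Sum>p\<in>{..<m} \<times> {..<n}. f (fst p * n + snd p))"
  by (rule sum.reindex_bij_betw[OF bij_betw_tensor_index, symmetric])

lemma tensor_index_less: "i < m \<Longrightarrow> k < n \<Longrightarrow> i * n + k < m * (n :: nat)"
  using bij_betw_apply[OF bij_betw_tensor_index, of "(i, k)" m n] by simp

lemma sesq_tensor_fun:
  "sesq {..<m * n} (mat_fun Y) x y
    = sesq ({..<m} \<times> {..<n}) (tensor_fun n Y) (\<lambda>p. x (fst p * n + snd p)) (\<lambda>p. y (fst p * n + snd p))"
  unfolding sesq_def mat_fun_def tensor_fun_def
  by (simp only: sum_tensor_index)

lemma hsip_tensor_fun:
  "hsip {..<m * n} (mat_fun X) (mat_fun Y) = hsip ({..<m} \<times> {..<n}) (tensor_fun n X) (tensor_fun n Y)"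
  unfolding hsip_def mat_fun_def tensor_fun_def
  by (simp only: sum_tensor_index)

lemma sqnorm_tensor:
  fixes n m :: nat
  shows "sqnorm {..<m * n} x = sqnorm ({..<m} \<times> {..<n}) (\<lambda>p. x (fst p * n + snd p))"
  unfolding sqnorm_def by (rule sum_tensor_index)

lemma sesq_tensor_fun':
  "sesq ({..<m} \<times> {..<n}) (tensor_fun n Y) x y
    = sesq {..<m * n} (mat_fun Y) (\<lambda>a. x (a div n, a mod n)) (\<lambda>a. y (a div n, a mod n))"
  unfolding sesq_tensor_fun by (rule sesq_cong) auto

lemma psd_tensor_iff:
  "psd (m * n) Y \<longleftrightarrow> Y \<in> carrier_mat (m * n) (m * n) \<and> pos_form ({..<m} \<times> {..<n}) (tensor_fun n Y)"
proof -
  have "pos_form {..<m * n} (mat_fun Y) \<longleftrightarrow> pos_form ({..<m} \<times> {..<n}) (tensor_fun n Y)"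
    unfolding pos_form_def
  proof (intro iffI allI)
    fix x assume "\<forall>x. 0 \<le> sesq {..<m * n} (mat_fun Y) x x"
    then show "0 \<le> sesq ({..<m} \<times> {..<n}) (tensor_fun n Y) x x" unfolding sesq_tensor_fun' by blast
  next
    fix x assume "\<forall>x. 0 \<le> sesq ({..<m} \<times> {..<n}) (tensor_fun n Y) x x"
    then show "0 \<le> sesq {..<m * n} (mat_fun Y) x x" unfolding sesq_tensor_fun by blast
  qed
  then show ?thesis by (simp add: psd_iff_pos_form)
qed

lemma tensor_mat_carrier [simp]: "tensor_mat m n R \<in> carrier_mat (m * n) (m * n)"
  by (simp add: tensor_mat_def)

lemma tensor_fun_tensor_mat:
  "p \<in> {..<m} \<times> {..<n} \<Longrightarrow> q \<in> {..<m} \<times> {..<n} \<Longrightarrow> tensor_fun n (tensor_mat m n R) p q = R p q"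
  by (auto simp: tensor_fun_def tensor_mat_def tensor_index_less)

lemma tensor_fun_one:
  assumes "p \<in> {..<m} \<times> {..<n}" "q \<in> {..<m} \<times> {..<n}"
  shows "tensor_fun n (1\<^sub>m (m * n)) p q = fun_one p q"
proof -
  have "fst p * n + snd p = fst q * n + snd q \<longleftrightarrow> p = q"
    using inj_on_eq_iff[OF bij_betw_imp_inj_on[OF bij_betw_tensor_index] assms] .
  then show ?thesis
    using assms by (simp add: tensor_fun_def fun_one_def tensor_index_less mem_Times_iff)
qed

lemma tensor_fun_add:
  assumes "X \<in> carrier_mat (m * n) (m * n)" "Y \<in> carrier_mat (m * n) (m * n)"
    "p \<in> {..<m} \<times> {..<n}" "q \<in> {..<m} \<times> {..<n}"
  shows "tensor_fun n (X + Y) p q = tensor_fun n X p q + tensor_fun n Y p q"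
  using assms by (auto simp: tensor_fun_def tensor_index_less)

lemma tensor_fun_minus:
  assumes "X \<in> carrier_mat (m * n) (m * n)" "Y \<in> carrier_mat (m * n) (m * n)"
    "p \<in> {..<m} \<times> {..<n}" "q \<in> {..<m} \<times> {..<n}"
  shows "tensor_fun n (X - Y) p q = tensor_fun n X p q - tensor_fun n Y p q"
  using assms by (auto simp: tensor_fun_def tensor_index_less)

lemma kron_carrier: "X \<in> carrier_mat m m \<Longrightarrow> Z \<in> carrier_mat n n \<Longrightarrow> kron X Z \<in> carrier_mat (m * n) (m * n)"
  by (auto simp: kron_def)

lemma tensor_fun_kron:
  assumes "X \<in> carrier_mat m m" "Z \<in> carrier_mat n n" "p \<in> {..<m} \<times> {..<n}" "q \<in> {..<m} \<times> {..<n}"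
  shows "tensor_fun n (kron X Z) p q = X $$ (fst p, fst q) * Z $$ (snd p, snd q)"
  using assms by (auto simp: tensor_fun_def kron_def tensor_index_less)

lemma tensor_fun_kron_one:
  assumes "\<rho> \<in> carrier_mat n n" "p \<in> {..<m} \<times> {..<n}" "q \<in> {..<m} \<times> {..<n}"
  shows "tensor_fun n (kron (1\<^sub>m m) \<rho>) p q = one_kron (mat_fun \<rho>) p q"
  using assms tensor_fun_kron[of "1\<^sub>m m" m \<rho> n p q] by (auto simp: one_kron_def mat_fun_def)

lemma tensor_mat_eqI:
  assumes "X \<in> carrier_mat (m * n) (m * n)" "Y \<in> carrier_mat (m * n) (m * n)"
    and "\<And>p q. p \<in> {..<m} \<times> {..<n} \<Longrightarrow> q \<in> {..<m} \<times> {..<n} \<Longrightarrow> tensor_fun n X p q = tensor_fun n Y p q"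
  shows "X = Y"
proof (rule eq_matI)
  fix a b assume "a < dim_row Y" "b < dim_col Y"
  then have ab: "a < m * n" "b < m * n" using assms(2) by auto
  then have "0 < n" by (cases n) auto
  then have "(a div n, a mod n) \<in> {..<m} \<times> {..<n}" "(b div n, b mod n) \<in> {..<m} \<times> {..<n}"
    using ab by (simp_all add: less_mult_imp_div_less)
  from assms(3)[OF this] show "X $$ (a, b) = Y $$ (a, b)" by (simp add: tensor_fun_def)
qed (use assms(1,2) in auto)

definition ent_fun :: "nat \<times> nat \<Rightarrow> complex" where
  "ent_fun p = (if fst p = snd p then 1 else 0)"

lemma fun_ent_ent_fun: "fun_ent p q = ent_fun p * cnj (ent_fun q)"
  by (simp add: fun_ent_def ent_fun_def)

lemma ent_vec_index: "p \<in> {..<d} \<times> {..<d} \<Longrightarrow> ent_vec d $ (fst p * d + snd p) = ent_fun p"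
proof -
  assume p: "p \<in> {..<d} \<times> {..<d}"
  then obtain i k where ik: "p = (i, k)" "i < d" "k < d" by auto
  have "ent_vec d $ (i * d + k) = (\<Sum>j<d. unit_vec d j $ i * unit_vec d j $ k)"
    unfolding ent_vec_def using tensor_index_less[OF ik(2,3)] ik
    by (simp add: kron_vec_def)
  also have "\<dots> = (\<Sum>j<d. if j = i then if i = k then 1 else 0 else 0)"
    using ik by (intro sum.cong refl) auto
  finally show ?thesis using ik by (simp add: ent_fun_def)
qed

lemma ent_mat_carrier [simp]: "ent_mat d \<in> carrier_mat (d * d) (d * d)"
  by (simp add: ent_mat_def)

lemma tensor_fun_ent_mat:
  assumes "p \<in> {..<d} \<times> {..<d}" "q \<in> {..<d} \<times> {..<d}"
  shows "tensor_fun d (ent_mat d) p q = fun_ent p q"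
  using assms ent_vec_index[OF assms(1)] ent_vec_index[OF assms(2)]
  by (auto simp: tensor_fun_def ent_mat_def tensor_index_less fun_ent_ent_fun)

lemma sesq_ent_fun: "sesq I R ent_fun ent_fun = hsip I fun_ent R"
  unfolding sesq_def hsip_def by (intro sum.cong refl) (simp add: fun_ent_ent_fun)

lemma pos_form_fun_ent: "pos_form I fun_ent"
  using pos_form_rank_one[of I ent_fun] by (simp add: fun_ent_ent_fun[abs_def])

lemma ent_vec_quadratic:
  assumes "X \<in> carrier_mat (d * d) (d * d)"
  shows "(X *\<^sub>v ent_vec d) \<bullet>c ent_vec d = hsip ({..<d} \<times> {..<d}) fun_ent (tensor_fun d X)"
proof -
  have e: "ent_vec d \<in> carrier_vec (d * d)" by (simp add: ent_vec_def)
  show ?thesis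
    unfolding cscalar_prod_sesq[OF assms e e] sesq_tensor_fun sesq_ent_fun[symmetric]
    by (rule sesq_cong) (simp_all add: ent_vec_index)
qed

lemma mat_fun_ptrace:
  "k < d \<Longrightarrow> l < d \<Longrightarrow> mat_fun (ptrace_fst d d Y) k l = fun_ptrace d (tensor_fun d Y) k l"
  by (simp add: mat_fun_def ptrace_fst_def fun_ptrace_def tensor_fun_def)

lemma sesq_blocks:
  "sesq (A \<times> B) R x y = (\<Sum>i\<in>A. \<Sum>j\<in>A. sesq B (\<lambda>k l. R (i, k) (j, l)) (\<lambda>k. x (i, k)) (\<lambda>l. y (j, l)))"
  unfolding sesq_def sum_times by (intro sum.cong refl sum.swap)

text \<open>Grouped by the second factor, so that each block is an operator on the first one, where
  \<open>S\<close> lives.\<close>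

lemma hsip_blocks:
  "hsip (A \<times> B) X Y = (\<Sum>k\<in>B. \<Sum>l\<in>B. hsip A (\<lambda>i j. X (i, k) (j, l)) (\<lambda>i j. Y (i, k) (j, l)))"
proof -
  let ?f = "\<lambda>i k j l. cnj (X (i, k) (j, l)) * Y (i, k) (j, l)"
  have "hsip (A \<times> B) X Y = (\<Sum>i\<in>A. \<Sum>k\<in>B. \<Sum>j\<in>A. \<Sum>l\<in>B. ?f i k j l)"
    by (simp add: hsip_def sum_times)
  also have "\<dots> = (\<Sum>k\<in>B. \<Sum>i\<in>A. \<Sum>j\<in>A. \<Sum>l\<in>B. ?f i k j l)" by (rule sum.swap)
  also have "\<dots> = (\<Sum>k\<in>B. \<Sum>i\<in>A. \<Sum>l\<in>B. \<Sum>j\<in>A. ?f i k j l)" by (intro sum.cong refl sum.swap)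
  also have "\<dots> = (\<Sum>k\<in>B. \<Sum>l\<in>B. \<Sum>i\<in>A. \<Sum>j\<in>A. ?f i k j l)" by (intro sum.cong refl sum.swap)
  finally show ?thesis by (simp add: hsip_def)
qed

section \<open>Operator spaces and their orthogonal complements\<close>

lemma subspace_matD:
  assumes "VectorSpace.subspace class_ring S (mat_space m)"
  shows "S \<subseteq> carrier_mat m m" "0\<^sub>m m m \<in> S" "X \<in> S \<Longrightarrow> Y \<in> S \<Longrightarrow> X + Y \<in> S" "X \<in> S \<Longrightarrow> c \<cdot>\<^sub>m X \<in> S"
  using assms unfolding subspace_def submodule_def module_mat_simps
  by (auto simp: class_ring_simps)

lemma subspace_matI:
  assumes "S \<subseteq> carrier_mat m m" "0\<^sub>m m m \<in> S"
    and "\<And>X Y. X \<in> S \<Longrightarrow> Y \<in> S \<Longrightarrow> X + Y \<in> S" "\<And>c X. X \<in> S \<Longrightarrow> c \<cdot>\<^sub>m X \<in> S"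
  shows "VectorSpace.subspace class_ring S (mat_space m)"
proof -
  interpret vectorspace class_ring "mat_space m" by (rule matrix_vs)
  show ?thesis
    unfolding subspace_def submodule_def module_mat_simps using assms vectorspace_axioms module_axioms by auto
qed

lemma hs_perp_carrier: "hs_perp m S \<subseteq> carrier_mat m m"
  by (auto simp: hs_perp_def)

lemma subspace_hs_perp:
  assumes S: "S \<subseteq> carrier_mat m m"
  shows "VectorSpace.subspace class_ring (hs_perp m S) (mat_space m)"
proof (rule subspace_matI[OF hs_perp_carrier])
  show "0\<^sub>m m m \<in> hs_perp m S" by (simp add: hs_perp_iff[OF S] hsip_def mat_fun_def)
next
  fix X Y assume XY: "X \<in> hs_perp m S" "Y \<in> hs_perp m S"
  have "hsip {..<m} (mat_fun (X + Y)) Z = hsip {..<m} (mat_fun X) Z + hsip {..<m} (mat_fun Y) Z" for Z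
    unfolding hsip_add_left[symmetric] by (rule hsip_cong) (use XY in \<open>auto simp: mat_fun_def hs_perp_def\<close>)
  then show "X + Y \<in> hs_perp m S" using XY by (auto simp: hs_perp_iff[OF S])
next
  fix c X assume X: "X \<in> hs_perp m S"
  have "hsip {..<m} (mat_fun (c \<cdot>\<^sub>m X)) Z = cnj c * hsip {..<m} (mat_fun X) Z" for Z
    unfolding hsip_scale_left[symmetric] by (rule hsip_cong) (use X in \<open>auto simp: mat_fun_def hs_perp_def\<close>)
  then show "c \<cdot>\<^sub>m X \<in> hs_perp m S" using X by (auto simp: hs_perp_iff[OF S])
qed

text \<open>Let \<open>P\<close> be the projection of \<open>X\<close> to \<open>S\<close> and
  \<open>E = X - P\<close>. Then \<open>E\<close> lies in the complement of \<open>S\<close>, so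
  both \<open>X\<close> and \<open>P\<close> are orthogonal to \<open>E\<close>, and therefore
  \<open>E\<close> is orthogonal to itself.\<close>

lemma hs_perp_hs_perp:
  assumes sub: "VectorSpace.subspace class_ring S (mat_space m)"
  shows "hs_perp m (hs_perp m S) = S"
proof
  note S = subspace_matD[OF sub]
  show "S \<subseteq> hs_perp m (hs_perp m S)"
  proof
    fix X assume X: "X \<in> S"
    then have "hsip {..<m} (mat_fun X) (mat_fun Y) = 0" if "Y \<in> hs_perp m S" for Y
      using that hsip_swap[of "{..<m}" "mat_fun X" "mat_fun Y"] by (simp add: hs_perp_iff[OF S(1)])
    then show "X \<in> hs_perp m (hs_perp m S)" using X S(1) by (auto simp: hs_perp_iff[OF hs_perp_carrier])
  qed
  show "hs_perp m (hs_perp m S) \<subseteq> S"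
  proof
    fix X assume X: "X \<in> hs_perp m (hs_perp m S)"
    then have Xc: "X \<in> carrier_mat m m" by (simp add: hs_perp_def)
    let ?I = "{..<m} \<times> {..<m}"
    \<comment> \<open>The projection lemma speaks about functions, so matrices become vectors
      indexed by pairs, set to 0 outside the index range.\<close>
    define W where "W = {(\<lambda>p. if p \<in> ?I then M $$ p else 0) | M. M \<in> S}"
    have "\<exists>p\<in>W. \<forall>w\<in>W. (\<Sum>i\<in>?I. cnj (w i) * (X $$ i - p i)) = 0"
    proof (rule ex_orthogonal_projection)
      show "(\<lambda>_. 0) \<in> W" unfolding W_def by (rule CollectI, rule exI[of _ "0\<^sub>m m m"]) (auto simp: S)
    next
      fix u v assume "u \<in> W" "v \<in> W"
      then obtain M N where "M \<in> S" "N \<in> S" "u = (\<lambda>p. if p \<in> ?I then M $$ p else 0)"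
        "v = (\<lambda>p. if p \<in> ?I then N $$ p else 0)" by (auto simp: W_def)
      then show "(\<lambda>i. u i + v i) \<in> W" unfolding W_def using S(1,3)
        by (intro CollectI exI[of _ "M + N"]) (fastforce simp: fun_eq_iff)
    next
      fix c u assume "u \<in> W"
      then obtain M where "M \<in> S" "u = (\<lambda>p. if p \<in> ?I then M $$ p else 0)" by (auto simp: W_def)
      then show "(\<lambda>i. c * u i) \<in> W" unfolding W_def using S(1,4)
        by (intro CollectI exI[of _ "c \<cdot>\<^sub>m M"]) (fastforce simp: fun_eq_iff)
    qed simp
    then obtain p where p: "p \<in> W" "\<forall>w\<in>W. (\<Sum>i\<in>?I. cnj (w i) * (X $$ i - p i)) = 0" by blast
    then obtain P where P: "P \<in> S" and p_P: "p = (\<lambda>i. if i \<in> ?I then P $$ i else 0)"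
      by (auto simp: W_def)
    have orth: "(\<Sum>i\<in>?I. cnj (M $$ i) * (X $$ i - P $$ i)) = 0" if "M \<in> S" for M
    proof -
      have "(\<lambda>i. if i \<in> ?I then M $$ i else 0) \<in> W" using that by (auto simp: W_def)
      from bspec[OF p(2) this]
      show ?thesis unfolding p_P by (subst (asm) sum.cong[OF refl, of _ _ "\<lambda>i. cnj (M $$ i) * (X $$ i - P $$ i)"]) auto
    qed
    have Pc: "P \<in> carrier_mat m m" using P S(1) by blast
    define E where "E = X - P"
    have Ec: "E \<in> carrier_mat m m" using Pc by (simp add: E_def minus_carrier_mat)
    have ent: "mat_fun E i j = X $$ (i, j) - P $$ (i, j)" if "i < m" "j < m" for i j
      using that Xc Pc by (simp add: E_def mat_fun_def)
    have ME: "hsip {..<m} (mat_fun M) (mat_fun E) = 0" if "M \<in> S" for M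
    proof -
      have "hsip {..<m} (mat_fun M) (mat_fun E) = (\<Sum>i\<in>?I. cnj (M $$ i) * (X $$ i - P $$ i))"
        unfolding hsip_def sum_times by (intro sum.cong refl) (simp add: ent[unfolded mat_fun_def] mat_fun_def)
      then show ?thesis using orth[OF that] by simp
    qed
    have "hsip {..<m} (mat_fun E) (mat_fun M) = 0" if "M \<in> S" for M
      using ME[OF that] hsip_swap by (metis complex_cnj_zero)
    then have E: "E \<in> hs_perp m S" using Ec by (simp add: hs_perp_iff[OF S(1)])
    then have "hsip {..<m} (mat_fun X) (mat_fun E) = 0" using X by (simp add: hs_perp_iff[OF hs_perp_carrier])
    moreover have "hsip {..<m} (mat_fun E) (mat_fun E) = hsip {..<m} (mat_fun X) (mat_fun E) - hsip {..<m} (mat_fun P) (mat_fun E)"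
      unfolding hsip_diff_left[symmetric] by (rule hsip_cong) (simp_all add: ent[unfolded mat_fun_def] mat_fun_def)
    ultimately have EE: "hsip {..<m} (mat_fun E) (mat_fun E) = 0" using ME[OF P] by simp
    have "mat_fun E i j = 0" if "i < m" "j < m" for i j
      using entry_le_hsip_self[of "{..<m}" i j "mat_fun E"] that EE by simp
    then have "X = P" using Xc Pc by (intro eq_matI) (auto simp: ent)
    then show "X \<in> S" using P by simp
  qed
qed

lemma mat_fun_adjoint:
  "X \<in> carrier_mat m m \<Longrightarrow> i < m \<Longrightarrow> j < m \<Longrightarrow> mat_fun (mat_adjoint X) i j = cnj (mat_fun X j i)"
  by (simp add: mat_fun_def mat_adjoint_index)

lemma hs_perp_adjoint:
  assumes S: "S \<subseteq> carrier_mat m m" and adj: "mat_adjoint ` S = S" and X: "X \<in> hs_perp m S"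
  shows "mat_adjoint X \<in> hs_perp m S"
proof -
  have Xc: "X \<in> carrier_mat m m" using X by (simp add: hs_perp_def)
  have "hsip {..<m} (mat_fun (mat_adjoint X)) (mat_fun Y) = 0" if Y: "Y \<in> S" for Y
  proof -
    have Yc: "Y \<in> carrier_mat m m" using Y S by blast
    have "hsip {..<m} (mat_fun (mat_adjoint X)) (mat_fun Y)
      = (\<Sum>i<m. \<Sum>j<m. mat_fun X j i * cnj (mat_fun (mat_adjoint Y) j i))"
      unfolding hsip_def using Xc Yc by (intro sum.cong refl) (simp add: mat_fun_adjoint)
    also have "\<dots> = (\<Sum>j<m. \<Sum>i<m. mat_fun X j i * cnj (mat_fun (mat_adjoint Y) j i))" by (rule sum.swap)
    also have "\<dots> = cnj (hsip {..<m} (mat_fun X) (mat_fun (mat_adjoint Y)))" by (simp add: hsip_def)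
    also have "\<dots> = 0" using X adj Y by (auto simp: hs_perp_iff[OF S])
    finally show ?thesis .
  qed
  then show ?thesis using mat_adjoint_index(1)[OF Xc] by (simp add: hs_perp_iff[OF S])
qed

text \<open>This is \<open>S \<otimes> L(C^n)\<close> read off from blocks
  (\<open>tensor_space_iff\<close>): finitely many conditions on operators of the first factor, with
  entries outside the index range left free.\<close>

definition block_space :: "nat \<Rightarrow> nat \<Rightarrow> complex mat set \<Rightarrow> (nat \<times> nat \<Rightarrow> nat \<times> nat \<Rightarrow> complex) set" where
  "block_space m n S = {R. \<forall>k<n. \<forall>l<n. mat m m (\<lambda>(i, j). R (i, k) (j, l)) \<in> S}"

lemma block_space_local:
  assumes "R \<in> block_space m n S"
    and "\<And>p q. p \<in> {..<m} \<times> {..<n} \<Longrightarrow> q \<in> {..<m} \<times> {..<n} \<Longrightarrow> R p q = Z p q"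
  shows "Z \<in> block_space m n S"
proof -
  have "mat m m (\<lambda>(i, j). Z (i, k) (j, l)) = mat m m (\<lambda>(i, j). R (i, k) (j, l))" if "k < n" "l < n" for k l
    using assms(2) that by (intro eq_matI) auto
  then show ?thesis using assms(1) by (simp add: block_space_def)
qed

lemma block_space_lin:
  assumes sub: "VectorSpace.subspace class_ring S (mat_space m)"
    and R: "R \<in> block_space m n S" and Z: "Z \<in> block_space m n S"
  shows "(\<lambda>p q. R p q + c * Z p q) \<in> block_space m n S"
proof -
  have "mat m m (\<lambda>(i, j). R (i, k) (j, l) + c * Z (i, k) (j, l))
      = mat m m (\<lambda>(i, j). R (i, k) (j, l)) + c \<cdot>\<^sub>m mat m m (\<lambda>(i, j). Z (i, k) (j, l))" for k l
    by (intro eq_matI) auto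
  then show ?thesis using R Z subspace_matD[OF sub] by (simp add: block_space_def)
qed

lemma block_space_zero:
  assumes "VectorSpace.subspace class_ring S (mat_space m)"
  shows "(\<lambda>p q. 0) \<in> block_space m n S"
proof -
  have "mat m m (\<lambda>(i, j). 0 :: complex) = 0\<^sub>m m m" by (intro eq_matI) auto
  then show ?thesis using subspace_matD(2)[OF assms] by (simp add: block_space_def)
qed

lemma fun_one_block_space:
  assumes sub: "VectorSpace.subspace class_ring S (mat_space m)" and one: "1\<^sub>m m \<in> S"
  shows "fun_one \<in> block_space m n S"
proof -
  have "mat m m (\<lambda>(i, j). fun_one (i, k) (j, l)) = (if k = l then 1\<^sub>m m else 0\<^sub>m m m)" for k l :: nat
    by (intro eq_matI) (auto simp: fun_one_def)
  then show ?thesis using one subspace_matD(2)[OF sub] by (simp add: block_space_def)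
qed

lemma block_space_adjoint:
  assumes adj: "\<And>X. X \<in> S \<Longrightarrow> mat_adjoint X \<in> S" and R: "R \<in> block_space m n S"
  shows "(\<lambda>p q. cnj (R q p)) \<in> block_space m n S"
proof -
  have "mat m m (\<lambda>(i, j). cnj (R (j, l) (i, k))) = mat_adjoint (mat m m (\<lambda>(i, j). R (i, l) (j, k)))" for k l
  proof -
    have c: "mat m m (\<lambda>(i, j). R (i, l) (j, k)) \<in> carrier_mat m m" by simp
    show ?thesis using mat_adjoint_index[OF c] by (intro eq_matI) auto
  qed
  then show ?thesis using R adj by (simp add: block_space_def)
qed

text \<open>The block condition defines a subspace that contains all generators, hence their span.
  Conversely, \<open>Y\<close> is the sum over \<open>(k, l)\<close> of its block at
  \<open>(k, l)\<close> tensored with a matrix unit; the sum is built one block position at a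
  time.\<close>

lemma tensor_space_iff:
  assumes sub: "VectorSpace.subspace class_ring S (mat_space m)"
  shows "Y \<in> tensor_space m S n (carrier_mat n n) \<longleftrightarrow>
    Y \<in> carrier_mat (m * n) (m * n) \<and> tensor_fun n Y \<in> block_space m n S"
proof -
  note S = subspace_matD[OF sub]
  interpret vectorspace class_ring "mat_space (m * n)" by (rule matrix_vs)
  let ?G = "{kron X Z | X Z. X \<in> S \<and> Z \<in> carrier_mat n n}"
  let ?N = "{Y \<in> carrier_mat (m * n) (m * n). tensor_fun n Y \<in> block_space m n S}"
  have G: "?G \<subseteq> carrier (mat_space (m * n))"
    using S(1) unfolding module_mat_simps by (auto intro: kron_carrier)
  have G_N: "?G \<subseteq> ?N"
  proof
    fix Y assume "Y \<in> ?G"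
    then obtain X Z where XZ: "X \<in> S" "Z \<in> carrier_mat n n" "Y = kron X Z" by blast
    have Xc: "X \<in> carrier_mat m m" using XZ(1) S(1) by blast
    have "mat m m (\<lambda>(i, j). tensor_fun n Y (i, k) (j, l)) = Z $$ (k, l) \<cdot>\<^sub>m X" if "k < n" "l < n" for k l
      using that Xc XZ by (intro eq_matI) (auto simp: tensor_fun_kron)
    then show "Y \<in> ?N" using S(4)[OF XZ(1)] XZ kron_carrier[OF Xc XZ(2)] by (simp add: block_space_def)
  qed
  have "VectorSpace.subspace class_ring ?N (mat_space (m * n))"
  proof (rule subspace_matI)
    show "0\<^sub>m (m * n) (m * n) \<in> ?N"
      using block_space_local[OF block_space_zero[OF sub, of n], of "tensor_fun n (0\<^sub>m (m * n) (m * n))"]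
      by (auto simp: tensor_fun_def tensor_index_less)
  next
    fix X Y assume XY: "X \<in> ?N" "Y \<in> ?N"
    have "(\<lambda>p q. tensor_fun n X p q + 1 * tensor_fun n Y p q) \<in> block_space m n S"
      using XY by (intro block_space_lin[OF sub]) auto
    then have "tensor_fun n (X + Y) \<in> block_space m n S"
      by (rule block_space_local) (use XY in \<open>simp add: tensor_fun_add[of _ m]\<close>)
    then show "X + Y \<in> ?N" using XY by simp
  next
    fix c X assume X: "X \<in> ?N"
    have "(\<lambda>p q. 0 + c * tensor_fun n X p q) \<in> block_space m n S"
      using X by (intro block_space_lin[OF sub] block_space_zero[OF sub]) auto
    then have "tensor_fun n (c \<cdot>\<^sub>m X) \<in> block_space m n S"
      by (rule block_space_local) (use X in \<open>auto simp: tensor_fun_def tensor_index_less\<close>)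
    then show "c \<cdot>\<^sub>m X \<in> ?N" using X by simp
  qed auto
  then have "span ?G \<subseteq> ?N" by (intro span_is_subset[OF G_N]) simp
  moreover have "?N \<subseteq> span ?G"
  proof
    fix Y assume Y: "Y \<in> ?N"
    have "VectorSpace.subspace class_ring (span ?G) (mat_space (m * n))"
      using span_is_submodule[OF G] vectorspace_axioms by (simp add: subspace_def)
    note T = subspace_matD[OF this]
    have part: "tensor_mat m n (\<lambda>p q. if (snd p, snd q) \<in> A then tensor_fun n Y p q else 0) \<in> span ?G"
      if "finite A" "A \<subseteq> {..<n} \<times> {..<n}" for A
      using that
    proof (induction A rule: finite_induct)
      case empty
      have "tensor_mat m n (\<lambda>p q. if (snd p, snd q) \<in> {} then tensor_fun n Y p q else 0) = 0\<^sub>m (m * n) (m * n)"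
        by (intro eq_matI) (auto simp: tensor_mat_def)
      then show ?case using T(2) by simp
    next
      case (insert a A)
      obtain k l where a: "a = (k, l)" and kl: "k < n" "l < n" using insert.prems by (cases a) auto
      define X where "X = mat m m (\<lambda>(i, j). tensor_fun n Y (i, k) (j, l))"
      define Z where "Z = mat n n (\<lambda>b. if b = (k, l) then 1 else 0 :: complex)"
      have XZ: "X \<in> S" "Z \<in> carrier_mat n n" "X \<in> carrier_mat m m"
        using Y kl by (auto simp: block_space_def X_def Z_def)
      have "kron X Z \<in> span ?G" using in_own_span[OF G] XZ by blast
      moreover have "tensor_mat m n (\<lambda>p q. if (snd p, snd q) \<in> insert a A then tensor_fun n Y p q else 0)
        = tensor_mat m n (\<lambda>p q. if (snd p, snd q) \<in> A then tensor_fun n Y p q else 0) + kron X Z"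
      proof (rule tensor_mat_eqI)
        fix p q assume pq: "p \<in> {..<m} \<times> {..<n}" "q \<in> {..<m} \<times> {..<n}"
        have "tensor_fun n (kron X Z) p q = (if (snd p, snd q) = a then tensor_fun n Y p q else 0)"
          using pq tensor_fun_kron[OF XZ(3,2) pq] by (auto simp: X_def Z_def a)
        then show "tensor_fun n (tensor_mat m n (\<lambda>p q. if (snd p, snd q) \<in> insert a A then tensor_fun n Y p q else 0)) p q
          = tensor_fun n (tensor_mat m n (\<lambda>p q. if (snd p, snd q) \<in> A then tensor_fun n Y p q else 0) + kron X Z) p q"
          using insert.hyps
          by (simp add: tensor_fun_add[OF tensor_mat_carrier kron_carrier[OF XZ(3,2)] pq] tensor_fun_tensor_mat[OF pq])
      qed (use kron_carrier[OF XZ(3,2)] in auto)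
      ultimately show ?case using insert T(3) by simp
    qed
    have "Y = tensor_mat m n (\<lambda>p q. if (snd p, snd q) \<in> {..<n} \<times> {..<n} then tensor_fun n Y p q else 0)"
      using Y by (intro tensor_mat_eqI) (auto simp: tensor_fun_tensor_mat)
    then show "Y \<in> span ?G" using part[of "{..<n} \<times> {..<n}"] by simp
  qed
  ultimately show ?thesis unfolding tensor_space_def by blast
qed

lemma block_space_hs_perp_iff:
  assumes S: "S \<subseteq> carrier_mat m m"
  shows "R \<in> block_space m n (hs_perp m S) \<longleftrightarrow>
    (\<forall>k<n. \<forall>l<n. \<forall>Y\<in>S. hsip {..<m} (\<lambda>i j. R (i, k) (j, l)) (mat_fun Y) = 0)"
proof -
  have "hsip {..<m} (mat_fun (mat m m (\<lambda>(i, j). R (i, k) (j, l)))) Z = hsip {..<m} (\<lambda>i j. R (i, k) (j, l)) Z" for k l Z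
    by (rule hsip_cong) (auto simp: mat_fun_def)
  then show ?thesis by (simp add: block_space_def hs_perp_iff[OF S])
qed

lemma hsip_block_space_perp:
  assumes S: "S \<subseteq> carrier_mat m m"
    and R: "R \<in> block_space m n (hs_perp m S)" and Z: "Z \<in> block_space m n S"
  shows "hsip ({..<m} \<times> {..<n}) R Z = 0"
proof -
  have "hsip {..<m} (\<lambda>i j. R (i, k) (j, l)) (\<lambda>i j. Z (i, k) (j, l)) = 0" if "k < n" "l < n" for k l
  proof -
    have "hsip {..<m} (\<lambda>i j. R (i, k) (j, l)) (\<lambda>i j. Z (i, k) (j, l))
        = hsip {..<m} (\<lambda>i j. R (i, k) (j, l)) (mat_fun (mat m m (\<lambda>(i, j). Z (i, k) (j, l))))"
      by (rule hsip_cong) (auto simp: mat_fun_def)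
    moreover have "mat m m (\<lambda>(i, j). Z (i, k) (j, l)) \<in> S" using Z that by (simp add: block_space_def)
    ultimately show ?thesis using R that by (simp add: block_space_hs_perp_iff[OF S])
  qed
  then show ?thesis unfolding hsip_blocks by (intro sum.neutral ballI) auto
qed

text \<open>Test \<open>R\<close> against forms whose only non-zero block is an element of
  \<open>S\<close>; the pairing then isolates one block of \<open>R\<close>.\<close>

lemma block_space_hs_perpI:
  assumes sub: "VectorSpace.subspace class_ring S (mat_space m)"
    and R: "\<And>Z. Z \<in> block_space m n S \<Longrightarrow> hsip ({..<m} \<times> {..<n}) R Z = 0"
  shows "R \<in> block_space m n (hs_perp m S)"
  unfolding block_space_hs_perp_iff[OF subspace_matD(1)[OF sub]]
proof (intro allI impI ballI)
  note S = subspace_matD[OF sub]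
  fix k l Y assume kl: "k < n" "l < n" and Y: "Y \<in> S"
  define Z where "Z = (\<lambda>p q. if snd p = k \<and> snd q = l then mat_fun Y (fst p) (fst q) else 0)"
  have "mat m m (\<lambda>(i, j). Z (i, k') (j, l')) = (if k' = k \<and> l' = l then Y else 0\<^sub>m m m)" for k' l'
    using S(1) Y by (intro eq_matI) (auto simp: Z_def mat_fun_def)
  then have "Z \<in> block_space m n S" using Y S(2) by (simp add: block_space_def)
  note Z_in = this
  let ?h = "hsip {..<m} (\<lambda>i j. R (i, k) (j, l)) (mat_fun Y)"
  have "hsip {..<m} (\<lambda>i j. R (i, k') (j, l')) (\<lambda>i j. Z (i, k') (j, l'))
      = (if k' = k then if l' = l then ?h else 0 else 0)" for k' l'
    by (simp add: Z_def hsip_def)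
  then have "hsip ({..<m} \<times> {..<n}) R Z = (\<Sum>k'<n. \<Sum>l'<n. if k' = k then if l' = l then ?h else 0 else 0)"
    unfolding hsip_blocks by simp
  also have "\<dots> = (\<Sum>k'<n. if k' = k then \<Sum>l'<n. if l' = l then ?h else 0 else 0)"
    by (intro sum.cong refl) simp
  also have "\<dots> = ?h" using kl by simp
  finally show "?h = 0" using R[OF Z_in] by simp
qed

text \<open>The second factor is the full operator space, so orthogonality can be tested block by
  block and complementing affects the first factor only. This identifies the complement in
  \<open>lovasz_theta\<close> with \<open>S^\<bottom> \<otimes> L(C^n)\<close>.\<close>

lemma hs_perp_tensor_space_iff:
  assumes sub: "VectorSpace.subspace class_ring S (mat_space m)"
  shows "T \<in> hs_perp (m * n) (tensor_space m S n (carrier_mat n n)) \<longleftrightarrow>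
    T \<in> carrier_mat (m * n) (m * n) \<and> tensor_fun n T \<in> block_space m n (hs_perp m S)"
proof -
  note S = subspace_matD[OF sub]
  have ts: "tensor_space m S n (carrier_mat n n) \<subseteq> carrier_mat (m * n) (m * n)"
    using tensor_space_iff[OF sub] by blast
  have "(\<forall>Y\<in>tensor_space m S n (carrier_mat n n). hsip {..<m * n} (mat_fun T) (mat_fun Y) = 0)
    \<longleftrightarrow> tensor_fun n T \<in> block_space m n (hs_perp m S)"
  proof
    assume a: "\<forall>Y\<in>tensor_space m S n (carrier_mat n n). hsip {..<m * n} (mat_fun T) (mat_fun Y) = 0"
    show "tensor_fun n T \<in> block_space m n (hs_perp m S)"
    proof (rule block_space_hs_perpI[OF sub])
      fix Z assume "Z \<in> block_space m n S"
      then have "tensor_fun n (tensor_mat m n Z) \<in> block_space m n S"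
        by (rule block_space_local) (simp add: tensor_fun_tensor_mat)
      then have "hsip ({..<m} \<times> {..<n}) (tensor_fun n T) (tensor_fun n (tensor_mat m n Z)) = 0"
        using a by (simp add: tensor_space_iff[OF sub] hsip_tensor_fun)
      moreover have "hsip ({..<m} \<times> {..<n}) (tensor_fun n T) (tensor_fun n (tensor_mat m n Z))
          = hsip ({..<m} \<times> {..<n}) (tensor_fun n T) Z"
        by (rule hsip_cong) (simp_all add: tensor_fun_tensor_mat)
      ultimately show "hsip ({..<m} \<times> {..<n}) (tensor_fun n T) Z = 0" by simp
    qed
  next
    assume "tensor_fun n T \<in> block_space m n (hs_perp m S)"
    then show "\<forall>Y\<in>tensor_space m S n (carrier_mat n n). hsip {..<m * n} (mat_fun T) (mat_fun Y) = 0"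
      by (simp add: tensor_space_iff[OF sub] hsip_tensor_fun hsip_block_space_perp[OF S(1)])
  qed
  then show ?thesis by (simp add: hs_perp_iff[OF ts])
qed

section \<open>Transforming the second tensor factor\<close>

text \<open>The conjugation \<open>(1 \<otimes> N)^* X (1 \<otimes> N)\<close>. \<open>N\<close> may
  be rectangular: it has \<open>n\<close> rows, and the range of its columns is left open.\<close>

definition congr :: "nat \<Rightarrow> (nat \<Rightarrow> nat \<Rightarrow> complex) \<Rightarrow> (nat \<times> nat \<Rightarrow> nat \<times> nat \<Rightarrow> complex)
    \<Rightarrow> nat \<times> nat \<Rightarrow> nat \<times> nat \<Rightarrow> complex" where
  "congr n N X p q = (\<Sum>k<n. \<Sum>l<n. cnj (N k (snd p)) * X (fst p, k) (fst q, l) * N l (snd q))"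

lemma sesq_congruence:
  "sesq J (\<lambda>a b. \<Sum>k\<in>K. \<Sum>l\<in>K. cnj (N k a) * R k l * N l b) x y
    = sesq K R (\<lambda>k. \<Sum>a\<in>J. N k a * x a) (\<lambda>l. \<Sum>b\<in>J. N l b * y b)"
proof -
  let ?t = "\<lambda>a b k l. cnj (N k a * x a) * R k l * (N l b * y b)"
  have "sesq J (\<lambda>a b. \<Sum>k\<in>K. \<Sum>l\<in>K. cnj (N k a) * R k l * N l b) x y
      = (\<Sum>a\<in>J. \<Sum>b\<in>J. \<Sum>k\<in>K. \<Sum>l\<in>K. ?t a b k l)"
    by (simp add: sesq_def sum_distrib_left sum_distrib_right mult_ac)
  also have "\<dots> = (\<Sum>a\<in>J. \<Sum>k\<in>K. \<Sum>b\<in>J. \<Sum>l\<in>K. ?t a b k l)" by (intro sum.cong refl sum.swap)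
  also have "\<dots> = (\<Sum>k\<in>K. \<Sum>a\<in>J. \<Sum>b\<in>J. \<Sum>l\<in>K. ?t a b k l)" by (rule sum.swap)
  also have "\<dots> = (\<Sum>k\<in>K. \<Sum>a\<in>J. \<Sum>l\<in>K. \<Sum>b\<in>J. ?t a b k l)" by (intro sum.cong refl sum.swap)
  also have "\<dots> = (\<Sum>k\<in>K. \<Sum>l\<in>K. \<Sum>a\<in>J. \<Sum>b\<in>J. ?t a b k l)" by (intro sum.cong refl sum.swap)
  also have "\<dots> = (\<Sum>k\<in>K. \<Sum>l\<in>K. \<Sum>b\<in>J. \<Sum>a\<in>J. ?t a b k l)" by (intro sum.cong refl sum.swap)
  also have "\<dots> = sesq K R (\<lambda>k. \<Sum>a\<in>J. N k a * x a) (\<lambda>l. \<Sum>b\<in>J. N l b * y b)"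
    by (simp only: sesq_def cnj_sum sum_distrib_left sum_distrib_right)
  finally show ?thesis .
qed

lemma sesq_congr:
  "sesq (A \<times> B) (congr n N X) x y = sesq (A \<times> {..<n}) X
    (\<lambda>p. \<Sum>a\<in>B. N (snd p) a * x (fst p, a)) (\<lambda>q. \<Sum>b\<in>B. N (snd q) b * y (fst q, b))"
  unfolding sesq_blocks congr_def fst_conv snd_conv sesq_congruence ..

lemma congr_diff: "congr n N (\<lambda>p q. X p q - Y p q) = (\<lambda>p q. congr n N X p q - congr n N Y p q)"
  by (simp add: congr_def fun_eq_iff sum_subtractf algebra_simps)

lemma congr_one_kron:
  "congr n N (one_kron G) = one_kron (\<lambda>a b. \<Sum>k<n. \<Sum>l<n. cnj (N k a) * G k l * N l b)"
  by (simp add: congr_def one_kron_def fun_eq_iff)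

lemma fun_one_one_kron: "fun_one = one_kron fun_one"
  by (auto simp: fun_one_def one_kron_def fun_eq_iff)

lemma gram_fun_one:
  fixes n :: nat
  shows "(\<Sum>k<n. \<Sum>l<n. cnj (N k a) * fun_one k l * N l b) = (\<Sum>k<n. cnj (N k a) * N k b)"
proof -
  have "(\<Sum>k<n. \<Sum>l<n. cnj (N k a) * fun_one k l * N l b) = sesq {..<n} fun_one (\<lambda>k. N k a) (\<lambda>k. N k b)"
    by (simp add: sesq_def)
  then show ?thesis by (simp add: sesq_fun_one)
qed

lemma hsip_sum_left: "hsip I (\<lambda>i j. \<Sum>k\<in>K. Z k i j) Y = (\<Sum>k\<in>K. hsip I (Z k) Y)"
proof -
  have "hsip I (\<lambda>i j. \<Sum>k\<in>K. Z k i j) Y = (\<Sum>i\<in>I. \<Sum>k\<in>K. \<Sum>j\<in>I. cnj (Z k i j) * Y i j)"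
    unfolding hsip_def cnj_sum sum_distrib_right by (intro sum.cong refl sum.swap)
  also have "\<dots> = (\<Sum>k\<in>K. hsip I (Z k) Y)" unfolding hsip_def by (rule sum.swap)
  finally show ?thesis .
qed

text \<open>Conjugation acts on the second factor, so each new block is a linear combination of old
  blocks. The number of blocks may change, which links level \<open>n\<close> to level
  \<open>d\<close>.\<close>

lemma congr_block_space:
  assumes S: "S \<subseteq> carrier_mat m m" and X: "X \<in> block_space m n (hs_perp m S)"
  shows "congr n N X \<in> block_space m n' (hs_perp m S)"
  unfolding block_space_hs_perp_iff[OF S]
proof (intro allI impI ballI)
  fix a b Y assume Y: "Y \<in> S"
  have "hsip {..<m} (\<lambda>i j. congr n N X (i, a) (j, b)) (mat_fun Y)
    = hsip {..<m} (\<lambda>i j. \<Sum>k<n. \<Sum>l<n. (cnj (N k a) * N l b) * X (i, k) (j, l)) (mat_fun Y)"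
    by (rule hsip_cong) (simp_all add: congr_def mult_ac)
  also have "\<dots> = (\<Sum>k<n. \<Sum>l<n. cnj (cnj (N k a) * N l b) * hsip {..<m} (\<lambda>i j. X (i, k) (j, l)) (mat_fun Y))"
    by (simp only: hsip_sum_left hsip_scale_left)
  also have "\<dots> = 0"
    using X Y by (intro sum.neutral ballI) (simp add: block_space_hs_perp_iff[OF S])
  finally show "hsip {..<m} (\<lambda>i j. congr n N X (i, a) (j, b)) (mat_fun Y) = 0" .
qed

lemma pos_form_congr:
  assumes "pos_form (A \<times> {..<n}) X"
  shows "pos_form (A \<times> B) (congr n N X)"
  using assms unfolding pos_form_def sesq_congr by blast

text \<open>The variable \<open>E\<close> stands for \<open>1 \<otimes> \<rho> + T'\<close>, so that
  the objective and the larger positivity constraint involve \<open>E\<close> alone.\<close>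

definition primal_form :: "nat \<Rightarrow> complex mat set \<Rightarrow> (nat \<Rightarrow> nat \<Rightarrow> complex)
    \<Rightarrow> (nat \<times> nat \<Rightarrow> nat \<times> nat \<Rightarrow> complex) \<Rightarrow> bool" where
  "primal_form d S \<rho> E \<longleftrightarrow> pos_form {..<d} \<rho> \<and> (\<Sum>k<d. \<rho> k k) = 1 \<and>
     pos_form ({..<d} \<times> {..<d}) E \<and> (\<lambda>p q. E p q - one_kron \<rho> p q) \<in> block_space d d (hs_perp d S)"

text \<open>The entries of \<open>y\<close> form the matrix \<open>N\<close> with \<open>y = (1 \<otimes> N) \<Phi>\<close>.\<close>

lemma primal_form_of_vector:
  assumes S: "S \<subseteq> carrier_mat d d"
    and X: "pos_form ({..<d} \<times> {..<n}) X" "(\<lambda>p q. X p q - fun_one p q) \<in> block_space d n (hs_perp d S)"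
    and y: "sqnorm ({..<d} \<times> {..<n}) y = 1"
  shows "\<exists>\<rho> E. primal_form d S \<rho> E \<and>
    hsip ({..<d} \<times> {..<d}) fun_ent E = sesq ({..<d} \<times> {..<n}) X y y"
proof (intro exI conjI)
  define N where "N = (\<lambda>k a. y (a, k))"
  define \<rho> where "\<rho> = (\<lambda>a b. \<Sum>k<n. cnj (N k a) * N k b)"
  show "primal_form d S \<rho> (congr n N X)"
    unfolding primal_form_def
  proof (intro conjI)
    show "pos_form {..<d} \<rho>" unfolding \<rho>_def by (rule pos_form_gram)
    have "(\<Sum>k<d. \<rho> k k) = of_real (sqnorm ({..<d} \<times> {..<n}) y)"
      by (simp add: \<rho>_def N_def sqnorm_def sum_times complex_norm_square mult.commute del: of_real_power)
    then show "(\<Sum>k<d. \<rho> k k) = 1" using y by simp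
    show "pos_form ({..<d} \<times> {..<d}) (congr n N X)" by (rule pos_form_congr[OF X(1)])
    have "congr n N fun_one = one_kron \<rho>"
      by (subst fun_one_one_kron) (simp add: congr_one_kron gram_fun_one \<rho>_def)
    then show "(\<lambda>p q. congr n N X p q - one_kron \<rho> p q) \<in> block_space d d (hs_perp d S)"
      using congr_block_space[OF S X(2), of N d] by (simp add: congr_diff)
  qed
  show "hsip ({..<d} \<times> {..<d}) fun_ent (congr n N X) = sesq ({..<d} \<times> {..<n}) X y y"
    unfolding hsip_fun_ent sesq_blocks by (simp add: congr_def sesq_def N_def)
qed

text \<open>The attained maximum, restated for forms indexed by pairs. The second part describes
  \<open>s\<close> through upper bounds over unit vectors of one optimal \<open>X\<close>, so no
  maximising vector has to be carried along.\<close>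

lemma lovasz_theta_form:
  assumes n: "0 < d" "0 < n" and S: "noncomm_graph d S"
  defines "s \<equiv> lovasz_theta (d * n) (tensor_space d S n (carrier_mat n n))" and "I \<equiv> {..<d} \<times> {..<n}"
  shows "\<And>X x. pos_form I X \<Longrightarrow> (\<lambda>p q. X p q - fun_one p q) \<in> block_space d n (hs_perp d S) \<Longrightarrow>
      Re (sesq I X x x) \<le> s * sqnorm I x"
    and "\<exists>X. pos_form I X \<and> (\<lambda>p q. X p q - fun_one p q) \<in> block_space d n (hs_perp d S) \<and>
      (\<forall>t. (\<forall>x. sqnorm I x = 1 \<longrightarrow> Re (sesq I X x x) \<le> t) \<longrightarrow> s \<le> t)"
proof -
  have sub: "VectorSpace.subspace class_ring S (mat_space d)" and one: "1\<^sub>m d \<in> S"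
    using S by (auto simp: noncomm_graph_def)
  have fin: "finite I" by (simp add: I_def)
  let ?TS = "tensor_space d S n (carrier_mat n n)" and ?m = "d * n"
  have m: "0 < ?m" using n by simp
  have TS: "?TS \<subseteq> carrier_mat ?m ?m" using tensor_space_iff[OF sub] by blast
  have "tensor_fun n (1\<^sub>m ?m) \<in> block_space d n S"
    by (rule block_space_local[OF fun_one_block_space[OF sub one]]) (simp add: tensor_fun_one)
  then have oneTS: "1\<^sub>m ?m \<in> ?TS" by (simp add: tensor_space_iff[OF sub])
  note attained = lovasz_theta_attained[OF m TS oneTS]
  have tf: "tensor_fun n (1\<^sub>m ?m + T) p q = fun_one p q + tensor_fun n T p q"
    if "T \<in> carrier_mat ?m ?m" "p \<in> I" "q \<in> I" for T p q
    using that by (simp add: tensor_fun_add[of _ d] tensor_fun_one I_def)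
  show "Re (sesq I X x x) \<le> s * sqnorm I x"
    if X: "pos_form I X" "(\<lambda>p q. X p q - fun_one p q) \<in> block_space d n (hs_perp d S)" for X x
  proof -
    define T where "T = tensor_mat d n (\<lambda>p q. X p q - fun_one p q)"
    have Tc: "T \<in> carrier_mat ?m ?m" by (simp add: T_def)
    have eq: "tensor_fun n (1\<^sub>m ?m + T) p q = X p q" if "p \<in> I" "q \<in> I" for p q
      using that by (simp add: tf[OF Tc]) (simp add: T_def tensor_fun_tensor_mat I_def)
    have "tensor_fun n T \<in> block_space d n (hs_perp d S)"
      by (rule block_space_local[OF X(2)]) (simp add: T_def tensor_fun_tensor_mat)
    then have T: "T \<in> hs_perp ?m ?TS" using Tc by (simp add: hs_perp_tensor_space_iff[OF sub])
    have "pos_form I (tensor_fun n (1\<^sub>m ?m + T)) \<longleftrightarrow> pos_form I X"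
      by (rule pos_form_cong) (rule eq)
    then have P: "psd ?m (1\<^sub>m ?m + T)"
      using X(1) Tc by (simp add: psd_tensor_iff I_def)
    have "\<forall>x. Re (sesq {..<?m} (mat_fun (1\<^sub>m ?m + T)) x x) \<le> s * sqnorm {..<?m} x"
      using attained(2)[OF T P] unfolding s_def op_norm_le_iff[OF P m] .
    from spec[OF this, of "\<lambda>a. x (a div n, a mod n)"]
    have "Re (sesq I (tensor_fun n (1\<^sub>m ?m + T)) x x) \<le> s * sqnorm {..<?m} (\<lambda>a. x (a div n, a mod n))"
      unfolding I_def by (simp add: sesq_tensor_fun')
    moreover have "sqnorm {..<?m} (\<lambda>a. x (a div n, a mod n)) = sqnorm I x"
      unfolding sqnorm_tensor I_def by (rule sqnorm_cong) auto
    moreover have "sesq I (tensor_fun n (1\<^sub>m ?m + T)) x x = sesq I X x x"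
      by (rule sesq_cong) (simp_all add: eq)
    ultimately show ?thesis by simp
  qed
  obtain T where T: "T \<in> hs_perp ?m ?TS" "psd ?m (1\<^sub>m ?m + T)" "s = op_norm (1\<^sub>m ?m + T)"
    using attained(1) by (auto simp: s_def)
  have Tc: "T \<in> carrier_mat ?m ?m" using T(1) by (simp add: hs_perp_def)
  define X where "X = tensor_fun n (1\<^sub>m ?m + T)"
  have "pos_form I X" using T(2) by (simp add: psd_tensor_iff X_def I_def)
  moreover have "(\<lambda>p q. X p q - fun_one p q) \<in> block_space d n (hs_perp d S)"
    by (rule block_space_local[of "tensor_fun n T"])
      (use T(1) tf[OF Tc] in \<open>simp_all add: hs_perp_tensor_space_iff[OF sub] X_def I_def\<close>)
  moreover have "s \<le> t" if t: "\<forall>x. sqnorm I x = 1 \<longrightarrow> Re (sesq I X x x) \<le> t" for t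
    unfolding T(3) op_norm_le_iff[OF T(2) m] sesq_tensor_fun sqnorm_tensor
    using sesq_le_of_unit[OF fin, of X t] t by (simp add: X_def I_def)
  ultimately show "\<exists>X. pos_form I X \<and> (\<lambda>p q. X p q - fun_one p q) \<in> block_space d n (hs_perp d S) \<and>
      (\<forall>t. (\<forall>x. sqnorm I x = 1 \<longrightarrow> Re (sesq I X x x) \<le> t) \<longrightarrow> s \<le> t)" by blast
qed

text \<open>Every unit vector at every level \<open>n\<close> yields a primal point with the same
  value, so one bound on the primal programme bounds all levels. Used for the supremum over
  \<open>n\<close>, for the value of the programme and for weak duality.\<close>

lemma lovasz_theta_le_primal_bound:
  assumes "0 < d" "0 < n" "noncomm_graph d S"
    and bnd: "\<And>\<rho> E. primal_form d S \<rho> E \<Longrightarrow> Re (hsip ({..<d} \<times> {..<d}) fun_ent E) \<le> t"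
  shows "lovasz_theta (d * n) (tensor_space d S n (carrier_mat n n)) \<le> t"
proof -
  have S: "S \<subseteq> carrier_mat d d" using assms(3) subspace_matD(1) by (auto simp: noncomm_graph_def)
  let ?I = "{..<d} \<times> {..<n}"
  obtain X where X: "pos_form ?I X" "(\<lambda>p q. X p q - fun_one p q) \<in> block_space d n (hs_perp d S)"
    and le: "\<And>t. (\<forall>x. sqnorm ?I x = 1 \<longrightarrow> Re (sesq ?I X x x) \<le> t) \<Longrightarrow>
      lovasz_theta (d * n) (tensor_space d S n (carrier_mat n n)) \<le> t"
    using lovasz_theta_form(2)[OF assms(1-3)] by blast
  have "Re (sesq ?I X x x) \<le> t" if "sqnorm ?I x = 1" for x
    using primal_form_of_vector[OF S X that] bnd by metis
  then show ?thesis by (intro le) simp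
qed

lemma fun_mat_inverse:
  fixes M :: "nat \<Rightarrow> nat \<Rightarrow> complex"
  assumes inj: "\<And>x. (\<And>k. k < d \<Longrightarrow> (\<Sum>a<d. M k a * x a) = 0) \<Longrightarrow> (\<And>a. a < d \<Longrightarrow> x a = 0)"
  obtains N where "\<And>a b. a < d \<Longrightarrow> b < d \<Longrightarrow> (\<Sum>k<d. M a k * N k b) = fun_one a b"
    and "\<And>a b. a < d \<Longrightarrow> b < d \<Longrightarrow> (\<Sum>k<d. N a k * M k b) = fun_one a b"
proof -
  define A where "A = mat d d (\<lambda>(i, j). M i j)"
  have A: "A \<in> carrier_mat d d" by (simp add: A_def)
  have "det A \<noteq> 0"
  proof
    assume "det A = 0"
    then obtain v where v: "v \<in> carrier_vec d" "v \<noteq> 0\<^sub>v d" "A *\<^sub>v v = 0\<^sub>v d"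
      using det_0_iff_vec_prod_zero_field[OF A] by blast
    have "(\<Sum>a<d. M k a * v $ a) = 0" if "k < d" for k
    proof -
      have "(\<Sum>a<d. M k a * v $ a) = (A *\<^sub>v v) $ k"
        using that v(1) by (simp add: A_def scalar_prod_def atLeast0LessThan)
      then show ?thesis using v(3) that by simp
    qed
    from inj[OF this] have "v = 0\<^sub>v d" using v(1) by (intro eq_vecI) auto
    then show False using v(2) by simp
  qed
  from det_non_zero_imp_unit[OF A this, unfolded Units_def, of "()"]
  obtain B where B: "B \<in> carrier_mat d d" "B * A = 1\<^sub>m d" "A * B = 1\<^sub>m d"
    by (auto simp: ring_mat_def)
  have ent: "(\<Sum>k<d. X $$ (a, k) * Y $$ (k, b)) = fun_one a b"
    if "X \<in> carrier_mat d d" "Y \<in> carrier_mat d d" "X * Y = 1\<^sub>m d" "a < d" "b < d" for X Y :: "complex mat" and a b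
  proof -
    have "(X * Y) $$ (a, b) = (\<Sum>k<d. X $$ (a, k) * Y $$ (k, b))"
      using that(1,2,4,5) by (simp add: scalar_prod_def atLeast0LessThan)
    then show ?thesis using that(3-5) by (simp add: fun_one_def)
  qed
  show ?thesis
  proof (rule that[of "mat_fun B"])
    fix a b assume ab: "a < d" "b < d"
    show "(\<Sum>k<d. M a k * mat_fun B k b) = fun_one a b"
      using ent[OF A B(1,3) ab] ab by (simp add: A_def mat_fun_def)
    show "(\<Sum>k<d. mat_fun B a k * M k b) = fun_one a b"
      using ent[OF B(1) A B(2) ab] ab by (simp add: A_def mat_fun_def)
  qed
qed

text \<open>For invertible \<open>F = M\<^sup>* M\<close>, conjugation with \<open>1 \<otimes> M\<^sup>-\<^sup>1\<close> inverts the construction above,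
  with \<open>n = d\<close> and the vector \<open>(1 \<otimes> M) \<Phi>\<close>.\<close>

lemma positive_definite_value_le_theta:
  assumes d: "0 < d" and S: "noncomm_graph d S"
    and F: "pos_form {..<d} F" and E: "pos_form ({..<d} \<times> {..<d}) E"
    and EF: "(\<lambda>p q. E p q - one_kron F p q) \<in> block_space d d (hs_perp d S)"
    and definite: "\<And>x. sesq {..<d} F x x = 0 \<Longrightarrow> sqnorm {..<d} x = 0"
  shows "Re (hsip ({..<d} \<times> {..<d}) fun_ent E)
    \<le> lovasz_theta (d * d) (tensor_space d S d (carrier_mat d d)) * (\<Sum>k<d. Re (F k k))"
proof -
  have Sc: "S \<subseteq> carrier_mat d d" using S subspace_matD(1) by (auto simp: noncomm_graph_def)
  let ?D = "{..<d}" and ?I = "{..<d} \<times> {..<d}"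
  have fin: "finite ?D" by simp
  obtain M where M: "\<And>i j. i \<in> ?D \<Longrightarrow> j \<in> ?D \<Longrightarrow> F i j = (\<Sum>k<d. cnj (M k i) * M k j)"
    using pos_form_cholesky[OF fin F] by blast
  \<comment> \<open>The factorisation \<open>F = M^* M\<close> as a sesquilinear identity: it gives
    injectivity of \<open>M\<close>, and with \<open>M N = 1\<close> it gives
    \<open>N^* F N = 1\<close>.\<close>
  have FM: "(\<Sum>k<d. \<Sum>l<d. cnj (x k) * F k l * y l) = (\<Sum>c<d. cnj (\<Sum>k<d. M c k * x k) * (\<Sum>l<d. M c l * y l))"
    for x y
  proof -
    have "(\<Sum>k<d. \<Sum>l<d. cnj (x k) * F k l * y l)
        = sesq ?D (\<lambda>k l. \<Sum>c<d. \<Sum>c'<d. cnj (M c k) * fun_one c c' * M c' l) x y"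
      unfolding sesq_def gram_fun_one by (intro sum.cong refl) (simp add: M)
    then show ?thesis by (simp add: sesq_congruence sesq_fun_one)
  qed
  obtain N where MN: "\<And>a b. a < d \<Longrightarrow> b < d \<Longrightarrow> (\<Sum>k<d. M a k * N k b) = fun_one a b"
    and NM: "\<And>a b. a < d \<Longrightarrow> b < d \<Longrightarrow> (\<Sum>k<d. N a k * M k b) = fun_one a b"
  proof (rule fun_mat_inverse[of d M])
    fix x a assume x: "\<And>k. k < d \<Longrightarrow> (\<Sum>a<d. M k a * x a) = 0" and a: "a < d"
    have "sesq ?D F x x = 0" unfolding sesq_def FM using x by (intro sum.neutral ballI) simp
    then have "sqnorm ?D x = 0" by (rule definite)
    then show "x a = 0" using entry_le_sqnorm[OF fin, of a x] a by simp
  qed blast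
  define X where "X = congr d N E"
  have pX: "pos_form ?I X" unfolding X_def by (rule pos_form_congr[OF E])
  have NFN: "(\<Sum>k<d. \<Sum>l<d. cnj (N k a) * F k l * N l b) = fun_one a b" if "a < d" "b < d" for a b
  proof -
    have "(\<Sum>k<d. \<Sum>l<d. cnj (N k a) * F k l * N l b) = (\<Sum>c<d. cnj (fun_one c a) * fun_one c b)"
      unfolding FM using that by (intro sum.cong refl) (simp add: MN)
    also have "\<dots> = (\<Sum>c<d. if c = a then fun_one a b else 0)"
      by (intro sum.cong refl) (auto simp: fun_one_def)
    finally show ?thesis using that by simp
  qed
  have "(\<lambda>p q. X p q - congr d N (one_kron F) p q) \<in> block_space d d (hs_perp d S)"
    using congr_block_space[OF Sc EF, of N d] by (simp add: congr_diff X_def)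
  then have "(\<lambda>p q. X p q - fun_one p q) \<in> block_space d d (hs_perp d S)"
    by (rule block_space_local) (auto simp: congr_one_kron one_kron_def NFN, auto simp: fun_one_def)
  \<comment> \<open>The vector \<open>(1 \<otimes> M) \<Phi>\<close> has the entry
    \<open>M k i\<close> at \<open>(i, k)\<close>, whence the swapped arguments; its squared norm is
    \<open>Tr F\<close>.\<close>
  from lovasz_theta_form(1)[OF d d S pX this, of "\<lambda>p. M (snd p) (fst p)"]
  have "Re (sesq ?I X (\<lambda>p. M (snd p) (fst p)) (\<lambda>p. M (snd p) (fst p)))
      \<le> lovasz_theta (d * d) (tensor_space d S d (carrier_mat d d)) * sqnorm ?I (\<lambda>p. M (snd p) (fst p))" .
  moreover have "sqnorm ?I (\<lambda>p. M (snd p) (fst p)) = (\<Sum>k<d. Re (F k k))"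
    unfolding sqnorm_def sum_times
    by (intro sum.cong refl) (simp add: M cmod_power2, simp add: power2_eq_square)
  moreover have "sesq ?I X (\<lambda>p. M (snd p) (fst p)) (\<lambda>p. M (snd p) (fst p)) = hsip ?I fun_ent E"
    unfolding X_def sesq_congr sesq_ent_fun[symmetric]
    by (rule sesq_cong) (auto simp: NM ent_fun_def fun_one_def)
  ultimately show ?thesis by simp
qed

text \<open>Adding \<open>\<epsilon> 1\<close> to both \<open>\<rho>\<close> and \<open>E\<close>
  leaves \<open>T'\<close> unchanged and makes \<open>\<rho>\<close> definite. Value and trace both
  grow by \<open>\<epsilon> d\<close>, so the inequality survives as \<open>\<epsilon>\<close> tends
  to 0.\<close>

lemma primal_value_le_theta:
  assumes d: "0 < d" and S: "noncomm_graph d S" and E: "primal_form d S \<rho> E"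
  shows "Re (hsip ({..<d} \<times> {..<d}) fun_ent E) \<le> lovasz_theta (d * d) (tensor_space d S d (carrier_mat d d))"
    (is "?v \<le> ?s")
proof -
  let ?D = "{..<d}" and ?I = "{..<d} \<times> {..<d}"
  have p: "pos_form ?D \<rho>" "(\<Sum>k<d. \<rho> k k) = 1" "pos_form ?I E"
    "(\<lambda>p q. E p q - one_kron \<rho> p q) \<in> block_space d d (hs_perp d S)"
    using E by (auto simp: primal_form_def)
  have perturbed: "?v + \<epsilon> * real d \<le> ?s * (1 + \<epsilon> * real d)" if e: "0 < \<epsilon>" for \<epsilon> :: real
  proof -
    define F where "F = (\<lambda>k l. \<rho> k l + of_real \<epsilon> * fun_one k l)"
    define E' where "E' = (\<lambda>p q. E p q + of_real \<epsilon> * fun_one p q)"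
    have F: "pos_form ?D F" "pos_form ?I E'" unfolding F_def E'_def
      using e by (auto intro!: pos_form_add pos_form_scale p pos_form_fun_one)
    have "(\<lambda>p q. E' p q - one_kron F p q) = (\<lambda>p q. E p q - one_kron \<rho> p q)"
      by (auto simp: E'_def F_def one_kron_def fun_one_def fun_eq_iff)
    then have EF: "(\<lambda>p q. E' p q - one_kron F p q) \<in> block_space d d (hs_perp d S)" using p by simp
    have definite: "sqnorm ?D x = 0" if "sesq ?D F x x = 0" for x
    proof -
      have "0 = Re (sesq ?D F x x)" using that by simp
      also have "\<dots> = Re (sesq ?D \<rho> x x) + \<epsilon> * sqnorm ?D x"
        by (simp add: F_def sesq_form_add sesq_form_scale sesq_fun_one_self)
      finally have "\<epsilon> * sqnorm ?D x = - Re (sesq ?D \<rho> x x)" by simp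
      moreover have "0 \<le> Re (sesq ?D \<rho> x x)" using p(1) by (auto simp: pos_form_def less_eq_complex_def)
      ultimately have "\<epsilon> * sqnorm ?D x \<le> 0" by linarith
      then show ?thesis using e sqnorm_nonneg[of ?D x] by (simp add: mult_le_0_iff)
    qed
    have "Re (hsip ?I fun_ent E') \<le> ?s * (\<Sum>k<d. Re (F k k))"
      by (rule positive_definite_value_le_theta[OF d S F EF definite])
    moreover have "(\<Sum>k<d. Re (F k k)) = 1 + \<epsilon> * real d"
    proof -
      have "(\<Sum>k<d. Re (\<rho> k k)) = 1" using p(2) by (metis Re_sum one_complex.simps(1))
      then show ?thesis by (simp add: F_def sum.distrib fun_one_def)
    qed
    moreover have "hsip ?I fun_ent E' = hsip ?I fun_ent E + of_real \<epsilon> * of_nat d"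
    proof -
      have "hsip ?I fun_ent fun_one = (\<Sum>i<d. \<Sum>j<d. if j = i then 1 else 0)"
        unfolding hsip_fun_ent by (intro sum.cong refl) (simp add: fun_one_def)
      then show ?thesis by (simp add: E'_def hsip_add_right hsip_scale_right)
    qed
    ultimately show ?thesis by simp
  qed
  show ?thesis
  proof (rule ccontr)
    assume "\<not> ?v \<le> ?s"
    \<comment> \<open>A gap \<open>c > 0\<close> would satisfy
      \<open>c \<le> \<epsilon> d (s - 1)\<close> for all positive \<open>\<epsilon>\<close>; the
      choice \<open>\<epsilon> = c / (2 K)\<close> makes the right side at most
      \<open>c / 2\<close>. The summand 1 in \<open>K\<close> keeps it positive.\<close>
    define c K where "c = ?v - ?s" and "K = real d * \<bar>?s - 1\<bar> + 1"
    have c: "0 < c" and K: "0 < K" using \<open>\<not> ?v \<le> ?s\<close> by (auto simp: c_def K_def intro: add_nonneg_pos)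
    have le: "c \<le> \<epsilon> * (real d * (?s - 1))" if "0 < \<epsilon>" for \<epsilon>
      using perturbed[OF that] by (simp add: c_def algebra_simps)
    have "c \<le> (c / (2 * K)) * (real d * (?s - 1))" by (rule le) (use c K in simp)
    also have "\<dots> \<le> (c / (2 * K)) * K"
    proof (rule mult_left_mono)
      have "real d * (?s - 1) \<le> real d * \<bar>?s - 1\<bar>" by (rule mult_left_mono) auto
      then show "real d * (?s - 1) \<le> K" unfolding K_def by linarith
    qed (use c K in simp)
    also have "\<dots> = c / 2" using K by simp
    finally show False using c by simp
  qed
qed

section \<open>The semidefinite programme and its dual\<close>

text \<open>Feasibility at level \<open>t\<close>: the norm bound on \<open>Tr_A Y\<close> appears
  as positivity of \<open>t 1 - Tr_A Y\<close>.\<close>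

definition dual_form :: "nat \<Rightarrow> complex mat set \<Rightarrow> real \<Rightarrow> (nat \<times> nat \<Rightarrow> nat \<times> nat \<Rightarrow> complex) \<Rightarrow> bool" where
  "dual_form d S t Y \<longleftrightarrow> Y \<in> block_space d d S \<and>
     pos_form ({..<d} \<times> {..<d}) (\<lambda>p q. Y p q - fun_ent p q) \<and>
     pos_form {..<d} (\<lambda>k l. of_real t * fun_one k l - fun_ptrace d Y k l)"

lemma sesq_fun_ptrace:
  "sesq {..<n} (fun_ptrace d Y) x y = (\<Sum>i<d. sesq {..<n} (\<lambda>k l. Y (i, k) (i, l)) x y)"
proof -
  have "sesq {..<n} (fun_ptrace d Y) x y = (\<Sum>k<n. \<Sum>i<d. \<Sum>l<n. cnj (x k) * Y (i, k) (i, l) * y l)"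
    unfolding sesq_def fun_ptrace_def sum_distrib_left sum_distrib_right by (intro sum.cong refl sum.swap)
  also have "\<dots> = (\<Sum>i<d. sesq {..<n} (\<lambda>k l. Y (i, k) (i, l)) x y)"
    unfolding sesq_def by (rule sum.swap)
  finally show ?thesis .
qed

lemma pos_form_block:
  fixes Y :: "'a \<times> 'b \<Rightarrow> 'a \<times> 'b \<Rightarrow> complex"
  assumes "pos_form (A \<times> B) Y" "finite A" "i \<in> A"
  shows "pos_form B (\<lambda>k l. Y (i, k) (i, l))"
  unfolding pos_form_def
proof
  fix x :: "'b \<Rightarrow> complex"
  define z where "z = (\<lambda>p. if fst p = i then x (snd p) else 0)"
  have "sesq (A \<times> B) Y z z
    = (\<Sum>i'\<in>A. \<Sum>j\<in>A. if i' = i then if j = i then sesq B (\<lambda>k l. Y (i, k) (i, l)) x x else 0 else 0)"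
    unfolding sesq_blocks by (intro sum.cong refl) (simp add: sesq_def z_def)
  also have "\<dots> = (\<Sum>i'\<in>A. if i' = i then \<Sum>j\<in>A. if j = i then sesq B (\<lambda>k l. Y (i, k) (i, l)) x x else 0 else 0)"
    by (intro sum.cong refl) simp
  also have "\<dots> = sesq B (\<lambda>k l. Y (i, k) (i, l)) x x" using assms by simp
  finally show "0 \<le> sesq B (\<lambda>k l. Y (i, k) (i, l)) x x" using spec[OF assms(1)[unfolded pos_form_def], of z] by (simp only:)
qed

lemma pos_form_fun_ptrace:
  assumes "pos_form ({..<d} \<times> {..<n}) Y"
  shows "pos_form {..<n} (fun_ptrace d Y)"
  unfolding pos_form_def sesq_fun_ptrace
  using pos_form_block[OF assms] by (intro allI sum_nonneg) (simp add: pos_form_def)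

lemma pos_form_of_ge_ent:
  assumes "pos_form I (\<lambda>p q. Y p q - fun_ent p q)"
  shows "pos_form I Y"
  using pos_form_add[OF assms pos_form_fun_ent] by simp

text \<open>From \<open>Y \<ge> \<Phi> \<ge> 0\<close> the partial trace is positive, so bounding
  its norm by \<open>t\<close> is the same as \<open>Tr_A Y \<le> t 1\<close>.\<close>

lemma dual_form_iff:
  assumes d: "0 < d" and sub: "VectorSpace.subspace class_ring S (mat_space d)"
  shows "Y \<in> lovasz_min_feasible d S \<and> op_norm (ptrace_fst d d Y) \<le> t \<longleftrightarrow>
    Y \<in> carrier_mat (d * d) (d * d) \<and> dual_form d S t (tensor_fun d Y)"
proof -
  let ?D = "{..<d}" and ?I = "{..<d} \<times> {..<d}"
  have feas: "Y \<in> lovasz_min_feasible d S \<longleftrightarrow> Y \<in> carrier_mat (d * d) (d * d) \<and>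
      tensor_fun d Y \<in> block_space d d S \<and> pos_form ?I (\<lambda>p q. tensor_fun d Y p q - fun_ent p q)"
  proof (cases "Y \<in> carrier_mat (d * d) (d * d)")
    case True
    have "pos_form ?I (tensor_fun d (Y - ent_mat d)) \<longleftrightarrow> pos_form ?I (\<lambda>p q. tensor_fun d Y p q - fun_ent p q)"
      by (rule pos_form_cong) (simp add: tensor_fun_minus[OF True ent_mat_carrier] tensor_fun_ent_mat)
    then show ?thesis
      using True by (simp add: lovasz_min_feasible_def tensor_space_iff[OF sub] psd_tensor_iff minus_carrier_mat)
  next
    case False
    then show ?thesis by (simp add: lovasz_min_feasible_def tensor_space_iff[OF sub])
  qed
  have norm: "op_norm (ptrace_fst d d Y) \<le> t \<longleftrightarrow>
      pos_form ?D (\<lambda>k l. of_real t * fun_one k l - fun_ptrace d (tensor_fun d Y) k l)"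
    if "pos_form ?I (\<lambda>p q. tensor_fun d Y p q - fun_ent p q)"
  proof -
    have fin: "finite ?D" by simp
    have P: "pos_form ?D (fun_ptrace d (tensor_fun d Y))"
      by (rule pos_form_fun_ptrace[OF pos_form_of_ge_ent[OF that]])
    have c: "ptrace_fst d d Y \<in> carrier_mat d d" by (simp add: ptrace_fst_def)
    have "pos_form ?D (mat_fun (ptrace_fst d d Y))"
      using P by (subst pos_form_cong[of ?D _ "fun_ptrace d (tensor_fun d Y)"]) (simp_all add: mat_fun_ptrace)
    then have psd: "psd d (ptrace_fst d d Y)" using c by (simp add: psd_iff_pos_form)
    have "sesq ?D (mat_fun (ptrace_fst d d Y)) x x = sesq ?D (fun_ptrace d (tensor_fun d Y)) x x" for x
      by (rule sesq_cong) (simp_all add: mat_fun_ptrace)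
    then show ?thesis
      unfolding op_norm_le_iff[OF psd d] pos_form_one_diff_iff[OF fin pos_form_herm[OF fin P]] by simp
  qed
  show ?thesis using feas norm by (auto simp: dual_form_def)
qed

text \<open>Pair \<open>E\<close> with \<open>Y - \<Phi>\<close> and \<open>\<rho>\<close> with
  \<open>t 1 - Tr_A Y\<close>. As \<open>E - 1 \<otimes> \<rho>\<close> is orthogonal to
  \<open>Y\<close>, the pairing of \<open>E\<close> with \<open>Y\<close> equals that of
  \<open>\<rho>\<close> with \<open>Tr_A Y\<close>, and the two inequalities chain.\<close>

lemma weak_duality:
  assumes S: "S \<subseteq> carrier_mat d d" and E: "primal_form d S \<rho> E" and Y: "dual_form d S t Y"
  shows "Re (hsip ({..<d} \<times> {..<d}) fun_ent E) \<le> t"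
proof -
  let ?D = "{..<d}" and ?I = "{..<d} \<times> {..<d}"
  have p: "pos_form ?D \<rho>" "(\<Sum>k<d. \<rho> k k) = 1" "pos_form ?I E"
    "(\<lambda>p q. E p q - one_kron \<rho> p q) \<in> block_space d d (hs_perp d S)"
    using E by (auto simp: primal_form_def)
  have y: "Y \<in> block_space d d S" "pos_form ?I (\<lambda>p q. Y p q - fun_ent p q)"
    "pos_form ?D (\<lambda>k l. of_real t * fun_one k l - fun_ptrace d Y k l)"
    using Y by (auto simp: dual_form_def)
  have "0 \<le> Re (hsip ?I E (\<lambda>p q. Y p q - fun_ent p q))"
    by (rule hsip_pos_form_nonneg[OF _ p(3) y(2)]) simp
  moreover have "0 \<le> Re (hsip ?D \<rho> (\<lambda>k l. of_real t * fun_one k l - fun_ptrace d Y k l))"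
    by (rule hsip_pos_form_nonneg[OF _ p(1) y(3)]) simp
  moreover have "hsip ?I E Y = hsip ?D \<rho> (fun_ptrace d Y)"
    using hsip_block_space_perp[OF S p(4) y(1)] by (simp add: hsip_diff_left hsip_one_kron)
  moreover have "hsip ?D \<rho> fun_one = 1" "Re (hsip ?I E fun_ent) = Re (hsip ?I fun_ent E)"
    using p(2) hsip_swap[of ?D \<rho> fun_one] hsip_swap[of ?I E fun_ent] by (simp_all add: hsip_fun_one)
  ultimately show ?thesis by (simp add: hsip_diff_right hsip_scale_right)
qed

text \<open>The double complement exhibits the space as an intersection of zero sets of continuous
  functionals.\<close>

lemma closed_block_space:
  assumes sub: "VectorSpace.subspace class_ring S (mat_space m)"
  shows "closed (block_space m n S)"
proof -
  have c: "continuous_on UNIV (\<lambda>R :: nat \<times> nat \<Rightarrow> nat \<times> nat \<Rightarrow> complex. R p q)" for p q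
    by (rule continuous_on_entry) (rule continuous_on_id)
  have "block_space m n S = block_space m n (hs_perp m (hs_perp m S))" by (simp add: hs_perp_hs_perp[OF sub])
  also have "\<dots> = (\<Inter>k\<in>{..<n}. \<Inter>l\<in>{..<n}. \<Inter>T\<in>hs_perp m S.
      {R. hsip {..<m} (\<lambda>i j. R (i, k) (j, l)) (mat_fun T) = 0})"
    by (auto simp: block_space_hs_perp_iff[OF hs_perp_carrier])
  also have "closed \<dots>"
    unfolding hsip_def by (intro closed_INT ballI closed_Collect_eq continuous_intros c)
  finally show ?thesis .
qed

lemma dual_form_attained:
  assumes d: "0 < d" and S: "noncomm_graph d S"
    and bnd: "\<And>\<rho> E. primal_form d S \<rho> E \<Longrightarrow> Re (hsip ({..<d} \<times> {..<d}) fun_ent E) \<le> t"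
  shows "\<exists>Y. dual_form d S t Y"
proof -
  have sub: "VectorSpace.subspace class_ring S (mat_space d)" and one: "1\<^sub>m d \<in> S" and adj: "mat_adjoint ` S = S"
    using S by (auto simp: noncomm_graph_def)
  have adj': "\<And>X. X \<in> S \<Longrightarrow> mat_adjoint X \<in> S" using adj by blast
  have "(\<exists>Y\<in>block_space d d S. pos_form ({..<d} \<times> {..<d}) (\<lambda>p q. Y p q - fun_ent p q) \<and>
            pos_form {..<d} (\<lambda>k l. of_real t * fun_one k l - fun_ptrace d Y k l)) \<or>
    (\<exists>\<rho> E. pos_form {..<d} \<rho> \<and> (\<Sum>k<d. \<rho> k k) = 1 \<and> pos_form ({..<d} \<times> {..<d}) E \<and>
       (\<forall>Z\<in>block_space d d S. hsip ({..<d} \<times> {..<d}) (\<lambda>p q. E p q - one_kron \<rho> p q) Z = 0) \<and>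
       t < Re (hsip ({..<d} \<times> {..<d}) fun_ent E))"
    by (rule duality_alternative[OF d closed_block_space[OF sub] block_space_lin[OF sub]
        block_space_adjoint[OF adj'] fun_one_block_space[OF sub one]]) (auto intro: block_space_local)
  then
  consider Y where "dual_form d S t Y"
    | \<rho> E where "pos_form {..<d} \<rho>" "(\<Sum>k<d. \<rho> k k) = 1" "pos_form ({..<d} \<times> {..<d}) E"
      "\<And>Z. Z \<in> block_space d d S \<Longrightarrow> hsip ({..<d} \<times> {..<d}) (\<lambda>p q. E p q - one_kron \<rho> p q) Z = 0"
      "t < Re (hsip ({..<d} \<times> {..<d}) fun_ent E)"
    unfolding dual_form_def by blast
  then show ?thesis
  proof cases
    case 1
    then show ?thesis by blast
  next
    case 2
    have "(\<lambda>p q. E p q - one_kron \<rho> p q) \<in> block_space d d (hs_perp d S)"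
      by (rule block_space_hs_perpI[OF sub 2(4)])
    then have "primal_form d S \<rho> E" using 2 by (simp add: primal_form_def)
    then show ?thesis using bnd 2(5) by fastforce
  qed
qed

section \<open>From forms back to the matrix programme, its value and its Lagrangian dual\<close>

lemma mtrace_mult_herm:
  assumes "herm_mat m X" "Y \<in> carrier_mat m m"
  shows "mtrace (X * Y) = hsip {..<m} (mat_fun X) (mat_fun Y)"
  using assms mtrace_adjoint_mult[of X m Y] by (simp add: herm_mat_def)

lemma kron_one_add:
  assumes "\<rho> \<in> carrier_mat d d" "T \<in> carrier_mat (d * d) (d * d)"
    "p \<in> {..<d} \<times> {..<d}" "q \<in> {..<d} \<times> {..<d}"
  shows "tensor_fun d (kron (1\<^sub>m d) \<rho> + T) p q = one_kron (mat_fun \<rho>) p q + tensor_fun d T p q"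
  using assms kron_carrier[of "1\<^sub>m d" d \<rho> d]
  by (simp add: tensor_fun_add[of _ d] tensor_fun_kron_one)

lemma sdp_obj_lovasz_sdp:
  assumes "\<rho> \<in> carrier_mat d d" "T \<in> carrier_mat (d * d) (d * d)"
  shows "sdp_obj (lovasz_sdp d S) (\<rho>, T)
    = Re (hsip ({..<d} \<times> {..<d}) fun_ent (\<lambda>p q. one_kron (mat_fun \<rho>) p q + tensor_fun d T p q))"
proof -
  have "hsip ({..<d} \<times> {..<d}) fun_ent (tensor_fun d (kron (1\<^sub>m d) \<rho> + T))
      = hsip ({..<d} \<times> {..<d}) fun_ent (\<lambda>p q. one_kron (mat_fun \<rho>) p q + tensor_fun d T p q)"
    by (rule hsip_cong) (simp_all add: kron_one_add[OF assms])
  then show ?thesis using assms(2) by (simp add: lovasz_sdp_def ent_vec_quadratic)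
qed

lemma primal_form_of_feasible:
  assumes S: "S \<subseteq> carrier_mat d d" and f: "(\<rho>, T) \<in> sdp_feasible (lovasz_sdp d S)"
  shows "\<exists>E. primal_form d S (mat_fun \<rho>) E \<and>
    sdp_obj (lovasz_sdp d S) (\<rho>, T) = Re (hsip ({..<d} \<times> {..<d}) fun_ent E)"
proof -
  let ?I = "{..<d} \<times> {..<d}"
  note sub = subspace_hs_perp[OF S]
  have f': "T \<in> carrier_mat (d * d) (d * d)" "tensor_fun d T \<in> block_space d d (hs_perp d S)"
    "mtrace \<rho> = 1" "psd (d * d) (kron (1\<^sub>m d) \<rho> + T)" "psd d \<rho>"
    using f by (auto simp: sdp_feasible_lovasz_sdp tensor_space_iff[OF sub])
  have \<rho>: "\<rho> \<in> carrier_mat d d" using f'(5) by (simp add: psd_def)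
  define E where "E = (\<lambda>p q. one_kron (mat_fun \<rho>) p q + tensor_fun d T p q)"
  have "pos_form ?I (tensor_fun d (kron (1\<^sub>m d) \<rho> + T)) \<longleftrightarrow> pos_form ?I E"
    by (rule pos_form_cong) (simp add: kron_one_add[OF \<rho> f'(1)] E_def)
  then have "pos_form ?I E" using f'(4) by (simp add: psd_tensor_iff)
  moreover have "(\<Sum>k<d. mat_fun \<rho> k k) = 1" using f'(3) \<rho> by (simp add: mtrace_def mat_fun_def)
  ultimately have "primal_form d S (mat_fun \<rho>) E"
    using f'(2,5) by (simp add: primal_form_def psd_iff_pos_form E_def)
  then show ?thesis using sdp_obj_lovasz_sdp[OF \<rho> f'(1)] unfolding E_def by blast
qed

lemma feasible_of_primal_form:
  assumes S: "S \<subseteq> carrier_mat d d" and E: "primal_form d S \<rho> E"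
  shows "\<exists>x\<in>sdp_feasible (lovasz_sdp d S).
    sdp_obj (lovasz_sdp d S) x = Re (hsip ({..<d} \<times> {..<d}) fun_ent E)"
proof -
  let ?D = "{..<d}" and ?I = "{..<d} \<times> {..<d}"
  note sub = subspace_hs_perp[OF S]
  have p: "pos_form ?D \<rho>" "(\<Sum>k<d. \<rho> k k) = 1" "pos_form ?I E"
    "(\<lambda>p q. E p q - one_kron \<rho> p q) \<in> block_space d d (hs_perp d S)"
    using E by (auto simp: primal_form_def)
  define r where "r = mat d d (\<lambda>(k, l). \<rho> k l)"
  define T where "T = tensor_mat d d (\<lambda>p q. E p q - one_kron \<rho> p q)"
  have r: "r \<in> carrier_mat d d" and T: "T \<in> carrier_mat (d * d) (d * d)" by (simp_all add: r_def T_def)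
  have rf: "mat_fun r k l = \<rho> k l" if "k \<in> ?D" "l \<in> ?D" for k l using that by (simp add: r_def mat_fun_def)
  have ef: "one_kron (mat_fun r) p q + tensor_fun d T p q = E p q" if "p \<in> ?I" "q \<in> ?I" for p q
    using that rf[of "snd p" "snd q"] by (auto simp: T_def tensor_fun_tensor_mat one_kron_def)
  have "tensor_fun d T \<in> block_space d d (hs_perp d S)"
    by (rule block_space_local[OF p(4)]) (simp add: T_def tensor_fun_tensor_mat)
  then have "T \<in> tensor_space d (hs_perp d S) d (carrier_mat d d)" using T by (simp add: tensor_space_iff[OF sub])
  moreover have "mtrace r = 1" using p(2) r by (simp add: mtrace_def r_def)
  moreover have "pos_form ?D (mat_fun r)" using p(1) pos_form_cong[of ?D "mat_fun r" \<rho>] rf by blast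
  then have "psd d r" using r by (simp add: psd_iff_pos_form)
  moreover have "pos_form ?I (tensor_fun d (kron (1\<^sub>m d) r + T)) \<longleftrightarrow> pos_form ?I E"
    by (rule pos_form_cong) (simp add: kron_one_add[OF r T] ef)
  then have "psd (d * d) (kron (1\<^sub>m d) r + T)" using p(3) T by (simp add: psd_tensor_iff)
  ultimately have "(r, T) \<in> sdp_feasible (lovasz_sdp d S)" by (simp add: sdp_feasible_lovasz_sdp)
  moreover have "hsip ?I fun_ent (\<lambda>p q. one_kron (mat_fun r) p q + tensor_fun d T p q) = hsip ?I fun_ent E"
    by (rule hsip_cong) (simp_all add: ef)
  then have "sdp_obj (lovasz_sdp d S) (r, T) = Re (hsip ?I fun_ent E)" using sdp_obj_lovasz_sdp[OF r T] by simp
  ultimately show ?thesis by blast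
qed

lemma quantum_lovasz_eq:
  assumes d: "0 < d" and S: "noncomm_graph d S"
  defines "s \<equiv> lovasz_theta (d * d) (tensor_space d S d (carrier_mat d d))"
  shows "quantum_lovasz d S = ereal s" and "sdp_value (lovasz_sdp d S) = ereal s"
proof -
  have Sc: "S \<subseteq> carrier_mat d d" using S subspace_matD(1) by (auto simp: noncomm_graph_def)
  have le: "Re (hsip ({..<d} \<times> {..<d}) fun_ent E) \<le> s" if "primal_form d S \<rho> E" for \<rho> E
    using primal_value_le_theta[OF d S that] by (simp add: s_def)
  have "lovasz_theta (d * n) (tensor_space d S n (carrier_mat n n)) \<le> s" if "1 \<le> n" for n
    using that le by (intro lovasz_theta_le_primal_bound[OF d _ S]) auto
  then show "quantum_lovasz d S = ereal s"
    unfolding quantum_lovasz_def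
    using d by (intro antisym SUP_least SUP_upper2[of d]) (auto simp: s_def)
  show "sdp_value (lovasz_sdp d S) = ereal s"
    unfolding sdp_value_def
  proof (rule antisym)
    show "(SUP x\<in>sdp_feasible (lovasz_sdp d S). ereal (sdp_obj (lovasz_sdp d S) x)) \<le> ereal s"
    proof (rule SUP_least)
      fix x assume "x \<in> sdp_feasible (lovasz_sdp d S)"
      then show "ereal (sdp_obj (lovasz_sdp d S) x) \<le> ereal s"
        using primal_form_of_feasible[OF Sc, of "fst x" "snd x"] le by fastforce
    qed
    show "ereal s \<le> (SUP x\<in>sdp_feasible (lovasz_sdp d S). ereal (sdp_obj (lovasz_sdp d S) x))"
    proof (rule le_SUP_iff[THEN iffD2], intro allI impI)
      \<comment> \<open>If all primal values were at most \<open>u < s\<close>, the bound at level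
        \<open>d\<close> would give \<open>s \<le> u\<close>. So the programme gets above every such
        \<open>u\<close>, which suffices for its supremum.\<close>
      fix t assume t: "t < ereal s"
      then obtain u where u: "t < ereal u" "u < s" using ereal_dense2[OF t] by (metis ereal_less_eq(3) less_ereal.simps(1))
      have "\<exists>\<rho> E. primal_form d S \<rho> E \<and> u < Re (hsip ({..<d} \<times> {..<d}) fun_ent E)"
      proof (rule ccontr)
        assume "\<not> ?thesis"
        then have "s \<le> u" unfolding s_def by (intro lovasz_theta_le_primal_bound[OF d d S]) force
        then show False using u by simp
      qed
      then obtain \<rho> E where E: "primal_form d S \<rho> E" "u < Re (hsip ({..<d} \<times> {..<d}) fun_ent E)" by blast
      obtain x where "x \<in> sdp_feasible (lovasz_sdp d S)" "u < sdp_obj (lovasz_sdp d S) x"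
        using feasible_of_primal_form[OF Sc E(1)] E(2) by force
      then show "\<exists>x\<in>sdp_feasible (lovasz_sdp d S). t < ereal (sdp_obj (lovasz_sdp d S) x)"
        using u(1) by (meson less_ereal.simps(1) less_trans)
    qed
  qed
qed

text \<open>Sorted by variables with \<open>Y = \<Phi> + Z\<close>: the coefficient of
  \<open>\<rho>\<close> is \<open>Tr_A Y + W + \<mu> 1\<close>, that of \<open>T\<close> is
  \<open>Y\<close>, and the constant is \<open>- \<mu>\<close>.\<close>

lemma lovasz_lagrangian:
  assumes Z: "psd (d * d) Z" and W: "psd d W" and v: "(\<rho>, T) \<in> sdp_vars (lovasz_sdp d S)"
  shows "sdp_lagrangian (lovasz_sdp d S) [Z, W] [\<mu>] (\<rho>, T) =
    Re (hsip {..<d} (mat_fun \<rho>) (fun_ptrace d (tensor_fun d (ent_mat d + Z))))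
    + Re (hsip ({..<d} \<times> {..<d}) (tensor_fun d T) (tensor_fun d (ent_mat d + Z)))
    + Re (hsip {..<d} (mat_fun \<rho>) (mat_fun W))
    + \<mu> * (Re (hsip {..<d} (mat_fun \<rho>) fun_one) - 1)"
proof -
  let ?D = "{..<d}" and ?I = "{..<d} \<times> {..<d}"
  have \<rho>: "\<rho> \<in> carrier_mat d d" and T: "T \<in> carrier_mat (d * d) (d * d)"
    using v by (auto simp: lovasz_sdp_def herm_mat_def)
  have Zc: "Z \<in> carrier_mat (d * d) (d * d)" using Z by (simp add: psd_def)
  have G: "kron (1\<^sub>m d) \<rho> + T \<in> carrier_mat (d * d) (d * d)" using T by simp
  define R where "R = (\<lambda>p q. one_kron (mat_fun \<rho>) p q + tensor_fun d T p q)"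
  have "mtrace (Z * (kron (1\<^sub>m d) \<rho> + T)) = hsip ?I (tensor_fun d Z) R"
    unfolding mtrace_mult_herm[OF psd_imp_herm[OF Z] G] hsip_tensor_fun
    by (rule hsip_cong) (simp_all add: kron_one_add[OF \<rho> T] R_def)
  then have 1: "Re (mtrace (Z * (kron (1\<^sub>m d) \<rho> + T))) = Re (hsip ?I R (tensor_fun d Z))"
    using hsip_swap[of ?I "tensor_fun d Z" R] by simp
  have 2: "Re (mtrace (W * \<rho>)) = Re (hsip ?D (mat_fun \<rho>) (mat_fun W))"
    using mtrace_mult_herm[OF psd_imp_herm[OF W] \<rho>] hsip_swap[of ?D "mat_fun W" "mat_fun \<rho>"] by simp
  have 3: "Re (mtrace \<rho>) = Re (hsip ?D (mat_fun \<rho>) fun_one)"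
    using \<rho> hsip_swap[of ?D "mat_fun \<rho>" fun_one] hsip_fun_one[of ?D "mat_fun \<rho>"]
    by (simp add: mtrace_def mat_fun_def)
  have 4: "sdp_obj (lovasz_sdp d S) (\<rho>, T) = Re (hsip ?I R fun_ent)"
    using sdp_obj_lovasz_sdp[OF \<rho> T] hsip_swap[of ?I R fun_ent] by (simp add: R_def)
  have 5: "hsip ?I X (tensor_fun d (ent_mat d + Z)) = hsip ?I X fun_ent + hsip ?I X (tensor_fun d Z)" for X
    unfolding hsip_add_right[symmetric]
    by (rule hsip_cong) (simp_all add: tensor_fun_add[OF ent_mat_carrier Zc] tensor_fun_ent_mat)
  have "sdp_lagrangian (lovasz_sdp d S) [Z, W] [\<mu>] (\<rho>, T) = sdp_obj (lovasz_sdp d S) (\<rho>, T)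
    + Re (mtrace (Z * (kron (1\<^sub>m d) \<rho> + T))) + Re (mtrace (W * \<rho>)) + \<mu> * (Re (mtrace \<rho>) - 1)"
    by (simp add: sdp_lagrangian_def lovasz_sdp_def lessThan_Suc numeral_2_eq_2)
  also have "\<dots> = Re (hsip ?I R (tensor_fun d (ent_mat d + Z)))
    + Re (hsip ?D (mat_fun \<rho>) (mat_fun W)) + \<mu> * (Re (hsip ?D (mat_fun \<rho>) fun_one) - 1)"
    unfolding 1 2 3 4 5 by simp
  finally show ?thesis by (simp add: R_def hsip_add_left hsip_one_kron)
qed

lemma sdp_multipliers_lovasz:
  "([Z, W], [\<mu>]) \<in> sdp_multipliers (lovasz_sdp d S) \<longleftrightarrow> psd (d * d) Z \<and> psd d W"
  by (simp add: sdp_multipliers_def lovasz_sdp_def)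

text \<open>The multipliers are the slacks \<open>Y - \<Phi>\<close> and
  \<open>t 1 - Tr_A Y\<close>, together with \<open>\<mu> = - t\<close>. Both coefficients of the
  Lagrangian then act as 0 on the variables, leaving the constant \<open>t\<close>.\<close>

lemma lovasz_dual_multipliers:
  assumes d: "0 < d" and S: "noncomm_graph d S"
    and Yc: "Y \<in> carrier_mat (d * d) (d * d)" and Y: "dual_form d S t (tensor_fun d Y)"
  shows "\<exists>Z W \<mu>. ([Z, W], [\<mu>]) \<in> sdp_multipliers (lovasz_sdp d S) \<and>
         Y = ent_mat d + Z \<and> sdp_dual_obj (lovasz_sdp d S) [Z, W] [\<mu>] \<le> ereal t"
proof -
  let ?D = "{..<d}" and ?I = "{..<d} \<times> {..<d}"
  have Sc: "S \<subseteq> carrier_mat d d" using S subspace_matD(1) by (auto simp: noncomm_graph_def)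
  have y: "tensor_fun d Y \<in> block_space d d S" "pos_form ?I (\<lambda>p q. tensor_fun d Y p q - fun_ent p q)"
    "pos_form ?D (\<lambda>k l. of_real t * fun_one k l - fun_ptrace d (tensor_fun d Y) k l)"
    using Y by (auto simp: dual_form_def)
  define Z where "Z = Y - ent_mat d"
  define W where "W = mat d d (\<lambda>(k, l). of_real t * fun_one k l - fun_ptrace d (tensor_fun d Y) k l)"
  have Zc: "Z \<in> carrier_mat (d * d) (d * d)" by (simp add: Z_def minus_carrier_mat)
  have "pos_form ?I (tensor_fun d Z)"
    using y(2) by (subst pos_form_cong[of ?I _ "\<lambda>p q. tensor_fun d Y p q - fun_ent p q"])
      (simp_all add: Z_def tensor_fun_minus[OF Yc ent_mat_carrier] tensor_fun_ent_mat)
  then have Z: "psd (d * d) Z" using Zc by (simp add: psd_tensor_iff)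
  have Wf: "mat_fun W k l = of_real t * fun_one k l - fun_ptrace d (tensor_fun d Y) k l" if "k \<in> ?D" "l \<in> ?D" for k l
    using that by (simp add: W_def mat_fun_def)
  have "pos_form ?D (mat_fun W)
      \<longleftrightarrow> pos_form ?D (\<lambda>k l. of_real t * fun_one k l - fun_ptrace d (tensor_fun d Y) k l)"
    by (rule pos_form_cong) (rule Wf)
  then have W: "psd d W" using y(3) by (simp add: psd_iff_pos_form W_def)
  have YZ: "Y = ent_mat d + Z"
    using Yc by (intro eq_matI) (auto simp: Z_def ent_mat_def)
  have "sdp_dual_obj (lovasz_sdp d S) [Z, W] [- t] \<le> ereal t"
    unfolding sdp_dual_obj_def
  proof (rule SUP_least)
    fix x assume "x \<in> sdp_vars (lovasz_sdp d S)"
    then obtain \<rho> T where x: "x = (\<rho>, T)" "(\<rho>, T) \<in> sdp_vars (lovasz_sdp d S)" by (cases x) auto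
    have "tensor_fun d T \<in> block_space d d (hs_perp d S)"
      using x(2) by (simp add: lovasz_sdp_def tensor_space_iff[OF subspace_hs_perp[OF Sc]])
    then have T_eq: "hsip ?I (tensor_fun d T) (tensor_fun d Y) = 0" by (rule hsip_block_space_perp[OF Sc _ y(1)])
    have W_eq: "hsip ?D (mat_fun \<rho>) (mat_fun W)
        = of_real t * hsip ?D (mat_fun \<rho>) fun_one - hsip ?D (mat_fun \<rho>) (fun_ptrace d (tensor_fun d Y))"
      unfolding hsip_scale_right[symmetric] hsip_diff_right[symmetric] by (rule hsip_cong) (simp_all add: Wf)
    have "sdp_lagrangian (lovasz_sdp d S) [Z, W] [- t] x = t"
      unfolding x(1) lovasz_lagrangian[OF Z W x(2)] YZ[symmetric] W_eq T_eq by (simp add: right_diff_distrib)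
    then show "ereal (sdp_lagrangian (lovasz_sdp d S) [Z, W] [- t] x) \<le> ereal t" by simp
  qed
  then show ?thesis using Z W YZ by (auto simp: sdp_multipliers_lovasz)
qed

lemma linear_bounded_eq_0:
  fixes a b t :: real
  assumes "\<And>s. s * a + b \<le> t"
  shows "a = 0"
proof (rule ccontr)
  assume "a \<noteq> 0"
  then show False using assms[of "(t - b + 1) / a"] by simp
qed

text \<open>The Lagrangian is affine, so it is bounded above only if its linear part vanishes.\<close>

lemma dual_form_of_multipliers:
  assumes d: "0 < d" and S: "noncomm_graph d S" and Z: "psd (d * d) Z" and W: "psd d W"
    and obj: "sdp_dual_obj (lovasz_sdp d S) [Z, W] [\<mu>] \<le> ereal t"
  shows "dual_form d S t (tensor_fun d (ent_mat d + Z))"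
proof -
  let ?D = "{..<d}" and ?I = "{..<d} \<times> {..<d}"
  have sub: "VectorSpace.subspace class_ring S (mat_space d)" and adj: "mat_adjoint ` S = S"
    using S by (auto simp: noncomm_graph_def)
  note Sc = subspace_matD(1)[OF sub] and sub' = subspace_hs_perp[OF subspace_matD(1)[OF sub]]
  define Y where "Y = tensor_fun d (ent_mat d + Z)"
  have Zc: "Z \<in> carrier_mat (d * d) (d * d)" using Z by (simp add: psd_def)
  have Zpos: "pos_form ?I (tensor_fun d Z)" using Z by (simp add: psd_tensor_iff)
  have "pos_form ?I (\<lambda>p q. Y p q - fun_ent p q) \<longleftrightarrow> pos_form ?I (tensor_fun d Z)"
    by (rule pos_form_cong) (simp add: Y_def tensor_fun_add[OF ent_mat_carrier Zc] tensor_fun_ent_mat)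
  then have Y_ge: "pos_form ?I (\<lambda>p q. Y p q - fun_ent p q)" using Zpos by simp
  have Y_herm: "herm_form ?I Y" by (rule pos_form_herm[OF _ pos_form_of_ge_ent[OF Y_ge]]) simp
  have zero_in: "(0\<^sub>m d d, 0\<^sub>m (d * d) (d * d)) \<in> sdp_vars (lovasz_sdp d S)"
  proof -
    have "tensor_fun d (0\<^sub>m (d * d) (d * d)) \<in> block_space d d (hs_perp d S)"
      by (rule block_space_local[OF block_space_zero[OF sub']]) (auto simp: tensor_fun_def tensor_index_less)
    then show ?thesis by (simp add: lovasz_sdp_def herm_mat_iff tensor_space_iff[OF sub'])
  qed
  have vars: "(\<rho>, T) \<in> sdp_vars (lovasz_sdp d S) \<Longrightarrow> sdp_lagrangian (lovasz_sdp d S) [Z, W] [\<mu>] (\<rho>, T) \<le> t" for \<rho> T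
    using obj unfolding sdp_dual_obj_def SUP_le_iff by fastforce
  have h0: "hsip J X Y = 0" if "\<And>i j. i \<in> J \<Longrightarrow> j \<in> J \<Longrightarrow> X i j = 0" for J :: "'j set" and X Y
    unfolding hsip_def by (intro sum.neutral ballI) (simp add: that)
  have z1: "hsip ?D (mat_fun (0\<^sub>m d d)) X = 0" for X by (rule h0) (simp add: mat_fun_def)
  have z2: "hsip ?I (tensor_fun d (0\<^sub>m (d * d) (d * d))) X = 0" for X
    by (rule h0) (auto simp: tensor_fun_def tensor_index_less)
  have mu: "- \<mu> \<le> t" using vars[OF zero_in] by (simp add: lovasz_lagrangian[OF Z W zero_in] z1 z2)
  \<comment> \<open>Varying \<open>\<rho>\<close> over real multiples of rank-one forms gives
    \<open>Tr_A Y + W + \<mu> 1 = 0\<close> as a quadratic form. With \<open>W \<ge> 0\<close> and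
    \<open>- \<mu> \<le> t\<close> this becomes \<open>Tr_A Y \<le> t 1\<close>.\<close>
  have trace_part: "Re (sesq ?D (fun_ptrace d Y) x x) + Re (sesq ?D (mat_fun W) x x) + \<mu> * sqnorm ?D x = 0" for x
  proof (rule linear_bounded_eq_0)
    fix s :: real
    define \<rho> where "\<rho> = mat d d (\<lambda>(i, j). of_real s * (x i * cnj (x j)))"
    have v: "(\<rho>, 0\<^sub>m (d * d) (d * d)) \<in> sdp_vars (lovasz_sdp d S)"
      using zero_in by (auto simp: lovasz_sdp_def herm_mat_iff \<rho>_def)
    have "hsip ?D (mat_fun \<rho>) X = of_real s * sesq ?D X x x" for X
    proof -
      have "hsip ?D (mat_fun \<rho>) X = (\<Sum>i<d. \<Sum>j<d. of_real s * (cnj (x i) * X i j * x j))"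
        unfolding hsip_def by (intro sum.cong refl) (simp add: \<rho>_def mat_fun_def)
      then show ?thesis by (simp add: sesq_def sum_distrib_left)
    qed
    then have "sdp_lagrangian (lovasz_sdp d S) [Z, W] [\<mu>] (\<rho>, 0\<^sub>m (d * d) (d * d))
       = s * (Re (sesq ?D (fun_ptrace d Y) x x) + Re (sesq ?D (mat_fun W) x x) + \<mu> * sqnorm ?D x) + - \<mu>"
      by (simp add: lovasz_lagrangian[OF Z W v] z2 Y_def sesq_fun_one_self algebra_simps)
    then show "s * (Re (sesq ?D (fun_ptrace d Y) x x) + Re (sesq ?D (mat_fun W) x x) + \<mu> * sqnorm ?D x) + - \<mu> \<le> t"
      using vars[OF v] by simp
  qed
  \<comment> \<open>Varying \<open>T\<close> over Hermitian elements of
    \<open>S^\<bottom> \<otimes> L(A')\<close>; closure of \<open>S\<close> under adjoints then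
    extends the orthogonality to the whole space, and the double complement places \<open>Y\<close>
    in \<open>S \<otimes> L(A')\<close>.\<close>
  have orth: "Re (hsip ?I Y R) = 0" if R: "R \<in> block_space d d (hs_perp d S)" "herm_form ?I R" for R
  proof (rule linear_bounded_eq_0)
    fix s :: real
    define T where "T = tensor_mat d d (\<lambda>p q. 0 + of_real s * R p q)"
    have Tf: "tensor_fun d T p q = of_real s * R p q" if "p \<in> ?I" "q \<in> ?I" for p q
      using that by (simp add: T_def tensor_fun_tensor_mat)
    have "(\<lambda>p q. 0 + of_real s * R p q) \<in> block_space d d (hs_perp d S)"
      by (rule block_space_lin[OF sub' block_space_zero[OF sub'] R(1)])
    then have Tb: "tensor_fun d T \<in> block_space d d (hs_perp d S)"
      by (rule block_space_local) (simp add: T_def tensor_fun_tensor_mat)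
    have "herm_mat (d * d) T"
      unfolding herm_mat_iff
    proof (intro conjI allI impI)
      fix a b assume ab: "a < d * d" "b < d * d"
      have "(a div d, a mod d) \<in> ?I" "(b div d, b mod d) \<in> ?I"
        using ab d by (simp_all add: less_mult_imp_div_less)
      then have "R (a div d, a mod d) (b div d, b mod d) = cnj (R (b div d, b mod d) (a div d, a mod d))"
        using R(2) unfolding herm_form_def by simp
      then show "T $$ (a, b) = cnj (T $$ (b, a))" using ab by (simp add: T_def tensor_mat_def)
    qed (simp add: T_def)
    then have v: "(0\<^sub>m d d, T) \<in> sdp_vars (lovasz_sdp d S)"
      using zero_in Tb by (auto simp: lovasz_sdp_def tensor_space_iff[OF sub'] T_def)
    have "hsip ?I (tensor_fun d T) Y = hsip ?I (\<lambda>p q. of_real s * R p q) Y"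
      by (rule hsip_cong) (simp_all add: Tf)
    then have "Re (hsip ?I (tensor_fun d T) Y) = s * Re (hsip ?I Y R)"
      using hsip_swap[of ?I Y R] by (simp add: hsip_scale_left)
    then have "sdp_lagrangian (lovasz_sdp d S) [Z, W] [\<mu>] (0\<^sub>m d d, T) = s * Re (hsip ?I Y R) + - \<mu>"
      by (simp add: lovasz_lagrangian[OF Z W v] z1 Y_def[symmetric])
    then show "s * Re (hsip ?I Y R) + - \<mu> \<le> t" using vars[OF v] by simp
  qed
  have "hsip ?I Y R = 0" if "R \<in> block_space d d (hs_perp d S)" for R
    by (rule hsip_eq_0_of_hermitian[where V = "block_space d d (hs_perp d S)", OF _ _ Y_herm orth that])
      (auto intro: block_space_lin[OF sub'] block_space_adjoint hs_perp_adjoint[OF Sc adj])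
  then have "Y \<in> block_space d d (hs_perp d (hs_perp d S))" by (rule block_space_hs_perpI[OF sub'])
  then have "Y \<in> block_space d d S" by (simp add: hs_perp_hs_perp[OF sub])
  moreover have "pos_form ?D (\<lambda>k l. of_real t * fun_one k l - fun_ptrace d Y k l)"
  proof -
    have fin: "finite ?D" by simp
    have "herm_form ?D (fun_ptrace d Y)"
      by (rule pos_form_herm[OF fin pos_form_fun_ptrace[OF pos_form_of_ge_ent[OF Y_ge]]])
    moreover have "Re (sesq ?D (fun_ptrace d Y) x x) \<le> t * sqnorm ?D x" for x
    proof -
      have "0 \<le> Re (sesq ?D (mat_fun W) x x)"
        using W by (auto simp: psd_iff_pos_form pos_form_def less_eq_complex_def)
      moreover have "- \<mu> * sqnorm ?D x \<le> t * sqnorm ?D x" by (rule mult_right_mono[OF mu sqnorm_nonneg])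
      ultimately show ?thesis using trace_part[of x] by simp
    qed
    ultimately show ?thesis using pos_form_one_diff_iff[OF fin] by blast
  qed
  ultimately show ?thesis using Y_ge by (simp add: dual_form_def Y_def)
qed

theorem theorem9:
  fixes d :: nat and S :: "complex mat set"
  assumes "0 < d" and "noncomm_graph d S"
  shows "(\<exists>Y\<in>lovasz_min_feasible d S. quantum_lovasz d S = ereal (op_norm (ptrace_fst d d Y))) \<and>
    (\<forall>Y\<in>lovasz_min_feasible d S. quantum_lovasz d S \<le> ereal (op_norm (ptrace_fst d d Y))) \<and>
    sdp_value (lovasz_sdp d S) = quantum_lovasz d S \<and>
    (\<forall>Y t. Y \<in> lovasz_min_feasible d S \<and> op_norm (ptrace_fst d d Y) \<le> t \<longleftrightarrow>
      (\<exists>Z W \<mu>. ([Z, W], [\<mu>]) \<in> sdp_multipliers (lovasz_sdp d S) \<and>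
         Y = ent_mat d + Z \<and> sdp_dual_obj (lovasz_sdp d S) [Z, W] [\<mu>] \<le> ereal t))"
proof -
  note d = assms(1) and S = assms(2)
  have sub: "VectorSpace.subspace class_ring S (mat_space d)" using S by (simp add: noncomm_graph_def)
  note Sc = subspace_matD(1)[OF sub] and dual_iff = dual_form_iff[OF d sub]
  let ?I = "{..<d} \<times> {..<d}"
  define s where "s = lovasz_theta (d * d) (tensor_space d S d (carrier_mat d d))"
  note vals = quantum_lovasz_eq[OF d S, folded s_def]
  have lower: "s \<le> op_norm (ptrace_fst d d Y)" if "Y \<in> lovasz_min_feasible d S" for Y
  proof -
    have "dual_form d S (op_norm (ptrace_fst d d Y)) (tensor_fun d Y)"
      using dual_iff[of Y "op_norm (ptrace_fst d d Y)"] that by simp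
    then show ?thesis
      unfolding s_def using weak_duality[OF Sc] by (intro lovasz_theta_le_primal_bound[OF d d S]) blast
  qed
  \<comment> \<open>At \<open>t = s\<close> no primal point exceeds the level, so the alternative
    yields an exact dual point: the minimum is attained.\<close>
  obtain Y where Y: "dual_form d S s Y"
    using dual_form_attained[OF d S, of s] primal_value_le_theta[OF d S] unfolding s_def by blast
  \<comment> \<open>\<open>Y\<close> is a function with arbitrary values off the index set; its
    matrix keeps exactly the relevant entries.\<close>
  have eq: "tensor_fun d (tensor_mat d d Y) p q = Y p q" if "p \<in> ?I" "q \<in> ?I" for p q
    using that by (simp add: tensor_fun_tensor_mat)
  have "dual_form d S s (tensor_fun d (tensor_mat d d Y))"
    unfolding dual_form_def
  proof (intro conjI)
    show "tensor_fun d (tensor_mat d d Y) \<in> block_space d d S"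
      by (rule block_space_local[of Y]) (use Y eq in \<open>simp_all add: dual_form_def\<close>)
    show "pos_form ?I (\<lambda>p q. tensor_fun d (tensor_mat d d Y) p q - fun_ent p q)"
      using Y by (subst pos_form_cong[of ?I _ "\<lambda>p q. Y p q - fun_ent p q"]) (simp_all add: eq dual_form_def)
    show "pos_form {..<d} (\<lambda>k l. of_real s * fun_one k l - fun_ptrace d (tensor_fun d (tensor_mat d d Y)) k l)"
      using Y by (subst pos_form_cong[of "{..<d}" _ "\<lambda>k l. of_real s * fun_one k l - fun_ptrace d Y k l"])
        (simp_all add: fun_ptrace_def eq dual_form_def)
  qed
  then have "tensor_mat d d Y \<in> lovasz_min_feasible d S" "op_norm (ptrace_fst d d (tensor_mat d d Y)) \<le> s"
    using dual_iff[of "tensor_mat d d Y" s] by simp_all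
  then have "\<exists>Y\<in>lovasz_min_feasible d S. quantum_lovasz d S = ereal (op_norm (ptrace_fst d d Y))"
    using lower vals(1) by (metis order_antisym)
  moreover have "\<forall>Y\<in>lovasz_min_feasible d S. quantum_lovasz d S \<le> ereal (op_norm (ptrace_fst d d Y))"
    using lower vals(1) by simp
  moreover have "Y \<in> lovasz_min_feasible d S \<and> op_norm (ptrace_fst d d Y) \<le> t \<longleftrightarrow>
      (\<exists>Z W \<mu>. ([Z, W], [\<mu>]) \<in> sdp_multipliers (lovasz_sdp d S) \<and>
         Y = ent_mat d + Z \<and> sdp_dual_obj (lovasz_sdp d S) [Z, W] [\<mu>] \<le> ereal t)" (is "_ \<longleftrightarrow> ?R") for Y t
    unfolding dual_iff
  proof
    assume "Y \<in> carrier_mat (d * d) (d * d) \<and> dual_form d S t (tensor_fun d Y)"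
    then show ?R using lovasz_dual_multipliers[OF d S] by blast
  next
    assume ?R
    then obtain Z W \<mu> where Z: "psd (d * d) Z" "psd d W" "Y = ent_mat d + Z"
      "sdp_dual_obj (lovasz_sdp d S) [Z, W] [\<mu>] \<le> ereal t"
      by (auto simp: sdp_multipliers_lovasz)
    then have "Y \<in> carrier_mat (d * d) (d * d)" by (simp add: psd_def)
    moreover have "dual_form d S t (tensor_fun d Y)"
      using dual_form_of_multipliers[OF d S Z(1,2,4)] Z(3) by simp
    ultimately show "Y \<in> carrier_mat (d * d) (d * d) \<and> dual_form d S t (tensor_fun d Y)" by blast
  qed
  ultimately show ?thesis using vals by simp
qed

end
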